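(* For any constants $D>1$ and $\eta>0$ there exist constants $C=C(D,\eta)\ge 1$ and $C'=C'(D,\eta)\ge1$ with the following property. Let $G=(V,E)$ be a graph with a $(D,\eta)$-good embedding with all edge weights in $[D^{-1},D]$. Then for any vertex $u$ and any $r\ge r_u$ with $B_{\mathrm{euc}}(u,Cr)\subset\operatorname{carr}(G)$, $$\frac{1}{C'}\,r^2\le \mathbb{E}_u\sum_{t=0}^{T_r}r_{X_t}^2\le C'\,r^2,$$ where $T_r=\tau_{\partial V_{\mathrm{euc}}(u,r)}$ is the first exit time from $V_{\mathrm{euc}}(u,r)$.
   Context: $G=(V,E)$ is an infinite, connected, simple planar graph. An embedding with straight lines maps vertices to points of $\mathbb{R}^2$ and each edge to the straight segment between its endpoints, with no two edges crossing. A vertex is identified with its image. For $D\in(1,\infty)$, $\eta>0$ such an embedding is $(D,\eta)$-good if: (a) for any face, all the inner angles are at most $\pi-\eta$ (in particular all faces are convex, there is no outer face, and the number of edges in a face is at most $2\pi/\eta$); (b) for any two adjacent edges $(u,v)$ and $(u,w)$, $|u-w|/|u-v|\in[D^{-1},D]$. The carrier $\operatorname{carr}(G)$ is the union of all the closed faces of the embedding. Edges carry positive weights $\{w_e\}$; the weighted random walk $\{X_n\}$ moves from $v$ to a neighbor $w$ with probability $w_{(v,w)}/\sum_{z\sim v}w_{(v,z)}$, and $\mathbb{E}_u$ is expectation for the walk started at $u$. $B_{\mathrm{euc}}(u,r)=\{y\in\mathbb{R}^2:|u-y|\le r\}$ and $V_{\mathrm{euc}}(u,r)=V\cap B_{\mathrm{euc}}(u,r)$.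 For $S\subset V$, $\partial S$ is the set of vertices not in $S$ with a neighbor in $S$. For $A\subset V$, $\tau_A=\min\{n:X_n\in A\}$ (or $\infty$ if $A$ is never hit). For $u\in V$, the radius of isolation is $r_u=\min_{v\in V\setminus\{u\}}|u-v|$. *)

theory Defs
  imports "HOL-Probability.Probability"
begin

section \<open>Straight-line embeddings\<close>

text \<open>
  The Euclidean plane is represented by the type of complex numbers.  Vertices are
  identified with their images: a graph is a set \<open>V\<close> of points and a set \<open>E\<close> of
  two-element subsets of \<open>V\<close>, and \<open>convex hull {u, v}\<close> is the segment that draws
  the edge \<open>{u, v}\<close>.
\<close>

definition simple_graph :: "complex set \<Rightarrow> complex set set \<Rightarrow> bool" where
  "simple_graph V E \<longleftrightarrow> (\<forall>e\<in>E. \<exists>u\<in>V. \<exists>v\<in>V. u \<noteq> v \<and> e = {u, v})"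

definition connected_graph :: "complex set \<Rightarrow> complex set set \<Rightarrow> bool" where
  "connected_graph V E \<longleftrightarrow> (\<forall>u\<in>V. \<forall>v\<in>V. (\<lambda>x y. {x, y} \<in> E)\<^sup>*\<^sup>* u v)"

definition neighbours :: "complex set set \<Rightarrow> complex \<Rightarrow> complex set" where
  "neighbours E v = {x. {v, x} \<in> E}"

text \<open>
  Two edges may meet only in a common endpoint.  In a connected graph with an edge this
  also prevents a vertex from lying in the interior of an edge.
\<close>

definition straight_embedding :: "complex set \<Rightarrow> complex set set \<Rightarrow> bool" where
  "straight_embedding V E \<longleftrightarrow>
     infinite V \<and> simple_graph V E \<and> connected_graph V E \<and>
     (\<forall>e\<in>E. \<forall>f\<in>E. e \<noteq> f \<longrightarrow> convex hull e \<inter> convex hull f \<subseteq> e \<inter> f)"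

definition skeleton :: "complex set set \<Rightarrow> complex set" where
  "skeleton E = (\<Union>e\<in>E. convex hull e)"

text \<open>
  A face is a component of the complement of the drawing that is bounded by edges.  The
  condition on the frontier matters because vertices may accumulate in the plane: if, say,
  the graph fills the open unit disc, then the complement of the disc is a component of the
  complement of the drawing, but its frontier is disjoint from the drawing, and it is not a
  face.  Faces are open sets, as they are disjoint from their frontiers.
\<close>

definition faces :: "complex set set \<Rightarrow> complex set set" where
  "faces E = {F \<in> components (- skeleton E). frontier F \<subseteq> skeleton E}"

definition carr :: "complex set set \<Rightarrow> complex set" where
  "carr E = (\<Union>F\<in>faces E. closure F)"

definition side_of_face :: "complex set \<Rightarrow> complex set \<Rightarrow> bool" where
  "side_of_face e F \<longleftrightarrow> convex hull e \<subseteq> frontier F"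

text \<open>
  The angle at \<open>v\<close> between the segments to \<open>a\<close> and \<open>b\<close>, in \<open>[0, \<pi>]\<close>.  It is the inner angle of
  a convex face at \<open>v\<close> if \<open>{v, a}\<close> and \<open>{v, b}\<close> are the two sides of the face at \<open>v\<close>.
\<close>

definition angle_at :: "complex \<Rightarrow> complex \<Rightarrow> complex \<Rightarrow> real" where
  "angle_at v a b = \<bar>Arg ((a - v) / (b - v))\<bar>"

text \<open>
  All inner angles of all faces are at most \<open>\<pi> - \<eta>\<close>.  Convexity of the faces, and the absence
  of an outer face or of any other boundary (every edge has a face on both sides), are part
  of this condition and are stated explicitly.
\<close>

definition inner_angles_bounded :: "real \<Rightarrow> complex set set \<Rightarrow> bool" where
  "inner_angles_bounded \<eta> E \<longleftrightarrow>
     (\<forall>e\<in>E. \<exists>F\<in>faces E. \<exists>F'\<in>faces E. F \<noteq> F' \<and> side_of_face e F \<and> side_of_face e F') \<and>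
     (\<forall>F\<in>faces E. convex F \<and>
        (\<forall>v a b. {v, a} \<in> E \<and> {v, b} \<in> E \<and> a \<noteq> b \<and>
           side_of_face {v, a} F \<and> side_of_face {v, b} F \<longrightarrow> angle_at v a b \<le> pi - \<eta>))"

definition adjacent_ratios_bounded :: "real \<Rightarrow> complex set set \<Rightarrow> bool" where
  "adjacent_ratios_bounded D E \<longleftrightarrow>
     (\<forall>u v w. {u, v} \<in> E \<and> {u, w} \<in> E \<longrightarrow> dist u w / dist u v \<in> {1 / D .. D})"

definition good_embedding :: "real \<Rightarrow> real \<Rightarrow> complex set \<Rightarrow> complex set set \<Rightarrow> bool" where
  "good_embedding D \<eta> V E \<longleftrightarrow>
     straight_embedding V E \<and> inner_angles_bounded \<eta> E \<and> adjacent_ratios_bounded D E"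

definition isolation_radius :: "complex set \<Rightarrow> complex \<Rightarrow> real" where
  "isolation_radius V u = (INF v\<in>V - {u}. dist u v)"

definition V_euc :: "complex set \<Rightarrow> complex \<Rightarrow> real \<Rightarrow> complex set" where
  "V_euc V u r = V \<inter> cball u r"

definition vertex_boundary :: "complex set \<Rightarrow> complex set set \<Rightarrow> complex set \<Rightarrow> complex set" where
  "vertex_boundary V E S = {x \<in> V - S. \<exists>y\<in>S. {x, y} \<in> E}"


section \<open>The weighted random walk\<close>

definition walk_prob ::
  "(complex set \<Rightarrow> real) \<Rightarrow> complex set set \<Rightarrow> complex \<Rightarrow> complex \<Rightarrow> real" where
  "walk_prob wt E v x =
     (if {v, x} \<in> E then wt {v, x} / (\<Sum>z\<in>neighbours E v. wt {v, z}) else 0)"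

text \<open>
  Meaningful only if \<open>v\<close> has finite positive degree and the weights are positive;
  both hold at every vertex of a graph with a good embedding and weights bounded below.
\<close>

definition walk_step ::
  "(complex set \<Rightarrow> real) \<Rightarrow> complex set set \<Rightarrow> complex \<Rightarrow> complex pmf" where
  "walk_step wt E v = embed_pmf (walk_prob wt E v)"

lemma pmf_walk_step:
  assumes fin: "finite (neighbours E v)" and ne: "neighbours E v \<noteq> {}"
    and pos: "\<And>e. e \<in> E \<Longrightarrow> wt e > 0"
  shows "pmf (walk_step wt E v) x = walk_prob wt E v x"
proof -
  let ?N = "neighbours E v" and ?f = "walk_prob wt E v"
  have S: "(\<Sum>z\<in>?N. wt {v, z}) > 0"
    using fin ne pos by (intro sum_pos) (auto simp: neighbours_def)
  have nonneg: "0 \<le> ?f x" for x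
    using S pos[of "{v, x}"] by (auto simp: walk_prob_def intro!: divide_nonneg_pos)
  have "(\<integral>\<^sup>+x. ennreal (?f x) \<partial>count_space UNIV) = (\<Sum>x\<in>?N. ennreal (?f x))"
    using fin by (intro nn_integral_count_space') (auto simp: walk_prob_def neighbours_def)
  also have "\<dots> = ennreal (\<Sum>x\<in>?N. ?f x)"
    using nonneg by simp
  also have "(\<Sum>x\<in>?N. ?f x) = (\<Sum>x\<in>?N. wt {v, x} / (\<Sum>z\<in>?N. wt {v, z}))"
    by (intro sum.cong) (auto simp: walk_prob_def neighbours_def)
  also have "\<dots> = 1"
    using S by (simp flip: sum_divide_distrib)
  finally show ?thesis
    unfolding walk_step_def using nonneg by (intro pmf_embed_pmf) auto
qed

text \<open>
  The law on path space of the walk started at \<open>u\<close> is obtained from the Ionescu-Tulcea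
  extension theorem: position \<open>0\<close> is \<open>u\<close>, and position \<open>n + 1\<close> is drawn from the
  one-step distribution at position \<open>n\<close>.
\<close>

abbreviation discrete_plane :: "complex measure" where
  "discrete_plane \<equiv> count_space UNIV"

definition walk_kernel ::
  "(complex set \<Rightarrow> real) \<Rightarrow> complex set set \<Rightarrow> complex \<Rightarrow>
     nat \<Rightarrow> (nat \<Rightarrow> complex) \<Rightarrow> complex measure" where
  "walk_kernel wt E u n \<omega> =
     (case n of 0 \<Rightarrow> measure_pmf (return_pmf u)
      | Suc m \<Rightarrow> measure_pmf (walk_step wt E (\<omega> m)))"

lemma walk_kernel_Ionescu_Tulcea:
  "Ionescu_Tulcea (walk_kernel wt E u) (\<lambda>_. discrete_plane)"
proof (rule Ionescu_Tulcea.intro)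
  fix i
  show "walk_kernel wt E u i \<in> PiM {0..<i} (\<lambda>_. discrete_plane) \<rightarrow>\<^sub>M subprob_algebra discrete_plane"
  proof (cases i)
    case 0
    then show ?thesis
      by (simp add: walk_kernel_def[abs_def] measurable_const space_subprob_algebra
          measure_pmf.subprob_space_axioms)
  next
    case (Suc m)
    have "(\<lambda>\<omega>. \<omega> m) \<in> PiM {0..<Suc m} (\<lambda>_. discrete_plane) \<rightarrow>\<^sub>M discrete_plane"
      by (rule measurable_component_singleton) simp
    moreover have "(\<lambda>v. measure_pmf (walk_step wt E v)) \<in> discrete_plane \<rightarrow>\<^sub>M subprob_algebra discrete_plane"
      by (simp add: space_subprob_algebra measure_pmf.subprob_space_axioms)
    ultimately have "(\<lambda>v. measure_pmf (walk_step wt E v)) \<circ> (\<lambda>\<omega>. \<omega> m)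
        \<in> PiM {0..<Suc m} (\<lambda>_. discrete_plane) \<rightarrow>\<^sub>M subprob_algebra discrete_plane"
      by (rule measurable_comp)
    with Suc show ?thesis
      by (simp add: walk_kernel_def[abs_def] comp_def)
  qed
next
  fix i and x :: "nat \<Rightarrow> complex"
  show "prob_space (walk_kernel wt E u i x)"
    by (simp add: walk_kernel_def measure_pmf.prob_space_axioms split: nat.split)
qed

interpretation walk: Ionescu_Tulcea "walk_kernel wt E u" "\<lambda>_. discrete_plane" for wt E u
  by (rule walk_kernel_Ionescu_Tulcea)

definition walk_law ::
  "(complex set \<Rightarrow> real) \<Rightarrow> complex set set \<Rightarrow> complex \<Rightarrow> (nat \<Rightarrow> complex) measure" where
  "walk_law wt E u = walk.PF.lim wt E u"

lemma walk_cylinder_aux: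
  "emeasure (walk.C wt E u 0 n (\<lambda>_. undefined)) {restrict x {0..<n}} =
     (\<Prod>i<n. emeasure (walk_kernel wt E u i x) {x i})"
proof (induction n)
  case 0
  have "restrict x {} = (\<lambda>_. undefined)" by (auto simp: restrict_def)
  then show ?case by (simp add: PiM_empty)
next
  case (Suc n)
  let ?M = "\<lambda>_ :: nat. discrete_plane"
  let ?r = "\<lambda>n. restrict x {0..<n}"
  let ?\<mu> = "walk.C wt E u 0 n (\<lambda>_. undefined)"
  let ?k = "emeasure (walk_kernel wt E u n x) {x n}"
  have S: "{?r m} \<in> sets (PiM {0..<m} ?M)" for m
  proof -
    have "PiE {0..<m} (\<lambda>i. {x i}) \<in> sets (PiM {0..<m} ?M)"
      by (intro sets_PiM_I_finite) auto
    also have "PiE {0..<m} (\<lambda>i. {x i}) = {?r m}"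
      by (auto simp: PiE_iff fun_eq_iff extensional_def restrict_def)
    finally show ?thesis .
  qed
  have undef: "(\<lambda>_. undefined) \<in> space (PiM {0..<0} ?M)"
    by (simp add: space_PiM)
  have sp: "space ?\<mu> = space (PiM {0..<n} ?M)"
    using walk.space_C[OF undef] by simp
  have st: "sets ?\<mu> = sets (PiM {0..<n} ?M)"
    using walk.sets_C[OF undef] by simp
  have step: "emeasure (walk.eP wt E u n \<omega>) {?r (Suc n)} = ?k * indicator {?r n} \<omega>"
    if \<omega>: "\<omega> \<in> space (PiM {0..<n} ?M)" for \<omega>
  proof -
    have ext: "\<omega> \<in> extensional {0..<n}"
      using \<omega> by (simp add: space_PiM PiE_iff)
    have "emeasure (walk.eP wt E u n \<omega>) {?r (Suc n)} =
        emeasure (walk_kernel wt E u n \<omega>) (fun_upd \<omega> n -` {?r (Suc n)} \<inter> UNIV)"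
      using walk.emeasure_eP[OF \<omega> S] by simp
    also have "fun_upd \<omega> n -` {?r (Suc n)} \<inter> UNIV = (if \<omega> = ?r n then {x n} else {})"
    proof -
      have "fun_upd \<omega> n y = ?r (Suc n) \<longleftrightarrow> \<omega> = ?r n \<and> y = x n" for y
      proof
        assume *: "fun_upd \<omega> n y = ?r (Suc n)"
        have "\<omega> i = ?r n i" for i
          using fun_cong[OF *, of i] ext by (cases "i < n") (auto simp: extensional_def)
        then show "\<omega> = ?r n \<and> y = x n"
          using fun_cong[OF *, of n] by auto
      qed (auto simp: restrict_def fun_eq_iff)
      then show ?thesis by auto
    qed
    also have "emeasure (walk_kernel wt E u n \<omega>) \<dots> = ?k * indicator {?r n} \<omega>"
      by (auto simp: walk_kernel_def split: nat.split)
    finally show ?thesis .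
  qed
  have "emeasure (walk.C wt E u 0 (Suc n) (\<lambda>_. undefined)) {?r (Suc n)} =
      (\<integral>\<^sup>+\<omega>. emeasure (walk.eP wt E u n \<omega>) {?r (Suc n)} \<partial>?\<mu>)"
    using walk.measurable_eP[of wt E u n] sp S[of "Suc n"] walk.space_PiM_not_empty
    by (simp, subst emeasure_bind[where N = "PiM {0..<Suc n} ?M"])
       (auto simp: measurable_cong_sets[OF st refl] space_PiM PiE_eq_empty_iff)
  also have "\<dots> = (\<integral>\<^sup>+\<omega>. ?k * indicator {?r n} \<omega> \<partial>?\<mu>)"
    using sp step by (intro nn_integral_cong) auto
  also have "\<dots> = ?k * emeasure ?\<mu> {?r n}"
    using S[of n] st by (intro nn_integral_cmult_indicator) auto
  finally show ?case
    by (simp only: Suc.IH prod.lessThan_Suc mult.commute)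
qed

text \<open>The defining property of the walk: the probability of following a given finite path.\<close>

lemma emeasure_walk_law_cylinder:
  "emeasure (walk_law wt E u) {X. \<forall>i\<le>n. X i = x i} =
     (if x 0 = u then ennreal (\<Prod>i<n. pmf (walk_step wt E (x i)) (x (Suc i))) else 0)"
proof -
  let ?M = "\<lambda>_ :: nat. discrete_plane"
  let ?J = "{0..<Suc n}"
  let ?c = "{restrict x ?J}"
  have eq: "PiE ?J (\<lambda>i. {x i}) = ?c"
    by (auto simp: PiE_iff fun_eq_iff extensional_def restrict_def)
  have "PiE ?J (\<lambda>i. {x i}) \<in> sets (PiM ?J ?M)"
    by (intro sets_PiM_I_finite) auto
  then have S: "?c \<in> sets (PiM ?J ?M)"
    by (simp only: eq)
  have "{X. \<forall>i\<le>n. X i = x i} = prod_emb UNIV ?M ?J ?c"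
    by (auto simp: prod_emb_def space_PiM less_Suc_eq_le restrict_def fun_eq_iff) metis
  then have "emeasure (walk_law wt E u) {X. \<forall>i\<le>n. X i = x i} =
      emeasure (walk.CI wt E u ?J) ?c"
    using walk.lim[of ?J ?c wt E u] S by (simp add: walk_law_def)
  also have "\<dots> = emeasure (walk.C wt E u 0 (Suc n) (\<lambda>_. undefined)) ?c"
  proof -
    have "prod_emb ?J ?M ?J ?c = ?c"
      using S by (intro prod_emb_id) (auto simp: space_PiM)
    then show ?thesis
      using walk.emeasure_CI[of ?J "Suc n" ?c wt E u] S by simp
  qed
  also have "\<dots> = (\<Prod>i<Suc n. emeasure (walk_kernel wt E u i x) {x i})"
    by (rule walk_cylinder_aux)
  also have "\<dots> = (if x 0 = u then ennreal (\<Prod>i<n. pmf (walk_step wt E (x i)) (x (Suc i))) else 0)"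
    by (subst prod.lessThan_Suc_shift)
       (auto simp: walk_kernel_def emeasure_pmf_single prod_ennreal indicator_def)
  finally show ?thesis .
qed

definition hitting_time :: "complex set \<Rightarrow> (nat \<Rightarrow> complex) \<Rightarrow> enat" where
  "hitting_time A X = Inf (enat ` {n. X n \<in> A})"

text \<open>
  The sum over \<open>0 \<le> t \<le> T\<close>, which runs over all \<open>t\<close> if \<open>T = \<infinity>\<close>, as an extended nonnegative
  real.
\<close>

definition isolation_sum :: "complex set \<Rightarrow> enat \<Rightarrow> (nat \<Rightarrow> complex) \<Rightarrow> ennreal" where
  "isolation_sum V T X =
     (\<Sum>t. if enat t \<le> T then ennreal ((isolation_radius V (X t))\<^sup>2) else 0)"

end

theory Submission
  imports Defs
begin

text \<open>
  The expectation is \<open>\<Sum>v. G(u, v) r\<^sub>v\<^sup>2\<close> for the Green function \<open>G\<close> of the walk killed outside of the ball,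
  up to a boundary term, and both bounds come from energy arguments on the faces of the embedding.

  Geometry: the condition on the angles separates the normals at the corners of a face, so a face has boundedly
  many sides, hence sides of comparable length.  A face that is thin at one corner would have three small angles
  in one triangle, so angles are bounded below, degrees are bounded, and all distances around a vertex
  \<open>v\<close> or a face at \<open>v\<close> are comparable to \<open>r\<^sub>v\<close>.

  Upper bound: walking through faces along horizontal and vertical lines gives a Sobolev inequality and
  thereby the Faber-Krahn inequality \<open>\<Sum> r\<^sub>v\<^sup>2 f(v)\<^sup>2 \<le> Q m(supp f) \<E>(f, f)\<close>, where \<open>m(A) = \<Sum>v\<in>A. r\<^sub>v\<^sup>2\<close>;
  Stampacchia's truncation method turns it into a bound on the expected time.

  Lower bound: a level set \<open>{g \<ge> k}\<close> of the Green function with pole \<open>u\<close> is connected and, by comparison with a cutoff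
  function, reaches out to distance of order \<open>r\<close>.  As \<open>min g k\<close> has energy at most \<open>k\<close>, it oscillates
  by less than \<open>k / 2\<close> on some circle of radius of order \<open>r\<close> (Courant-Lebesgue), which the level set crosses.  So \<open>g \<ge> k / 2\<close> on
  the circle, and inside it by the minimum principle.
\<close>

section \<open>Plane geometry\<close>

text \<open>Monotone iterates of the Dirichlet problem on \<open>V_euc V u r\<close> with source
  \<open>deg x * m x\<close> are exactly the expected partial sums of the killed walk. So the upper
  bound is a sup bound on these iterates; for the lower bound, symmetry of the energy rewrites their
  limit at \<open>u\<close> as the sum of the source against the Green function, and no transition
  probability is ever estimated.

  The obstacle is that vertices may accumulate, so countability, finite degrees and local finiteness
  have to be extracted from the embedding; the ball has finitely many vertices because it is compact
  and inside the carrier. Geometry enters the analysis mainly through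
  \<open>face_diam_le_dist\<close>: a face within distance \<open>s\<close> of \<open>v\<close>,
  where \<open>s\<close> is at least the isolation radius of \<open>v\<close>, has diameter of order
  \<open>s\<close>. Hence the coordinate walks of length \<open>(K + 4) * r\<close> leave the
  support, which is why the disc of radius \<open>(K + 6) * r\<close> has to lie in the carrier, and
  no face joins two annuli. If \<open>r\<close> is comparable to the isolation radius of
  \<open>u\<close>, there is no room for annuli, but the term at time 0 alone is of order
  \<open>r\<close> squared.\<close>

definition crs :: "complex \<Rightarrow> complex \<Rightarrow> real" where
  "crs z w = Re z * Im w - Im z * Re w"

lemma crs_self [simp]: "crs z z = 0"
  by (simp add: crs_def)

lemma crs_zero [simp]: "crs 0 z = 0" "crs z 0 = 0"
  by (simp_all add: crs_def)

lemma crs_minus [simp]: "crs (- z) w = - crs z w" "crs z (- w) = - crs z w"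
  by (simp_all add: crs_def)

lemma crs_swap: "crs w z = - crs z w"
  by (simp add: crs_def)

lemma crs_add: "crs (z + z') w = crs z w + crs z' w" "crs z (w + w') = crs z w + crs z w'"
  by (simp_all add: crs_def algebra_simps)

lemma crs_diff: "crs (z - z') w = crs z w - crs z' w" "crs z (w - w') = crs z w - crs z w'"
  by (simp_all add: crs_def algebra_simps)

lemma crs_scaleR [simp]: "crs (t *\<^sub>R z) w = t * crs z w" "crs z (t *\<^sub>R w) = t * crs z w"
  by (simp_all add: crs_def algebra_simps)

text \<open>Lagrange's identity, that is, cos^2 + sin^2 = 1 for the angle between \<open>z\<close>
  and \<open>w\<close>.\<close>

lemma inner_sq_add_crs_sq: "(z \<bullet> w)\<^sup>2 + (crs z w)\<^sup>2 = (norm z)\<^sup>2 * (norm w)\<^sup>2"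
  unfolding cmod_power2 by (simp add: crs_def inner_complex_def power2_eq_square algebra_simps)

lemma abs_crs_le: "\<bar>crs z w\<bar> \<le> norm z * norm w"
proof -
  have "(crs z w)\<^sup>2 \<le> (norm z * norm w)\<^sup>2"
    using inner_sq_add_crs_sq[of z w] zero_le_power2[of "z \<bullet> w"]
    unfolding power_mult_distrib by linarith
  then show ?thesis
    by (metis abs_le_square_iff abs_mult abs_norm_cancel)
qed

text \<open>Cramer's rule, as \<open>crs\<close> is the determinant of two vectors. Through it, the
  signs of determinants decide whether \<open>z\<close> lies in the cone spanned by \<open>a\<close>
  and \<open>b\<close>.\<close>

lemma crs_coords:
  "crs a b *\<^sub>R z = crs z b *\<^sub>R a + crs a z *\<^sub>R b"
  by (rule complex_eqI) (simp_all add: crs_def algebra_simps)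

lemma inner_crs_coords:
  "(norm a)\<^sup>2 *\<^sub>R z = (a \<bullet> z) *\<^sub>R a + crs a z *\<^sub>R (\<i> * a)"
  unfolding cmod_power2
  by (rule complex_eqI) (simp_all add: crs_def inner_complex_def power2_eq_square algebra_simps)

text \<open>Divided by the right-hand side, this is cot A cot B + cot B cot C + cot C cot A = 1 for
  the angles of a triangle.\<close>

lemma crs_triangle_identity:
  fixes a b c :: complex
  shows "(b - a) \<bullet> (c - a) * ((a - b) \<bullet> (c - b)) + (a - b) \<bullet> (c - b) * ((a - c) \<bullet> (b - c))
    + (a - c) \<bullet> (b - c) * ((b - a) \<bullet> (c - a)) = (crs (a - b) (c - b))\<^sup>2"
  by (simp add: inner_complex_def crs_def power2_eq_square algebra_simps)

text \<open>The hypotheses say that all three cotangents are at least 1, but their pairwise products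
  add up to 1.\<close>

lemma no_three_small_angles:
  fixes a b c :: complex
  assumes "crs (a - b) (c - b) \<noteq> 0"
    and "(b - a) \<bullet> (c - a) \<ge> \<bar>crs (a - b) (c - b)\<bar>"
    and "(a - b) \<bullet> (c - b) \<ge> \<bar>crs (a - b) (c - b)\<bar>"
    and "(a - c) \<bullet> (b - c) \<ge> \<bar>crs (a - b) (c - b)\<bar>"
  shows False
proof -
  let ?d = "\<bar>crs (a - b) (c - b)\<bar>"
  have d: "?d > 0" using assms(1) by simp
  have *: "x * y \<ge> ?d * ?d" if "x \<ge> ?d" "y \<ge> ?d" for x y
    using that d by (intro mult_mono) auto
  have "3 * (?d * ?d) \<le> (crs (a - b) (c - b))\<^sup>2"
    using *[OF assms(2,3)] *[OF assms(3,4)] *[OF assms(4,2)] crs_triangle_identity[of b a c]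
    by linarith
  moreover have "(crs (a - b) (c - b))\<^sup>2 = ?d * ?d" by (simp add: power2_eq_square)
  ultimately show False using mult_pos_pos[OF d d] by linarith
qed

text \<open>An angle bounded away from pi prevents the two vectors from cancelling: the squared norm
  is at least a quadratic form in the two lengths, which is diagonalised in their sum and
  difference.\<close>

lemma norm_cone_ge:
  fixes A B :: complex
  assumes AB: "A \<bullet> B \<ge> - k * norm A * norm B" and "\<alpha> \<ge> 0" "\<beta> \<ge> 0" and k: "0 \<le> k" "k \<le> 1"
  shows "sqrt ((1 - k) / 2) * (\<alpha> * norm A + \<beta> * norm B) \<le> norm (\<alpha> *\<^sub>R A + \<beta> *\<^sub>R B)"
proof -
  let ?x = "\<alpha> * norm A" and ?y = "\<beta> * norm B"
  have "(norm (\<alpha> *\<^sub>R A + \<beta> *\<^sub>R B))\<^sup>2 = ?x\<^sup>2 + ?y\<^sup>2 + 2 * (\<alpha> * \<beta> * (A \<bullet> B))"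
    unfolding power2_norm_eq_inner
    by (simp add: inner_add_left inner_add_right inner_commute power_mult_distrib
        power2_norm_eq_inner) (simp add: power2_eq_square power2_norm_eq_inner algebra_simps
        flip: power2_norm_eq_inner)
  also have "\<alpha> * \<beta> * (A \<bullet> B) \<ge> \<alpha> * \<beta> * (- k * norm A * norm B)"
    using AB assms(2,3) by (intro mult_left_mono) auto
  then have "?x\<^sup>2 + ?y\<^sup>2 + 2 * (\<alpha> * \<beta> * (A \<bullet> B)) \<ge> ?x\<^sup>2 + ?y\<^sup>2 - 2 * k * (?x * ?y)"
    by (simp add: algebra_simps)
  also have "?x\<^sup>2 + ?y\<^sup>2 - 2 * k * (?x * ?y) = (1 - k) / 2 * (?x + ?y)\<^sup>2 + (1 + k) / 2 * (?x - ?y)\<^sup>2"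
    by (simp add: power2_eq_square field_simps)
  finally have "(1 - k) / 2 * (?x + ?y)\<^sup>2 \<le> (norm (\<alpha> *\<^sub>R A + \<beta> *\<^sub>R B))\<^sup>2"
    using k by (smt (verit) mult_nonneg_nonneg zero_le_power2 divide_nonneg_pos)
  then have "sqrt ((1 - k) / 2 * (?x + ?y)\<^sup>2) \<le> norm (\<alpha> *\<^sub>R A + \<beta> *\<^sub>R B)"
    by (simp add: real_le_lsqrt real_sqrt_le_iff')
  then show ?thesis
    using assms(2,3) by (simp only: real_sqrt_mult real_sqrt_abs) (simp add: abs_of_nonneg)
qed

text \<open>
  If a triangle has a very small angle at \<open>b\<close>, then a polygon that continues \<open>b, c\<close> by a side of
  comparable length with an angle bounded away from \<open>\<pi>\<close> has to turn back.
\<close>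

lemma thin_corner_turns_back:
  fixes a c v :: complex
  assumes D: "D \<ge> 1" and k: "0 \<le> k" "k < 1"
    and s: "s = sqrt (1 - k\<^sup>2) / (4 * D * (1 + D))"
    and thin: "\<bar>crs a c\<bar> \<le> s * norm a * norm c" and ac: "a \<bullet> c \<ge> - k * norm a * norm c"
    and cone_b: "c + v = \<alpha> *\<^sub>R a + \<beta> *\<^sub>R c" "\<alpha> \<ge> 0" "\<beta> \<ge> 0"
    and cone_c: "a - c = \<alpha>' *\<^sub>R v + \<beta>' *\<^sub>R (- c)" "\<alpha>' \<ge> 0" "\<beta>' \<ge> 0"
    and cv: "(- c) \<bullet> v \<ge> - k * norm c * norm v"
    and len: "norm c \<le> D * norm v" "norm v \<le> D * norm c"
    and nz: "a \<noteq> 0" "c \<noteq> 0"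
  shows "a \<bullet> c \<ge> \<bar>crs a c\<bar>" "(- c) \<bullet> (a - c) \<ge> \<bar>crs a c\<bar>"
proof -
  define \<mu> where "\<mu> = sqrt (1 - k\<^sup>2)"
  have k2: "k\<^sup>2 < 1" using k by (simp add: power2_eq_square) (metis mult_strict_mono' mult_1 )
  have mu: "0 < \<mu>" "\<mu> \<le> 1" "\<mu>\<^sup>2 = 1 - k\<^sup>2"
    using k2 by (auto simp: \<mu>_def)
  have s_mu: "s * (4 * D * (1 + D)) = \<mu>"
    using D by (simp add: s \<mu>_def)
  have DD: "4 * D * (1 + D) \<ge> 8"
    using D mult_mono[of 1 D 2 "1 + D"] by simp
  have s0: "0 < s" using mu D by (simp add: s flip: \<mu>_def)
  have s8: "8 * s \<le> \<mu>"
    using mult_left_mono[OF DD, of s] s0 s_mu by simp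
  \<comment> \<open>Here \<open>x\<close>, \<open>y\<close>, \<open>P\<close> are an inner product,
    a cross product and the product of the norms: if the sine is small and the cosine is at least
    \<open>- k\<close>, then the cosine is at least 1/2.\<close>
  have key: "x > 0 \<and> 2 * x \<ge> P" if *: "x\<^sup>2 + y\<^sup>2 = P\<^sup>2" "\<bar>y\<bar> \<le> \<mu> / 2 * P" "x \<ge> - k * P" "P > 0"
    for x y P :: real
  proof -
    have "y\<^sup>2 \<le> (\<mu> / 2 * P)\<^sup>2" using *(2) by (metis abs_ge_zero power2_abs power_mono)
    then have y: "y\<^sup>2 \<le> (1 - k\<^sup>2) / 4 * P\<^sup>2" using mu by (simp add: power_mult_distrib power_divide)
    have P2: "P\<^sup>2 > 0" using *(4) by simp
    have x1: "x\<^sup>2 > (k * P)\<^sup>2"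
    proof -
      have "k\<^sup>2 * P\<^sup>2 < (1 - (1 - k\<^sup>2) / 4) * P\<^sup>2"
        using k2 P2 by (intro mult_strict_right_mono) (auto simp: field_simps)
      moreover have "(1 - (1 - k\<^sup>2) / 4) * P\<^sup>2 = P\<^sup>2 - (1 - k\<^sup>2) / 4 * P\<^sup>2"
        by (simp only: left_diff_distrib mult_1)
      ultimately show ?thesis using y *(1) unfolding power_mult_distrib by linarith
    qed
    have "x > 0"
    proof (rule ccontr)
      assume "\<not> x > 0"
      then have "\<bar>x\<bar> \<le> k * P" using *(3) by simp
      then have "x\<^sup>2 \<le> (k * P)\<^sup>2" by (metis abs_ge_zero power2_abs power_mono)
      then show False using x1 by simp
    qed
    moreover have "(P / 2)\<^sup>2 \<le> x\<^sup>2"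
    proof -
      have "(1 - k\<^sup>2) / 4 * P\<^sup>2 \<le> 1 / 4 * P\<^sup>2"
        using P2 by (intro mult_right_mono) auto
      then have "y\<^sup>2 \<le> 1 / 4 * P\<^sup>2" using y by linarith
      moreover have "(P / 2)\<^sup>2 = 1 / 4 * P\<^sup>2" by (simp add: power_divide)
      ultimately show ?thesis using *(1) P2 by linarith
    qed
    ultimately show ?thesis
      using power2_le_imp_le[of "P / 2" x] by simp
  qed
  have "a \<bullet> c > 0 \<and> 2 * (a \<bullet> c) \<ge> norm a * norm c"
  proof (rule key)
    show "(a \<bullet> c)\<^sup>2 + (crs a c)\<^sup>2 = (norm a * norm c)\<^sup>2"
      by (simp add: inner_sq_add_crs_sq power_mult_distrib)
    have "s * (norm a * norm c) \<le> \<mu> / 2 * (norm a * norm c)"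
      using s8 s0 mu by (intro mult_right_mono) auto
    then show "\<bar>crs a c\<bar> \<le> \<mu> / 2 * (norm a * norm c)" using thin by (simp add: mult.assoc)
  qed (use ac nz in \<open>auto simp: mult.assoc\<close>)
  note ac2 = this
  show "a \<bullet> c \<ge> \<bar>crs a c\<bar>"
  proof -
    have "s * (norm a * norm c) \<le> 1 / 2 * (norm a * norm c)"
      using s8 mu by (intro mult_right_mono) auto
    then show ?thesis using thin ac2 by (simp add: mult.assoc)
  qed
  have v0: "norm v > 0"
    using len(1) nz(2) D by (metis mult_zero_right norm_le_zero_iff norm_zero zero_less_norm_iff)
  \<comment> \<open>The cone at \<open>b\<close> carries the thinness over to the corner at
    \<open>c\<close>: the cross product there is \<open>\<alpha>\<close> times that at
    \<open>b\<close>, and \<open>\<alpha> * norm a\<close> is bounded by the component of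
    \<open>c + v\<close> along \<open>c\<close>.\<close>
  have crs_cv: "\<bar>crs c v\<bar> = \<alpha> * \<bar>crs a c\<bar>"
  proof -
    have "crs c (c + v) = \<alpha> * crs c a" unfolding cone_b(1) by (simp add: crs_add)
    then show ?thesis using cone_b(2) by (simp add: crs_add crs_swap[of c a] abs_mult)
  qed
  have al: "\<alpha> * norm a \<le> 2 * (1 + D) * norm c"
  proof -
    have "\<alpha> * (norm a * norm c) \<le> 2 * (\<alpha> * (a \<bullet> c))"
      using ac2 cone_b(2) mult_left_mono[of "norm a * norm c" "2 * (a \<bullet> c)" \<alpha>] by simp
    also have "\<alpha> * (a \<bullet> c) \<le> (c + v) \<bullet> c"
      unfolding cone_b(1) using cone_b(3) by (simp add: inner_add_left)
    also have "\<dots> \<le> norm (c + v) * norm c" by (rule norm_cauchy_schwarz)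
    also have "\<dots> \<le> ((1 + D) * norm c) * norm c"
      using norm_triangle_ineq[of c v] len(2) by (intro mult_right_mono) (auto simp: algebra_simps)
    finally have "(\<alpha> * norm a) * norm c \<le> (2 * (1 + D) * norm c) * norm c"
      by (simp only: mult.assoc)
    then show ?thesis using nz(2) by simp
  qed
  have small: "\<bar>crs c v\<bar> \<le> \<mu> / 2 * (norm c * norm v)"
  proof -
    have "\<bar>crs c v\<bar> \<le> \<alpha> * (s * norm a * norm c)"
      unfolding crs_cv using thin cone_b(2) by (intro mult_left_mono) auto
    also have "\<dots> = s * norm c * (\<alpha> * norm a)" by simp
    also have "\<dots> \<le> s * norm c * (2 * (1 + D) * norm c)"
      using al s0 by (intro mult_left_mono) auto
    also have "\<dots> \<le> s * norm c * (2 * (1 + D) * (D * norm v))"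
      using len(1) s0 D by (intro mult_left_mono) auto
    also have "\<dots> = (s * (4 * D * (1 + D))) / 2 * (norm c * norm v)" by simp
    finally show ?thesis unfolding s_mu .
  qed
  have "(- c) \<bullet> v > 0 \<and> 2 * ((- c) \<bullet> v) \<ge> norm c * norm v"
  proof (rule key)
    show "(- c \<bullet> v)\<^sup>2 + (crs c v)\<^sup>2 = (norm c * norm v)\<^sup>2"
      using inner_sq_add_crs_sq[of c v] by (simp add: power_mult_distrib)
  qed (use small cv nz v0 in \<open>auto simp: mult.assoc\<close>)
  then have cv2: "(- c) \<bullet> v \<ge> \<bar>crs c v\<bar>"
    using small mu mult_right_mono[of \<mu> 1 "norm c * norm v"] by simp
  \<comment> \<open>From the next side \<open>v\<close> back to the third side \<open>a - c\<close>
    of the triangle, through the cone at \<open>c\<close>.\<close>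
  have "\<bar>crs a c\<bar> = \<alpha>' * \<bar>crs c v\<bar>"
  proof -
    have "crs c (a - c) = \<alpha>' * crs c v" unfolding cone_c(1) by (simp add: crs_diff)
    then have "- crs a c = \<alpha>' * crs c v" by (simp add: crs_diff crs_swap[of c a])
    then show ?thesis using cone_c(2) by (metis abs_minus_cancel abs_mult abs_of_nonneg)
  qed
  also have "\<dots> \<le> \<alpha>' * ((- c) \<bullet> v)" using cv2 cone_c(2) by (intro mult_left_mono) auto
  also have "\<dots> \<le> (- c) \<bullet> (a - c)"
    unfolding cone_c(1) using cone_c(3) by (simp add: inner_diff_right)
  finally show "(- c) \<bullet> (a - c) \<ge> \<bar>crs a c\<bar>" .
qed

text \<open>\<open>c'\<close> and \<open>d\<close> stand for the vertices that follow
  \<open>c\<close> and \<open>a\<close> on the polygon. If the angle at \<open>b\<close> were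
  smaller, the polygon would turn back at both \<open>c\<close> and \<open>a\<close>, and the
  triangle would have three angles of at most 45 degrees.\<close>

lemma angle_lower_bound:
  fixes a b c c' d :: complex
  assumes D: "D \<ge> 1" and k: "0 \<le> k" "k < 1"
    and s: "s = sqrt (1 - k\<^sup>2) / (4 * D * (1 + D))"
    and nz: "crs (a - b) (c - b) \<noteq> 0"
    and B: "(a - b) \<bullet> (c - b) \<ge> - k * norm (a - b) * norm (c - b)"
    and C: "(b - c) \<bullet> (c' - c) \<ge> - k * norm (b - c) * norm (c' - c)"
    and A: "(b - a) \<bullet> (d - a) \<ge> - k * norm (b - a) * norm (d - a)"
    and c'_cone: "c' - b = \<alpha>1 *\<^sub>R (a - b) + \<beta>1 *\<^sub>R (c - b)" "\<alpha>1 \<ge> 0" "\<beta>1 \<ge> 0"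
    and d_cone: "d - b = \<alpha>2 *\<^sub>R (c - b) + \<beta>2 *\<^sub>R (a - b)" "\<alpha>2 \<ge> 0" "\<beta>2 \<ge> 0"
    and a_cone: "a - c = \<alpha>3 *\<^sub>R (c' - c) + \<beta>3 *\<^sub>R (b - c)" "\<alpha>3 \<ge> 0" "\<beta>3 \<ge> 0"
    and c_cone: "c - a = \<alpha>4 *\<^sub>R (d - a) + \<beta>4 *\<^sub>R (b - a)" "\<alpha>4 \<ge> 0" "\<beta>4 \<ge> 0"
    and len: "norm (c - b) \<le> D * norm (c' - c)" "norm (c' - c) \<le> D * norm (c - b)"
      "norm (a - b) \<le> D * norm (d - a)" "norm (d - a) \<le> D * norm (a - b)"
  shows "\<bar>crs (a - b) (c - b)\<bar> \<ge> s * norm (a - b) * norm (c - b)"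
proof (rule ccontr)
  assume "\<not> ?thesis"
  then have thin: "\<bar>crs (a - b) (c - b)\<bar> \<le> s * norm (a - b) * norm (c - b)" by simp
  have ne: "a - b \<noteq> 0" "c - b \<noteq> 0" using nz by auto
  have 1: "(a - b) \<bullet> (c - b) \<ge> \<bar>crs (a - b) (c - b)\<bar>"
     "(- (c - b)) \<bullet> ((a - b) - (c - b)) \<ge> \<bar>crs (a - b) (c - b)\<bar>"
    using thin_corner_turns_back[OF D k s thin B, of "c' - c" \<alpha>1 \<beta>1 \<alpha>3 \<beta>3]
      c'_cone a_cone C len ne by (auto simp: norm_minus_commute)
  have thin': "\<bar>crs (c - b) (a - b)\<bar> \<le> s * norm (c - b) * norm (a - b)"
    using thin by (simp add: crs_swap[of "c - b" "a - b"] mult_ac)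
  have B': "(c - b) \<bullet> (a - b) \<ge> - k * norm (c - b) * norm (a - b)"
    using B by (simp add: inner_commute mult_ac)
  have 2: "(- (a - b)) \<bullet> ((c - b) - (a - b)) \<ge> \<bar>crs (c - b) (a - b)\<bar>"
  proof (rule thin_corner_turns_back(2)[OF D k s thin' B'])
    show "a - b + (d - a) = \<alpha>2 *\<^sub>R (c - b) + \<beta>2 *\<^sub>R (a - b)" using d_cone(1) by simp
    show "c - b - (a - b) = \<alpha>4 *\<^sub>R (d - a) + \<beta>4 *\<^sub>R - (a - b)" using c_cone(1) by simp
    show "- k * norm (a - b) * norm (d - a) \<le> - (a - b) \<bullet> (d - a)"
      using A by (simp add: norm_minus_commute)
  qed (use d_cone c_cone len ne in auto)
  show False
    by (rule no_three_small_angles[OF nz]) (use 1 2 in \<open>auto simp: inner_commute crs_swap[of "c - b" "a - b"]\<close>)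
qed


section \<open>Packing, covering and chaining arguments\<close>

lemma sum_sq_radii_disjoint_balls:
  fixes c :: "'i \<Rightarrow> complex"
  assumes fin: "finite S" and nonneg: "\<And>i. i \<in> S \<Longrightarrow> 0 \<le> \<rho> i"
    and disj: "disjoint_family_on (\<lambda>i. ball (c i) (\<rho> i)) S"
    and sub: "\<And>i. i \<in> S \<Longrightarrow> ball (c i) (\<rho> i) \<subseteq> ball p R" and R: "0 \<le> R"
  shows "(\<Sum>i\<in>S. (\<rho> i)\<^sup>2) \<le> R\<^sup>2"
proof -
  have "(\<Sum>i\<in>S. emeasure lborel (ball (c i) (\<rho> i))) = emeasure lborel (\<Union>i\<in>S. ball (c i) (\<rho> i))"
    by (rule sum_emeasure[OF _ disj fin]) auto
  also have "\<dots> \<le> emeasure lborel (ball p R)"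
    using sub by (intro emeasure_mono) auto
  finally have "(\<Sum>i\<in>S. ennreal (pi * (\<rho> i)\<^sup>2)) \<le> ennreal (pi * R\<^sup>2)"
    using nonneg R by (simp add: emeasure_ball unit_ball_vol_2)
  then have "pi * (\<Sum>i\<in>S. (\<rho> i)\<^sup>2) \<le> pi * R\<^sup>2"
    by (subst (asm) sum_ennreal) (auto simp: sum_distrib_left)
  then show ?thesis by simp
qed

lemma sum_sq_radii_covering_balls:
  fixes c :: "'i \<Rightarrow> complex"
  assumes fin: "finite S" and nonneg: "\<And>i. i \<in> S \<Longrightarrow> 0 \<le> \<rho> i"
    and sub: "ball p R \<subseteq> (\<Union>i\<in>S. cball (c i) (\<rho> i))" and R: "0 \<le> R"
  shows "R\<^sup>2 \<le> (\<Sum>i\<in>S. (\<rho> i)\<^sup>2)"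
proof -
  have "emeasure lborel (ball p R) \<le> emeasure lborel (\<Union>i\<in>S. cball (c i) (\<rho> i))"
    using sub fin by (intro emeasure_mono) auto
  also have "\<dots> \<le> (\<Sum>i\<in>S. emeasure lborel (cball (c i) (\<rho> i)))"
    using fin by (intro emeasure_subadditive_finite) auto
  finally have "ennreal (pi * R\<^sup>2) \<le> (\<Sum>i\<in>S. ennreal (pi * (\<rho> i)\<^sup>2))"
    using nonneg R by (simp add: emeasure_ball emeasure_cball unit_ball_vol_2)
  then have "pi * R\<^sup>2 \<le> pi * (\<Sum>i\<in>S. (\<rho> i)\<^sup>2)"
    by (subst (asm) sum_ennreal) (auto simp: sum_distrib_left sum_nonneg ennreal_le_iff)
  then show ?thesis by simp
qed

lemma card_separated_points:
  fixes c :: "'i \<Rightarrow> complex"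
  assumes sep: "\<And>i j. i \<in> S \<Longrightarrow> j \<in> S \<Longrightarrow> i \<noteq> j \<Longrightarrow> dist (c i) (c j) \<ge> \<rho>" and "\<rho> > 0"
    and sub: "\<And>i. i \<in> S \<Longrightarrow> c i \<in> cball p R" and R: "0 \<le> R"
  shows "finite S \<and> real (card S) \<le> (2 * R / \<rho> + 1)\<^sup>2"
proof -
  have bound: "real (card T) \<le> (2 * R / \<rho> + 1)\<^sup>2" if T: "T \<subseteq> S" "finite T" for T
  proof -
    have "(\<Sum>i\<in>T. (\<rho> / 2)\<^sup>2) \<le> (R + \<rho> / 2)\<^sup>2"
    proof (rule sum_sq_radii_disjoint_balls[where c = c and p = p])
      show "disjoint_family_on (\<lambda>i. ball (c i) (\<rho> / 2)) T"
        unfolding disjoint_family_on_def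
      proof (intro ballI impI)
        fix i j assume "i \<in> T" "j \<in> T" "i \<noteq> j"
        then have "dist (c i) (c j) \<ge> \<rho>" using sep T by auto
        then show "ball (c i) (\<rho> / 2) \<inter> ball (c j) (\<rho> / 2) = {}"
          by (intro disjoint_ballI) auto
      qed
      fix i assume "i \<in> T"
      then have "dist p (c i) \<le> R" using sub[of i] T by auto
      then have "dist p x < R + \<rho> / 2" if "dist (c i) x < \<rho> / 2" for x
        using dist_triangle[of p x "c i"] that by linarith
      then show "ball (c i) (\<rho> / 2) \<subseteq> ball p (R + \<rho> / 2)" by auto
    qed (use T R \<open>\<rho> > 0\<close> in auto)
    then have "real (card T) * (\<rho> / 2)\<^sup>2 \<le> ((2 * R / \<rho> + 1) * (\<rho> / 2))\<^sup>2"
      using \<open>\<rho> > 0\<close> by (simp add: algebra_simps)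
    then show ?thesis using \<open>\<rho> > 0\<close> unfolding power_mult_distrib by simp
  qed
  have "card T \<le> nat \<lceil>(2 * R / \<rho> + 1)\<^sup>2\<rceil>" if "T \<subseteq> S" "finite T" for T
    using bound[OF that] by linarith
  then have "finite S"
    by (metis finite_if_finite_subsets_card_bdd)
  with bound show ?thesis by blast
qed

text \<open>
  Walking along \<open>G\<close> from one set \<open>K j\<close> to the next, with a value in \<open>{lo j..hi j}\<close> attached to each
  of them: a value missed by all the intervals would disconnect \<open>G\<close>.
\<close>

lemma connected_interval_chain:
  fixes K :: "'i \<Rightarrow> 'a::topological_space set" and lo hi :: "'i \<Rightarrow> real"
  assumes G: "connected G" and J: "finite J" and cover: "G \<subseteq> (\<Union>j\<in>J. K j)"
    and closed: "\<And>j. j \<in> J \<Longrightarrow> closed (K j)" and meet: "\<And>j. j \<in> J \<Longrightarrow> K j \<inter> G \<noteq> {}"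
    and le: "\<And>j. j \<in> J \<Longrightarrow> lo j \<le> hi j"
    and adj: "\<And>i j. i \<in> J \<Longrightarrow> j \<in> J \<Longrightarrow> K i \<inter> K j \<inter> G \<noteq> {} \<Longrightarrow> {lo i..hi i} \<inter> {lo j..hi j} \<noteq> {}"
    and ij: "i \<in> J" "j \<in> J" "s \<in> {lo i..hi i}" "t \<in> {lo j..hi j}"
  shows "\<bar>s - t\<bar> \<le> (\<Sum>j\<in>J. hi j - lo j)"
proof -
  have main: "t - s \<le> (\<Sum>j\<in>J. hi j - lo j)"
    if ij: "i \<in> J" "j \<in> J" "s \<in> {lo i..hi i}" "t \<in> {lo j..hi j}" and st: "s \<le> t" for i j s t
  proof -
    have "{s..t} \<subseteq> (\<Union>j\<in>J. {lo j..hi j})"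
    proof
      fix x assume x: "x \<in> {s..t}"
      show "x \<in> (\<Union>j\<in>J. {lo j..hi j})"
      proof (rule ccontr)
        assume no: "x \<notin> (\<Union>j\<in>J. {lo j..hi j})"
        define J1 where "J1 = {j\<in>J. hi j < x}"
        define J2 where "J2 = {j\<in>J. x < lo j}"
        have split: "J = J1 \<union> J2"
          using no by (auto simp: J1_def J2_def not_less)
        have "i \<in> J1" using no ij x by (force simp: J1_def)
        have "j \<in> J2" using no ij x by (force simp: J2_def)
        let ?A = "\<Union>j\<in>J1. K j" and ?B = "\<Union>j\<in>J2. K j"
        have "closed ?A" "closed ?B"
          using J closed by (auto simp: J1_def J2_def intro!: closed_UN)
        moreover have "G \<subseteq> ?A \<union> ?B" using cover split by auto
        moreover have "?A \<inter> G \<noteq> {}" using meet[OF ij(1)] \<open>i \<in> J1\<close> by blast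
        moreover have "?B \<inter> G \<noteq> {}" using meet[OF ij(2)] \<open>j \<in> J2\<close> by blast
        ultimately have "?A \<inter> ?B \<inter> G \<noteq> {}"
          using G unfolding connected_closed by metis
        then obtain i' j' where "i' \<in> J1" "j' \<in> J2" "K i' \<inter> K j' \<inter> G \<noteq> {}" by blast
        then have "{lo i'..hi i'} \<inter> {lo j'..hi j'} \<noteq> {}"
          using adj by (auto simp: J1_def J2_def)
        with \<open>i' \<in> J1\<close> \<open>j' \<in> J2\<close> show False by (auto simp: J1_def J2_def)
      qed
    qed
    then have "emeasure lborel {s..t} \<le> emeasure lborel (\<Union>j\<in>J. {lo j..hi j})"
      using J by (intro emeasure_mono) auto
    also have "\<dots> \<le> (\<Sum>j\<in>J. emeasure lborel {lo j..hi j})"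
      using J by (intro emeasure_subadditive_finite) auto
    finally have "ennreal (t - s) \<le> (\<Sum>j\<in>J. ennreal (hi j - lo j))"
      using st le by simp
    then show ?thesis
      using le by (subst (asm) sum_ennreal) (auto simp: sum_nonneg ennreal_le_iff)
  qed
  show ?thesis
    using main[OF ij] main[OF ij(2,1,4,3)] by (cases "s \<le> t") auto
qed

text \<open>Removing a limit point from \<open>W\<close> leaves a relatively open and dense subset.
  By Baire's theorem the intersection of these countably many subsets is still dense, and it has
  only isolated points.\<close>

lemma countable_closed_isolated_dense:
  fixes W :: "complex set"
  assumes "closed W" "countable W"
  shows "W \<subseteq> closure {w\<in>W. \<not> w islimpt W}"
proof (cases "\<exists>w\<in>W. w islimpt W")
  case True
  let ?G = "(\<lambda>w. W - {w}) ` {w\<in>W. w islimpt W}"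
  have "W \<subseteq> closure (\<Inter>?G)"
  proof (rule Baire[OF assms(1)])
    show "countable ?G" using assms(2) by auto
    fix T assume "T \<in> ?G"
    then obtain w where w: "w \<in> W" "w islimpt W" "T = W - {w}" by auto
    have "openin (top_of_set W) T"
      unfolding w(3) by (simp add: openin_delete)
    moreover have "w \<in> closure T"
      using w(2,3) islimpt_punctured[of w W] by (simp add: closure_def)
    then have "W \<subseteq> closure T" using w closure_subset[of T] by auto
    ultimately show "openin (top_of_set W) T \<and> W \<subseteq> closure T" by blast
  qed
  also have "\<Inter>?G \<subseteq> {w\<in>W. \<not> w islimpt W}" using True by auto
  finally show ?thesis by (metis closure_mono dual_order.trans \<open>\<Inter>?G \<subseteq> _\<close> \<open>W \<subseteq> closure (\<Inter>?G)\<close>)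
next
  case False
  then have "{w\<in>W. \<not> w islimpt W} = W" by auto
  then show ?thesis using closure_subset by simp
qed

section \<open>Segments in the frontier of an open convex set\<close>

lemma crs_eq_0_iff_collinear:
  assumes "a \<noteq> 0" "crs a z = 0"
  obtains s where "z = s *\<^sub>R a"
proof
  have "z = (1 / (norm a)\<^sup>2) *\<^sub>R ((norm a)\<^sup>2 *\<^sub>R z)" using assms(1) by simp
  also have "\<dots> = ((a \<bullet> z) / (norm a)\<^sup>2) *\<^sub>R a"
    unfolding inner_crs_coords using assms(2) by simp
  finally show "z = ((a \<bullet> z) / (norm a)\<^sup>2) *\<^sub>R a" .
qed

lemma i_mult_inner: "(\<i> * z) \<bullet> w = crs z w"
  by (simp add: inner_complex_def crs_def)

text \<open>The functional of a supporting line at the midpoint is minimal there, hence constant on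
  the segment; so the supporting line is the line through \<open>a\<close> and
  \<open>b\<close>.\<close>

lemma frontier_segment_halfplane:
  fixes F :: "complex set"
  assumes F: "convex F" "open F" and ab: "a \<noteq> b" "closed_segment a b \<subseteq> frontier F"
  shows "(\<forall>y\<in>F. crs (b - a) (y - a) > 0) \<or> (\<forall>y\<in>F. crs (b - a) (y - a) < 0)"
proof -
  let ?x = "midpoint a b"
  have "?x \<in> frontier F" using ab(2) by (auto simp: midpoint_in_closed_segment)
  then have x: "?x \<in> closure F" "?x \<notin> rel_interior F"
    using F by (auto simp: frontier_def rel_interior_open interior_open)
  obtain n where n: "n \<noteq> 0" "\<And>y. y \<in> closure F \<Longrightarrow> n \<bullet> ?x \<le> n \<bullet> y"
    "\<And>y. y \<in> rel_interior F \<Longrightarrow> n \<bullet> ?x < n \<bullet> y"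
    using supporting_hyperplane_relative_frontier[OF F(1) x] by metis
  have "a \<in> closure F" "b \<in> closure F" using ab(2) by (auto simp: frontier_def)
  then have "n \<bullet> ?x \<le> n \<bullet> a" "n \<bullet> ?x \<le> n \<bullet> b" using n by auto
  moreover have "2 * (n \<bullet> ?x) = n \<bullet> a + n \<bullet> b"
    by (simp add: midpoint_def inner_add_right)
  ultimately have na: "n \<bullet> a = n \<bullet> ?x" "n \<bullet> b = n \<bullet> a" by auto
  have perp: "(b - a) \<bullet> n = 0"
    unfolding inner_commute[of _ n] inner_diff_right using na by linarith
  have eq: "(norm (b - a))\<^sup>2 * (n \<bullet> (y - a)) = crs (b - a) n * crs (b - a) (y - a)" for y
  proof -
    have "(norm (b - a))\<^sup>2 * (n \<bullet> (y - a)) = ((norm (b - a))\<^sup>2 *\<^sub>R n) \<bullet> (y - a)" by simp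
    also have "\<dots> = crs (b - a) n * crs (b - a) (y - a)"
      unfolding inner_crs_coords perp by (simp add: i_mult_inner)
    finally show ?thesis .
  qed
  have "crs (b - a) n * crs (b - a) (y - a) > 0" if "y \<in> F" for y
  proof -
    have "n \<bullet> (y - a) > 0"
      using n(3)[of y] that F na by (simp add: rel_interior_open inner_diff_right)
    then show ?thesis using ab(1) by (subst eq[symmetric]) simp
  qed
  then show ?thesis
    by (cases "crs (b - a) n > 0") (auto simp: zero_less_mult_iff)
qed

text \<open>\<open>t\<close> is the height of \<open>y\<close> over the line through
  \<open>a\<close> and \<open>b\<close> relative to that of the apex \<open>p\<close>, and
  \<open>z\<close> is the projection of \<open>y\<close> from \<open>p\<close> onto this line. The
  last hypothesis keeps \<open>z\<close> within \<open>m\<close> of \<open>x\<close>, hence between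
  \<open>a\<close> and \<open>b\<close>.\<close>

lemma segment_triangle_nbhd:
  fixes a b x y p :: complex
  assumes ab: "a \<noteq> b" and x: "x \<in> closed_segment a b" and m: "dist x a \<ge> m" "dist x b \<ge> m"
    and h: "crs (b - a) (p - a) \<noteq> 0" and t: "t = crs (b - a) (y - a) / crs (b - a) (p - a)" "t < 1" "0 \<le> t"
    and close: "dist y x + t * dist p x \<le> (1 - t) * m"
  obtains z where "z \<in> closed_segment a b" "y = (1 - t) *\<^sub>R z + t *\<^sub>R p"
proof
  define z where "z = (1 / (1 - t)) *\<^sub>R (y - t *\<^sub>R p)"
  have z: "(1 - t) *\<^sub>R z = y - t *\<^sub>R p" using t(2) by (simp add: z_def)
  then show y: "y = (1 - t) *\<^sub>R z + t *\<^sub>R p" by simp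
  have "(1 - t) * crs (b - a) (z - a) = crs (b - a) ((1 - t) *\<^sub>R z - (1 - t) *\<^sub>R a)"
    by (simp flip: scaleR_diff_right)
  also have "\<dots> = crs (b - a) (y - a) - t * crs (b - a) (p - a)"
  proof -
    have "(1 - t) *\<^sub>R z - (1 - t) *\<^sub>R a = (y - a) - t *\<^sub>R (p - a)"
      unfolding z by (simp add: algebra_simps)
    then show ?thesis by (simp only: crs_diff(2)[of _ "y - a"] crs_scaleR)
  qed
  also have "\<dots> = 0" using h t(1) by simp
  finally have "crs (b - a) (z - a) = 0" using t(2) by simp
  then obtain s where s: "z - a = s *\<^sub>R (b - a)"
    using ab crs_eq_0_iff_collinear by (metis right_minus_eq)
  obtain u where u: "0 \<le> u" "u \<le> 1" "x = (1 - u) *\<^sub>R a + u *\<^sub>R b"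
    using x by (auto simp: in_segment)
  have xa: "x - a = u *\<^sub>R (b - a)" "x - b = (u - 1) *\<^sub>R (b - a)"
    using u by (auto simp: algebra_simps)
  let ?L = "norm (b - a)"
  have L: "?L > 0" using ab by simp
  have mu: "u * ?L \<ge> m" "(1 - u) * ?L \<ge> m"
    using m u unfolding dist_norm xa by auto
  have zx: "z - x = (s - u) *\<^sub>R (b - a)"
  proof -
    have "z - x = (z - a) - (x - a)" by simp
    also have "\<dots> = (s - u) *\<^sub>R (b - a)" by (simp only: s xa(1) scaleR_left_diff_distrib)
    finally show ?thesis .
  qed
  have "(1 - t) * norm (z - x) = norm ((1 - t) *\<^sub>R (z - x))" using t by simp
  also have "(1 - t) *\<^sub>R (z - x) = (y - x) - t *\<^sub>R (p - x)"
    unfolding scaleR_diff_right z by (simp add: algebra_simps)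
  also have "norm \<dots> \<le> dist y x + t * dist p x"
    using norm_triangle_ineq4[of "y - x" "t *\<^sub>R (p - x)"] t(3) by (simp add: dist_norm)
  finally have "(1 - t) * norm (z - x) \<le> (1 - t) * m" using close by simp
  then have "norm (z - x) \<le> m" using t by simp
  then have su: "\<bar>s - u\<bar> * ?L \<le> m" unfolding zx by simp
  have "\<bar>s - u\<bar> * ?L \<le> u * ?L" "\<bar>s - u\<bar> * ?L \<le> (1 - u) * ?L" using su mu by auto
  then have "\<bar>s - u\<bar> \<le> u" "\<bar>s - u\<bar> \<le> 1 - u" using L by auto
  then have "0 \<le> s" "s \<le> 1" by auto
  moreover have "z = (1 - s) *\<^sub>R a + s *\<^sub>R b" using s by (simp add: algebra_simps)
  ultimately show "z \<in> closed_segment a b" by (auto simp: in_segment)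
qed

text \<open>The points near \<open>x\<close> on the same side as \<open>p\<close> lie in the
  triangle with apex \<open>p\<close> over the segment, and off its base. Convexity puts them into
  \<open>F\<close> although the base is only in the closure.\<close>

lemma frontier_segment_half_disc:
  fixes F :: "complex set"
  assumes F: "convex F" "open F" and ab: "a \<noteq> b" "closed_segment a b \<subseteq> closure F"
    and p: "p \<in> F" "crs (b - a) (p - a) \<noteq> 0" and x: "x \<in> open_segment a b"
  obtains \<rho> where "\<rho> > 0"
    "\<And>y. y \<in> ball x \<rho> \<Longrightarrow> crs (b - a) (y - a) * crs (b - a) (p - a) > 0 \<Longrightarrow> y \<in> F"
proof
  let ?h = "crs (b - a) (p - a)"
  define m where "m = min (dist x a) (dist x b)"
  have m: "m > 0" using x by (auto simp: m_def open_segment_def)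
  define q where "q = norm (b - a) / \<bar>?h\<bar>"
  have q: "q > 0" using ab p by (simp add: q_def)
  \<comment> \<open>Since \<open>t \<le> q * dist y x\<close>, the first entry makes
    \<open>t\<close> at most 1/2, and the second one gives the closeness that
    \<open>segment_triangle_nbhd\<close> asks for.\<close>
  define \<rho> where "\<rho> = min (1 / (2 * q)) (m / (2 * (1 + q * dist p x)))"
  have den: "2 * (1 + q * dist p x) > 0" using q by (simp add: add_pos_nonneg)
  show "\<rho> > 0" using q m den unfolding \<rho>_def by (simp del: mult_pos_pos)
  fix y assume y: "y \<in> ball x \<rho>" and pos: "crs (b - a) (y - a) * ?h > 0"
  define t where "t = crs (b - a) (y - a) / ?h"
  have xs: "x \<in> closed_segment a b" using x by (simp add: open_segment_def)
  have t0: "t > 0" using pos by (auto simp: t_def zero_less_mult_iff zero_less_divide_iff)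
  have yx: "dist y x \<le> \<rho>" using y by (simp add: dist_commute)
  obtain u where "x - a = u *\<^sub>R (b - a)"
    using xs by (auto simp: in_segment algebra_simps)
  then have "crs (b - a) (x - a) = 0" by simp
  then have "crs (b - a) (y - a) = crs (b - a) (y - x)" by (simp add: crs_diff)
  then have "\<bar>crs (b - a) (y - a)\<bar> \<le> norm (b - a) * dist y x"
    using abs_crs_le[of "b - a" "y - x"] by (simp add: dist_norm)
  then have tq: "t \<le> q * dist y x"
  proof -
    have "t = \<bar>t\<bar>" using t0 by simp
    also have "\<dots> = \<bar>crs (b - a) (y - a)\<bar> / \<bar>?h\<bar>" by (simp add: t_def abs_divide)
    also have "\<dots> \<le> norm (b - a) * dist y x / \<bar>?h\<bar>"
      using \<open>\<bar>crs (b - a) (y - a)\<bar> \<le> norm (b - a) * dist y x\<close> by (intro divide_right_mono) auto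
    finally show ?thesis by (simp add: q_def)
  qed
  also have "\<dots> \<le> q * \<rho>" using yx q by simp
  finally have tq': "t \<le> q * \<rho>" .
  also have "\<dots> \<le> q * (1 / (2 * q))" using q by (intro mult_left_mono) (auto simp: \<rho>_def)
  finally have t1: "t \<le> 1 / 2" using q by simp
  have "dist y x + t * dist p x \<le> \<rho> + q * \<rho> * dist p x"
    using yx tq' by (intro add_mono mult_right_mono) auto
  also have "\<dots> = \<rho> * (1 + q * dist p x)" by (simp add: algebra_simps)
  also have "\<dots> \<le> m / (2 * (1 + q * dist p x)) * (1 + q * dist p x)"
    using den by (intro mult_right_mono) (auto simp: \<rho>_def)
  also have "\<dots> = m / 2"
  proof -
    have "m / (2 * e) * e = m / 2" if "e > 0" for e :: real using that by simp
    moreover have "0 < 1 + q * dist p x" using q by (simp add: add_pos_nonneg)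
    ultimately show ?thesis .
  qed
  also have "\<dots> \<le> (1 - t) * m" using t1 m mult_right_mono[of "1/2" "1 - t" m] by simp
  finally have close: "dist y x + t * dist p x \<le> (1 - t) * m" .
  obtain z where z: "z \<in> closed_segment a b" "y = (1 - t) *\<^sub>R z + t *\<^sub>R p"
    using segment_triangle_nbhd[OF ab(1) xs _ _ p(2) t_def _ _ close] t0 t1 by (auto simp: m_def)
  have "z - t *\<^sub>R (z - p) \<in> interior F"
    using mem_interior_closure_convex_shrink[OF F(1), of p z t] z(1) ab(2) p(1) F(2) t0 t1
    by (auto simp: interior_open)
  also have "z - t *\<^sub>R (z - p) = y" using z(2) by (simp add: algebra_simps)
  finally show "y \<in> F" using F by (simp add: interior_open)
qed

section \<open>The faces of a good embedding\<close>

locale good_graph =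
  fixes D \<eta> :: real and V :: "complex set" and E :: "complex set set"
  assumes D: "D > 1" and eta: "0 < \<eta>" "\<eta> \<le> 1" and good: "good_embedding D \<eta> V E"
begin

abbreviation "\<kappa> \<equiv> cos \<eta>"

lemma kappa: "0 \<le> \<kappa>" "\<kappa> < 1"
proof -
  show "0 \<le> \<kappa>" using eta pi_ge_two by (intro cos_ge_zero) auto
  show "\<kappa> < 1" using cos_monotone_0_pi[of 0 \<eta>] eta pi_ge_two by simp
qed

lemma infinite_V: "infinite V"
  and simple: "simple_graph V E"
  and connected: "connected_graph V E"
  and no_crossing: "\<And>e f. e \<in> E \<Longrightarrow> f \<in> E \<Longrightarrow> e \<noteq> f \<Longrightarrow> convex hull e \<inter> convex hull f \<subseteq> e \<inter> f"
  using good unfolding good_embedding_def straight_embedding_def by auto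

lemma edge_ends:
  assumes "{a, b} \<in> E"
  shows "a \<in> V" "b \<in> V" "a \<noteq> b"
proof -
  obtain u v where "u \<in> V" "v \<in> V" "u \<noteq> v" "{a, b} = {u, v}"
    using simple assms unfolding simple_graph_def by blast
  then show "a \<in> V" "b \<in> V" "a \<noteq> b" by (auto simp: doubleton_eq_iff)
qed

lemma edge_cases:
  assumes "e \<in> E"
  obtains a b where "e = {a, b}" "a \<in> V" "b \<in> V" "a \<noteq> b"
  using simple assms unfolding simple_graph_def by blast

lemma edge_ratio:
  assumes "{u, v} \<in> E" "{u, w} \<in> E"
  shows "dist u w \<le> D * dist u v"
proof -
  have "dist u w / dist u v \<le> D"
    using good assms unfolding good_embedding_def adjacent_ratios_bounded_def by auto
  then show ?thesis using edge_ends(3)[OF assms(1)] by (simp add: divide_le_eq)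
qed

lemma has_edge:
  assumes "v \<in> V"
  obtains a where "{v, a} \<in> E"
proof -
  obtain w where w: "w \<in> V" "w \<noteq> v"
    using infinite_V by (metis finite.emptyI finite_insert insertI1 subsetI finite_subset)
  have "(\<lambda>x y. {x, y} \<in> E)\<^sup>*\<^sup>* v w"
    using connected assms w unfolding connected_graph_def by blast
  then show ?thesis using w that by (cases rule: converse_rtranclpE) auto
qed

lemma edge_in_skeleton: "{a, b} \<in> E \<Longrightarrow> closed_segment a b \<subseteq> skeleton E"
  unfolding skeleton_def segment_convex_hull by blast

lemma V_subset_skeleton: "V \<subseteq> skeleton E"
proof
  fix v assume "v \<in> V"
  then obtain a where "{v, a} \<in> E" using has_edge by blast
  then show "v \<in> skeleton E" using edge_in_skeleton by force
qed

lemma vertex_on_edge: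
  assumes "v \<in> V" "{a, b} \<in> E" "v \<in> closed_segment a b"
  shows "v = a \<or> v = b"
proof -
  obtain w where w: "{v, w} \<in> E" using has_edge[OF assms(1)] .
  show ?thesis
  proof (cases "{v, w} = {a, b}")
    case False
    have "v \<in> convex hull {v, w} \<inter> convex hull {a, b}"
      using assms(3) by (simp add: segment_convex_hull[symmetric])
    then show ?thesis using no_crossing[OF w assms(2) False] by auto
  qed auto
qed

lemma edges_meet:
  assumes "{a, b} \<in> E" "{c, d} \<in> E" "{a, b} \<noteq> {c, d}" "x \<in> closed_segment a b" "x \<in> closed_segment c d"
  shows "x \<in> {a, b}" "x \<in> {c, d}"
  using no_crossing[OF assms(1-3)] assms(4,5) by (auto simp: segment_convex_hull)

lemma edges_on_ray:
  assumes "{v, a} \<in> E" "{v, b} \<in> E" "b - v = s *\<^sub>R (a - v)" "s > 0"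
  shows "a = b"
proof (rule ccontr)
  assume "a \<noteq> b"
  define t where "t = min 1 s / 2"
  have t: "0 < t" "t < 1" "t < s" "t / s < 1" using assms(4) by (auto simp: t_def)
  define x where "x = v + t *\<^sub>R (a - v)"
  have "x = (1 - t) *\<^sub>R v + t *\<^sub>R a" by (simp add: x_def algebra_simps)
  then have 1: "x \<in> closed_segment v a"
    unfolding in_segment using t by (intro exI[of _ t]) auto
  have "x = v + (t / s) *\<^sub>R (b - v)" using assms(3,4) by (simp add: x_def)
  then have "x = (1 - t / s) *\<^sub>R v + (t / s) *\<^sub>R b" by (simp add: algebra_simps)
  then have 2: "x \<in> closed_segment v b"
    unfolding in_segment using t assms(4) by (intro exI[of _ "t / s"]) auto
  have ne: "{v, a} \<noteq> {v, b}" using \<open>a \<noteq> b\<close> by (auto simp: doubleton_eq_iff)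
  have "a \<noteq> v" "b \<noteq> v" using edge_ends assms(1,2) by blast+
  have "x = v \<or> x = a" "x = v \<or> x = b" using edges_meet[OF assms(1,2) ne 1 2] by auto
  then have "x = v" using \<open>a \<noteq> b\<close> by auto
  then show False using t \<open>a \<noteq> v\<close> by (simp add: x_def)
qed

lemma face_disjoint_skeleton: "F \<in> faces E \<Longrightarrow> F \<inter> skeleton E = {}"
  unfolding faces_def using in_components_subset by blast

lemma face_frontier: "F \<in> faces E \<Longrightarrow> frontier F \<subseteq> skeleton E"
  unfolding faces_def by simp

lemma face_open: "F \<in> faces E \<Longrightarrow> open F"
  using face_disjoint_skeleton[of F] face_frontier[of F] frontier_disjoint_eq[of F] by blast

lemma face_convex: "F \<in> faces E \<Longrightarrow> convex F"
  using good unfolding good_embedding_def inner_angles_bounded_def by blast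

lemma face_nonempty: "F \<in> faces E \<Longrightarrow> F \<noteq> {}"
  unfolding faces_def using in_components_nonempty by blast

lemma faces_disjoint: "F \<in> faces E \<Longrightarrow> F' \<in> faces E \<Longrightarrow> F \<noteq> F' \<Longrightarrow> F \<inter> F' = {}"
  unfolding faces_def using components_nonoverlap by blast

lemma frontier_face: "F \<in> faces E \<Longrightarrow> frontier F = closure F - F"
  by (simp add: frontier_def face_open interior_open)

lemma faces_eqI:
  assumes "F \<in> faces E" "F' \<in> faces E" "x \<in> F" "x \<in> closure F'"
  shows "F = F'"
proof -
  have "F \<inter> F' \<noteq> {}" using assms face_open[OF assms(1)] open_Int_closure_eq_empty by blast
  then show ?thesis using faces_disjoint assms by blast
qed

section \<open>Sides of faces, and the two faces along an edge\<close>

definition side :: "complex set \<Rightarrow> complex \<Rightarrow> complex \<Rightarrow> bool" where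
  "side F a b \<longleftrightarrow> {a, b} \<in> E \<and> side_of_face {a, b} F"

lemma side_sym: "side F a b \<Longrightarrow> side F b a"
  by (simp add: side_def insert_commute)

lemma side_edge: "side F a b \<Longrightarrow> {a, b} \<in> E"
  by (simp add: side_def)

lemma side_frontier: "side F a b \<Longrightarrow> closed_segment a b \<subseteq> frontier F"
  by (simp add: side_def side_of_face_def segment_convex_hull)

lemma side_ends_closure: "side F a b \<Longrightarrow> a \<in> closure F" "side F a b \<Longrightarrow> b \<in> closure F"
  using side_frontier by (force simp: frontier_def)+

lemma side_sign:
  assumes "F \<in> faces E" "side F a b"
  shows "(\<forall>y\<in>F. crs (b - a) (y - a) > 0) \<or> (\<forall>y\<in>F. crs (b - a) (y - a) < 0)"
  using frontier_segment_halfplane[OF face_convex face_open, OF assms(1,1)] side_frontier[OF assms(2)]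
    edge_ends(3)[OF side_edge[OF assms(2)]] by blast

lemma crs_flip: "crs (a - b) (y - b) = - crs (b - a) (y - a)"
  by (simp add: crs_def algebra_simps)

lemma crs_closure_nonneg:
  assumes "\<And>y. y \<in> F \<Longrightarrow> crs z (y - w) \<ge> 0" "y \<in> closure F"
  shows "crs z (y - w) \<ge> 0"
proof -
  have "closed {y. 0 \<le> crs z (y - w)}"
    unfolding crs_def by (intro closed_Collect_le continuous_intros)
  then show ?thesis using closure_minimal[of F "{y. 0 \<le> crs z (y - w)}"] assms by blast
qed

lemma crs_closure_nonpos:
  assumes "\<And>y. y \<in> F \<Longrightarrow> crs z (y - w) \<le> 0" "y \<in> closure F"
  shows "crs z (y - w) \<le> 0"
  using crs_closure_nonneg[of F "- z" w y] assms by simp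

lemma half_disc:
  assumes F: "F \<in> faces E" and ab: "side F a b" and x: "x \<in> open_segment a b" and p: "p \<in> F"
  obtains \<rho> where "\<rho> > 0" "\<And>y. y \<in> ball x \<rho> \<Longrightarrow> crs (b - a) (y - a) * crs (b - a) (p - a) > 0 \<Longrightarrow> y \<in> F"
proof -
  have "closed_segment a b \<subseteq> closure F" using side_frontier[OF ab] by (auto simp: frontier_def)
  moreover have "crs (b - a) (p - a) \<noteq> 0" using side_sign[OF F ab] p by fastforce
  ultimately show ?thesis
    using frontier_segment_half_disc[OF face_convex[OF F] face_open[OF F]
        edge_ends(3)[OF side_edge[OF ab]] _ p _ x] that by blast
qed

text \<open>The condition on the faces yields two different faces along the edge, but not yet on
  different sides of it. Two faces on the same side would both contain a small half disc about the
  midpoint.\<close>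

lemma edge_two_faces:
  assumes ab: "{a, b} \<in> E"
  obtains F F' where "F \<in> faces E" "F' \<in> faces E" "side F a b" "side F' a b"
    "\<And>y. y \<in> F \<Longrightarrow> crs (b - a) (y - a) > 0" "\<And>y. y \<in> F' \<Longrightarrow> crs (b - a) (y - a) < 0"
proof -
  obtain F F' where F: "F \<in> faces E" "F' \<in> faces E" "F \<noteq> F'" "side F a b" "side F' a b"
    using good ab unfolding good_embedding_def inner_angles_bounded_def side_def by metis
  have ne: "a \<noteq> b" using edge_ends[OF ab] by blast
  let ?m = "midpoint a b"
  have m: "?m \<in> open_segment a b" using ne by (simp add: midpoint_in_open_segment)
  have same_sign: False if p: "p \<in> F" "p' \<in> F'" "crs (b - a) (p - a) * crs (b - a) (p' - a) > 0" for p p'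
  proof -
    obtain \<rho> where r: "\<rho> > 0"
      "\<And>y. y \<in> ball ?m \<rho> \<Longrightarrow> crs (b - a) (y - a) * crs (b - a) (p - a) > 0 \<Longrightarrow> y \<in> F"
      using half_disc[OF F(1,4) m p(1)] by blast
    obtain \<rho>' where r': "\<rho>' > 0"
      "\<And>y. y \<in> ball ?m \<rho>' \<Longrightarrow> crs (b - a) (y - a) * crs (b - a) (p' - a) > 0 \<Longrightarrow> y \<in> F'"
      using half_disc[OF F(2,5) m p(2)] by blast
    \<comment> \<open>Brings a point \<open>y\<close> on the way from the midpoint to
      \<open>p\<close> into both half discs; the \<open>+ 1\<close> keeps the denominator
      positive.\<close>
    define t where "t = min \<rho> \<rho>' / 2 / (norm (p - ?m) + 1)"
    have pm: "norm (p - ?m) + 1 > 0" by (simp add: add_nonneg_pos)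
    have t: "t > 0" using r(1) r'(1) pm by (simp add: t_def)
    define y where "y = ?m + t *\<^sub>R (p - ?m)"
    have "dist ?m y = t * norm (p - ?m)" using t by (simp add: y_def dist_norm)
    also have "\<dots> \<le> t * (norm (p - ?m) + 1)" using t by simp
    also have "\<dots> = min \<rho> \<rho>' / 2"
    proof -
      have "c / 2 / e * e = c / 2" if "e > 0" for c e :: real using that by simp
      then show ?thesis using pm unfolding t_def by blast
    qed
    also have "\<dots> < min \<rho> \<rho>'" using r(1) r'(1) by linarith
    finally have y: "y \<in> ball ?m \<rho>" "y \<in> ball ?m \<rho>'" by auto
    have ma: "?m - a = (1/2) *\<^sub>R (b - a)"
      by (simp add: midpoint_def scaleR_conv_of_real field_simps)
    have "y - a = (1 - t) *\<^sub>R (?m - a) + t *\<^sub>R (p - a)"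
      by (simp add: y_def algebra_simps)
    then have cy: "crs (b - a) (y - a) = t * crs (b - a) (p - a)"
      unfolding ma by (simp add: crs_add)
    have "crs (b - a) (p - a) \<noteq> 0" using p(3) by auto
    then have "0 < t * (crs (b - a) (p - a) * crs (b - a) (p - a))"
      using t mult_pos_pos not_real_square_gt_zero by blast
    then have "y \<in> F" using r(2)[OF y(1)] by (simp add: cy mult.assoc)
    moreover have "y \<in> F'" using r'(2)[OF y(2)] t p(3) by (simp add: cy mult.assoc)
    ultimately show False using faces_disjoint F by blast
  qed
  obtain p p' where p: "p \<in> F" "p' \<in> F'"
    using face_nonempty[OF F(1)] face_nonempty[OF F(2)] by blast
  show ?thesis
  proof (cases "\<forall>y\<in>F. crs (b - a) (y - a) > 0")
    case True
    then have "\<forall>y\<in>F'. crs (b - a) (y - a) < 0"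
      using side_sign[OF F(2,5)] same_sign p by (metis mult_pos_pos)
    then show ?thesis using that[OF F(1,2,4,5)] True by blast
  next
    case False
    then have *: "\<forall>y\<in>F. crs (b - a) (y - a) < 0" using side_sign[OF F(1,4)] by blast
    then have "\<forall>y\<in>F'. crs (b - a) (y - a) > 0"
      using side_sign[OF F(2,5)] same_sign p by (metis mult_neg_neg)
    then show ?thesis using that[OF F(2,1,5,4)] * by blast
  qed
qed

lemma edge_nbhd:
  assumes ab: "{a, b} \<in> E" and x: "x \<in> open_segment a b"
    and F: "F \<in> faces E" "F' \<in> faces E" "side F a b" "side F' a b"
    "\<And>y. y \<in> F \<Longrightarrow> crs (b - a) (y - a) > 0" "\<And>y. y \<in> F' \<Longrightarrow> crs (b - a) (y - a) < 0"
  obtains \<rho> where "\<rho> > 0" "ball x \<rho> \<subseteq> F \<union> F' \<union> open_segment a b"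
proof -
  obtain p p' where p: "p \<in> F" "p' \<in> F'"
    using face_nonempty[OF F(1)] face_nonempty[OF F(2)] by blast
  obtain \<rho> where r: "\<rho> > 0"
    "\<And>y. y \<in> ball x \<rho> \<Longrightarrow> crs (b - a) (y - a) * crs (b - a) (p - a) > 0 \<Longrightarrow> y \<in> F"
    using half_disc[OF F(1,3) x p(1)] by blast
  obtain \<rho>' where r': "\<rho>' > 0"
    "\<And>y. y \<in> ball x \<rho>' \<Longrightarrow> crs (b - a) (y - a) * crs (b - a) (p' - a) > 0 \<Longrightarrow> y \<in> F'"
    using half_disc[OF F(2,4) x p(2)] by blast
  define R where "R = min (min \<rho> \<rho>') (min (dist x a) (dist x b))"
  have ne: "a \<noteq> b" using edge_ends[OF ab] by blast
  have "R > 0" using r r' x by (auto simp: R_def open_segment_def)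
  moreover have "y \<in> F \<union> F' \<union> open_segment a b" if y: "y \<in> ball x R" for y
  proof -
    consider "crs (b - a) (y - a) > 0" | "crs (b - a) (y - a) < 0" | "crs (b - a) (y - a) = 0" by linarith
    then show ?thesis
    proof cases
      case 1
      then have "y \<in> F" using r(2)[of y] y F(5)[OF p(1)] by (simp add: R_def)
      then show ?thesis by simp
    next
      case 2
      then have "y \<in> F'" using r'(2)[of y] y F(6)[OF p(2)] by (simp add: R_def mult_neg_neg)
      then show ?thesis by simp
    next
      case 3
      then obtain s where s: "y - a = s *\<^sub>R (b - a)"
        using crs_eq_0_iff_collinear ne by (metis right_minus_eq)
      obtain u where u: "0 < u" "u < 1" "x = (1 - u) *\<^sub>R a + u *\<^sub>R b"
        using x by (auto simp: in_segment)
      have xa: "x - a = u *\<^sub>R (b - a)" "x - b = (u - 1) *\<^sub>R (b - a)" using u by (auto simp: algebra_simps)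
      have "x - y = (x - a) - (y - a)" by simp
      then have "x - y = (u - s) *\<^sub>R (b - a)" unfolding s xa by (simp only: scaleR_left_diff_distrib)
      then have "dist x y = \<bar>u - s\<bar> * norm (b - a)" by (simp add: dist_norm)
      moreover have "dist x y < dist x a" "dist x y < dist x b" using y by (auto simp: R_def)
      moreover have "dist x a = u * norm (b - a)" "dist x b = (1 - u) * norm (b - a)"
        unfolding dist_norm xa using u by auto
      moreover have "norm (b - a) > 0" using ne by simp
      ultimately have "\<bar>u - s\<bar> < u" "\<bar>u - s\<bar> < 1 - u" by auto
      then have "0 < s" "s < 1" by auto
      moreover have "y = (1 - s) *\<^sub>R a + s *\<^sub>R b" using s by (simp add: algebra_simps)
      ultimately show ?thesis using ne by (auto simp: in_segment)
    qed
  qed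
  ultimately show ?thesis using that by blast
qed

lemma face_at_edge:
  assumes ab: "{a, b} \<in> E" and x: "x \<in> open_segment a b" and F'': "F'' \<in> faces E" "x \<in> closure F''"
    and F: "F \<in> faces E" "F' \<in> faces E" "side F a b" "side F' a b"
    "\<And>y. y \<in> F \<Longrightarrow> crs (b - a) (y - a) > 0" "\<And>y. y \<in> F' \<Longrightarrow> crs (b - a) (y - a) < 0"
  shows "F'' = F \<or> F'' = F'"
proof -
  obtain \<rho> where r: "\<rho> > 0" "ball x \<rho> \<subseteq> F \<union> F' \<union> open_segment a b"
    using edge_nbhd[OF ab x F] by blast
  have "x \<in> ball x \<rho> \<inter> closure F''" using F''(2) r(1) by simp
  then have "ball x \<rho> \<inter> F'' \<noteq> {}"
    using open_Int_closure_eq_empty[OF open_ball, of x \<rho> F''] by blast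
  then obtain y where y: "y \<in> ball x \<rho>" "y \<in> F''" by blast
  have "y \<notin> skeleton E" using face_disjoint_skeleton F'' y by blast
  then have "y \<notin> open_segment a b" using edge_in_skeleton[OF ab] by (auto simp: open_segment_def)
  then have "y \<in> F \<or> y \<in> F'" using r y by blast
  then show ?thesis using faces_disjoint F F'' y by blast
qed

lemma side_of_closure:
  assumes "{a, b} \<in> E" "x \<in> open_segment a b" "F \<in> faces E" "x \<in> closure F"
  shows "side F a b"
  using edge_two_faces[OF assms(1)] face_at_edge[OF assms] by metis

section \<open>The vertices of a face\<close>

definition verts :: "complex set \<Rightarrow> complex set" where
  "verts F = V \<inter> frontier F"

lemma vertex_in_closure:
  assumes "F \<in> faces E" "v \<in> V" "v \<in> closure F"
  shows "v \<in> verts F"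
  using assms frontier_face V_subset_skeleton face_disjoint_skeleton unfolding verts_def by blast

lemma side_verts: "F \<in> faces E \<Longrightarrow> side F a b \<Longrightarrow> a \<in> verts F \<and> b \<in> verts F"
  using side_ends_closure edge_ends[OF side_edge] vertex_in_closure by meson

lemma frontier_face_cases:
  assumes "F \<in> faces E" "x \<in> frontier F"
  obtains "x \<in> verts F" | a b where "side F a b" "x \<in> open_segment a b"
proof -
  obtain e where e: "e \<in> E" "x \<in> convex hull e"
    using face_frontier[OF assms(1)] assms(2) unfolding skeleton_def by blast
  obtain a b where ab: "e = {a, b}" "a \<in> V" "b \<in> V" using edge_cases[OF e(1)] by metis
  have x: "x \<in> closed_segment a b" using e ab by (simp add: segment_convex_hull)
  show ?thesis
  proof (cases "x = a \<or> x = b")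
    case True
    then show ?thesis using that(1) assms ab by (auto simp: verts_def)
  next
    case False
    then have o: "x \<in> open_segment a b" using x by (simp add: open_segment_def)
    have "x \<in> closure F" using assms(2) by (simp add: frontier_def)
    then show ?thesis using that(2) side_of_closure[OF _ o assms(1)] e ab o by blast
  qed
qed

lemma vertex_not_in_open_segment: "v \<in> V \<Longrightarrow> {a, b} \<in> E \<Longrightarrow> v \<notin> open_segment a b"
  using vertex_on_edge[of v a b] by (auto simp: open_segment_def)

text \<open>An inner point of a side has a neighbourhood made of two faces and the open side, which
  contains no vertex. So vertices of a face can accumulate only at vertices.\<close>

lemma closed_verts:
  assumes F: "F \<in> faces E"
  shows "closed (verts F)"
  unfolding closed_limpt
proof (intro allI impI)
  fix x assume x: "x islimpt verts F"
  then have "x islimpt frontier F" by (rule islimpt_subset) (simp add: verts_def)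
  then have "x \<in> frontier F" using frontier_closed closed_limpt by blast
  show "x \<in> verts F"
  proof (cases rule: frontier_face_cases[OF F \<open>x \<in> frontier F\<close>])
    case (2 a b)
    obtain G G' where G: "G \<in> faces E" "G' \<in> faces E" "side G a b" "side G' a b"
      "\<And>y. y \<in> G \<Longrightarrow> crs (b - a) (y - a) > 0" "\<And>y. y \<in> G' \<Longrightarrow> crs (b - a) (y - a) < 0"
      using edge_two_faces[OF side_edge[OF 2(1)]] by blast
    obtain \<rho> where r: "\<rho> > 0" "ball x \<rho> \<subseteq> G \<union> G' \<union> open_segment a b"
      using edge_nbhd[OF side_edge[OF 2(1)] 2(2) G] by blast
    obtain v where "v \<in> verts F" "v \<in> ball x \<rho>"
      using x r(1) unfolding islimpt_def by (metis centre_in_ball open_ball)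
    then have "v \<in> V" "v \<in> G \<union> G' \<union> open_segment a b" using r by (auto simp: verts_def)
    then have False
      using vertex_not_in_open_segment[OF _ side_edge[OF 2(1)]] V_subset_skeleton
        face_disjoint_skeleton G(1,2) by blast
    then show ?thesis ..
  qed
qed

text \<open>Prepares the use of Baire's theorem in \<open>vert_corner\<close>. Neither finite
  degrees nor local finiteness are known at this stage; instead, the midpoints of the edges are
  isolated from each other, which gives disjoint discs and thereby countably many edges.\<close>

lemma countable_V: "countable V"
proof -
  \<comment> \<open>Summing over the two-element set makes the midpoint a function of the edge,
    without an order of its ends.\<close>
  define mid where "mid = (\<lambda>e. (\<Sum>x\<in>e. x) / 2 :: complex)"
  have mid: "mid {a, b} = midpoint a b" if "a \<noteq> b" for a b
    using that by (simp add: mid_def midpoint_def scaleR_conv_of_real)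
  have in_seg: "mid {a, b} \<in> open_segment a b" if "{a, b} \<in> E" for a b
    using edge_ends(3)[OF that] by (simp add: mid midpoint_in_open_segment)
  have other: "{c, d} = {a, b}" if "{a, b} \<in> E" "{c, d} \<in> E" "mid {c, d} \<in> open_segment a b" for a b c d
    using edges_meet[OF that(2,1), of "mid {c, d}"] in_seg[OF that(2)] that(3)
    by (auto simp: open_segment_def)
  have "\<exists>\<rho>>0. \<forall>f\<in>E. mid f \<in> ball (mid e) \<rho> \<longrightarrow> f = e" if "e \<in> E" for e
  proof -
    obtain a b where e: "e = {a, b}" using edge_cases \<open>e \<in> E\<close> by metis
    then have ab: "{a, b} \<in> E" using that by simp
    obtain G G' where G: "G \<in> faces E" "G' \<in> faces E" "side G a b" "side G' a b"
      "\<And>y. y \<in> G \<Longrightarrow> crs (b - a) (y - a) > 0" "\<And>y. y \<in> G' \<Longrightarrow> crs (b - a) (y - a) < 0"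
      using edge_two_faces[OF ab] by blast
    obtain \<rho> where r: "\<rho> > 0" "ball (mid e) \<rho> \<subseteq> G \<union> G' \<union> open_segment a b"
      using edge_nbhd[OF ab in_seg[OF ab] G] e by blast
    have "f = e" if f: "f \<in> E" "mid f \<in> ball (mid e) \<rho>" for f
    proof -
      obtain c d where cd: "f = {c, d}" using edge_cases f by metis
      have "mid f \<in> skeleton E"
        using in_seg[of c d] edge_in_skeleton[of c d] f(1) cd by (auto simp: open_segment_def)
      then have "mid f \<in> open_segment a b" using f r(2) G face_disjoint_skeleton by blast
      then show ?thesis using other[OF ab] f cd e by blast
    qed
    then show ?thesis using r by blast
  qed
  then obtain \<rho> where rho: "\<And>e. e \<in> E \<Longrightarrow> \<rho> e > 0"
    "\<And>e f. e \<in> E \<Longrightarrow> f \<in> E \<Longrightarrow> mid f \<in> ball (mid e) (\<rho> e) \<Longrightarrow> f = e" by metis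
  let ?B = "\<lambda>e. ball (mid e) (\<rho> e / 2)"
  have disj: "?B e \<inter> ?B f = {}" if ef: "e \<in> E" "f \<in> E" "e \<noteq> f" for e f
  proof (rule disjoint_ballI)
    have "\<rho> e \<le> dist (mid e) (mid f)" "\<rho> f \<le> dist (mid e) (mid f)"
      using rho(2)[OF ef(1,2)] rho(2)[OF ef(2,1)] ef(3) by (auto simp: dist_commute not_less[symmetric])
    then show "\<rho> e / 2 + \<rho> f / 2 \<le> dist (mid e) (mid f)" by simp
  qed
  have "countable (?B ` E)"
  proof (rule countable_disjoint_open_subsets)
    show "pairwise disjnt (?B ` E)"
      using disj by (auto simp: pairwise_def disjnt_def)
  qed auto
  moreover have "inj_on ?B E"
  proof (rule inj_onI)
    fix e f assume ef: "e \<in> E" "f \<in> E" "?B e = ?B f"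
    then have "mid e \<in> ?B e \<inter> ?B f" using rho(1)[OF ef(1)] by auto
    then show "e = f" using disj ef by blast
  qed
  ultimately have "countable E" by (rule countable_image_inj_on)
  moreover have "countable e" if "e \<in> E" for e
    using edge_cases[OF that] by (metis countable_finite finite.emptyI finite.insertI)
  ultimately have "countable (\<Union>E)" using countable_UN[of E "\<lambda>e. e"] by simp
  moreover have "V \<subseteq> \<Union>E"
  proof
    fix v assume "v \<in> V"
    then obtain a where "{v, a} \<in> E" using has_edge by blast
    then show "v \<in> \<Union>E" by blast
  qed
  ultimately show ?thesis using countable_subset by blast
qed

end

section \<open>Corners of a face\<close>

lemma crs_i_mult: "crs z (\<i> * z) = (norm z)\<^sup>2"
  unfolding cmod_power2 by (simp add: crs_def power2_eq_square)

lemma Re_divide_inner: "Re (x / y) = (x \<bullet> y) / (norm y)\<^sup>2"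
  unfolding cmod_power2 by (simp add: Re_divide inner_complex_def)

context good_graph
begin

text \<open>The orientation is part of the notion: the face is on the left of the ray from
  \<open>w\<close> to \<open>a\<close> and on the right of the ray from \<open>w\<close> to
  \<open>b\<close>.\<close>

definition corner :: "complex set \<Rightarrow> complex \<Rightarrow> complex \<Rightarrow> complex \<Rightarrow> bool" where
  "corner F w a b \<longleftrightarrow> side F w a \<and> side F w b \<and>
     (\<forall>y\<in>F. crs (a - w) (y - w) > 0) \<and> (\<forall>y\<in>F. crs (b - w) (y - w) < 0)"

lemma side_oriented:
  assumes F: "F \<in> faces E" "side F a b"
  obtains a' b' where "{a', b'} = {a, b}" "side F a' b'" "\<And>y. y \<in> F \<Longrightarrow> crs (b' - a') (y - a') > 0"
proof (cases "\<forall>y\<in>F. crs (b - a) (y - a) > 0")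
  case True
  then show ?thesis using that[of a b] F by blast
next
  case False
  then have "\<forall>y\<in>F. crs (b - a) (y - a) < 0" using side_sign[OF F] by blast
  then have "\<forall>y\<in>F. crs (a - b) (y - b) > 0" by (auto simp: crs_flip[of a b])
  then show ?thesis using that[of b a] side_sym[OF F(2)] by blast
qed

text \<open>
  A side that passes near \<open>w\<close> without ending at \<open>w\<close> or nearby would cut across the line from a
  point of \<open>F\<close> through \<open>w\<close> just behind \<open>w\<close>, which would put \<open>w\<close> into the interior of \<open>F\<close>.
\<close>

lemma frontier_near_isolated_vertex:
  assumes F: "F \<in> faces E" and w: "w \<in> verts F" "\<not> w islimpt verts F"
  obtains \<rho> where "\<rho> > 0"
    "\<And>x. x \<in> frontier F \<Longrightarrow> x \<noteq> w \<Longrightarrow> dist x w < \<rho> \<Longrightarrow> \<exists>a. side F w a \<and> x \<in> open_segment w a"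
proof -
  obtain \<rho>0 where r0: "\<rho>0 > 0" "\<And>v. v \<in> verts F \<Longrightarrow> dist v w < \<rho>0 \<Longrightarrow> v = w"
    using w(2) unfolding islimpt_approachable by blast
  obtain p where p: "p \<in> F" using face_nonempty[OF F] by blast
  obtain \<epsilon> where e: "\<epsilon> > 0" "ball p \<epsilon> \<subseteq> F" using face_open[OF F] p open_contains_ball by blast
  have wF: "w \<in> closure F" "w \<notin> F" "w \<in> V"
    using w(1) frontier_face[OF F] by (auto simp: verts_def)
  define d where "d = dist w p"
  have d: "d > 0" using p wF by (auto simp: d_def)
  define \<rho> where "\<rho> = min (min (\<epsilon> / 4) \<rho>0) (\<epsilon> * \<rho>0 / (8 * d))"
  have rho: "\<rho> > 0" "\<rho> \<le> \<epsilon> / 4" "\<rho> \<le> \<rho>0" "\<rho> \<le> \<epsilon> * \<rho>0 / (8 * d)" using e(1) r0(1) d by (auto simp: \<rho>_def)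
  have "\<exists>a. side F w a \<and> x \<in> open_segment w a"
    if x: "x \<in> frontier F" "x \<noteq> w" "dist x w < \<rho>" for x
  proof -
    have "x \<notin> verts F" using r0(2) x rho(3) by force
    then obtain a0 b0 where ab0: "side F a0 b0" "x \<in> open_segment a0 b0"
      using frontier_face_cases[OF F x(1)] by blast
    obtain a b where ab: "{a, b} = {a0, b0}" "side F a b" "\<And>y. y \<in> F \<Longrightarrow> crs (b - a) (y - a) > 0"
      using side_oriented[OF F ab0(1)] by blast
    have xab: "x \<in> open_segment a b"
      using ab(1) ab0(2) by (metis doubleton_eq_iff open_segment_commute)
    have ne: "a \<noteq> b" using edge_ends(3)[OF side_edge[OF ab(2)]] .
    define L where "L = norm (b - a)"
    have L: "L > 0" using ne by (simp add: L_def)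
    define \<sigma> where "\<sigma> = (\<lambda>y. crs (b - a) (y - a))"
    show ?thesis
    proof (cases "w = a \<or> w = b")
      case True
      then show ?thesis using ab(2) xab side_sym open_segment_commute by metis
    next
      case False
      have ab_far: "dist a w \<ge> \<rho>0" "dist b w \<ge> \<rho>0"
        using r0(2) side_verts[OF F ab(2)] False by force+
      obtain u where u: "0 < u" "u < 1" "x = (1 - u) *\<^sub>R a + u *\<^sub>R b"
        using xab by (auto simp: in_segment)
      have xa: "x - a = u *\<^sub>R (b - a)" using u by (simp add: algebra_simps)
      have \<sigma>x: "\<sigma> x = 0" by (simp add: \<sigma>_def xa)
      have "\<sigma> w - \<sigma> x = crs (b - a) (w - x)" by (simp add: \<sigma>_def crs_diff)
      then have "\<sigma> w \<le> L * dist w x"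
        using abs_crs_le[of "b - a" "w - x"] \<sigma>x by (simp add: L_def dist_norm)
      then have \<sigma>w: "\<sigma> w \<le> L * dist x w" by (simp add: dist_commute)
      have \<sigma>w0: "\<sigma> w \<ge> 0"
        using crs_closure_nonneg[of F "b - a" a w] ab(3) wF(1) by (force simp: \<sigma>_def)
      define p' where "p' = p - (\<epsilon> / 2 / L) *\<^sub>R (\<i> * (b - a))"
      have "dist p p' = \<epsilon> / 2" using L e by (simp add: p'_def dist_norm norm_mult L_def[symmetric])
      then have "p' \<in> F" using e by auto
      then have "\<sigma> p' > 0" using ab(3) by (simp add: \<sigma>_def)
      moreover have "\<sigma> p' = \<sigma> p - \<epsilon> / 2 * L"
      proof -
        have "p' - a = (p - a) - (\<epsilon> / 2 / L) *\<^sub>R (\<i> * (b - a))" by (simp add: p'_def)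
        then have "\<sigma> p' = \<sigma> p - \<epsilon> / 2 / L * L\<^sup>2"
          by (simp only: \<sigma>_def crs_diff(2)[of _ "p - a"] crs_scaleR crs_i_mult L_def)
        then show ?thesis using L by (simp add: power2_eq_square)
      qed
      ultimately have \<sigma>p: "\<sigma> p > \<epsilon> / 2 * L" by simp
      have "L * dist x w \<le> L * (\<epsilon> / 4)" using x(3) rho(2) L by (intro mult_left_mono) auto
      then have gap: "\<sigma> p - \<sigma> w \<ge> L * (\<epsilon> / 4)" using \<sigma>w \<sigma>p by (simp add: mult.commute)
      have gap0: "\<sigma> p - \<sigma> w > 0" using gap L e(1) by (smt (verit) mult_pos_pos divide_pos_pos)
      \<comment> \<open>Chosen so that the point \<open>q\<close> behind \<open>w\<close>, as seen
        from \<open>p\<close>, lies on the line through \<open>a\<close> and \<open>b\<close>. As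
        \<open>w\<close> is close to this line and \<open>p\<close> is not, \<open>s\<close> is
        small and \<open>q\<close> is near \<open>w\<close>.\<close>
      define s where "s = \<sigma> w / (\<sigma> p - \<sigma> w)"
      have s0: "s \<ge> 0" using \<sigma>w0 gap0 by (simp add: s_def)
      have "s \<le> (L * dist x w) / (L * (\<epsilon> / 4))"
        unfolding s_def using \<sigma>w \<sigma>w0 gap L e(1) by (intro frac_le) auto
      then have s_le: "s \<le> 4 * dist x w / \<epsilon>" using L e(1) by (simp add: field_simps)
      define q where "q = w + s *\<^sub>R (w - p)"
      have "\<sigma> q = \<sigma> w + s * (\<sigma> w - \<sigma> p)"
        by (simp add: \<sigma>_def q_def crs_def algebra_simps)
      then have \<sigma>q: "\<sigma> q = 0" using gap0 by (simp add: s_def field_simps)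
      have "dist q w = s * d" using s0 by (simp add: q_def d_def dist_norm)
      also have "\<dots> \<le> 4 * dist x w / \<epsilon> * d" using s_le d by (intro mult_right_mono) auto
      also have "\<dots> \<le> 4 * (\<epsilon> * \<rho>0 / (8 * d)) / \<epsilon> * d"
        using x(3) rho(4) d e(1) by (intro mult_right_mono divide_right_mono mult_left_mono) auto
      also have "\<dots> = \<rho>0 / 2" using d e(1) by (simp add: field_simps)
      finally have qw: "dist q w < \<rho>0" using r0(1) by simp
      obtain t where t: "q - a = t *\<^sub>R (b - a)"
        using crs_eq_0_iff_collinear[of "b - a" "q - a"] \<sigma>q ne by (auto simp: \<sigma>_def)
      have xw: "dist x w < \<rho>0" using x(3) rho(3) by simp
      have between: "dist y w < \<rho>0" if "y \<in> closed_segment x q" for y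
      proof -
        have "closed_segment x q \<subseteq> ball w \<rho>0"
          using xw qw by (intro closed_segment_subset) (auto simp: dist_commute)
        then show ?thesis using that by (auto simp: dist_commute)
      qed
      \<comment> \<open>Otherwise \<open>a\<close> would lie between \<open>x\<close> and
        \<open>q\<close>, which are both within \<open>\<rho>0\<close> of \<open>w\<close>, unlike
        \<open>a\<close>.\<close>
      have t0: "0 \<le> t"
      proof (rule ccontr)
        assume t: "\<not> 0 \<le> t"
        define c where "c = u / (u - t)"
        have c: "0 \<le> c" "c \<le> 1" using t u by (auto simp: c_def)
        have "(1 - c) * u + c * t = 0" using t u by (simp add: c_def field_simps)
        moreover have "(1 - c) *\<^sub>R x + c *\<^sub>R q = a + ((1 - c) * u + c * t) *\<^sub>R (b - a)"
        proof -
          have xq: "x = a + u *\<^sub>R (b - a)" "q = a + t *\<^sub>R (b - a)"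
            using xa \<open>q - a = t *\<^sub>R (b - a)\<close> by (simp_all add: algebra_simps)
          show ?thesis unfolding xq by (simp add: algebra_simps)
        qed
        ultimately have "a = (1 - c) *\<^sub>R x + c *\<^sub>R q" by simp
        then have "a \<in> closed_segment x q" using c unfolding in_segment by blast
        then show False using between ab_far by force
      qed
      have t1: "t \<le> 1"
      proof (rule ccontr)
        assume t: "\<not> t \<le> 1"
        define c where "c = (1 - u) / (t - u)"
        have c: "0 \<le> c" "c \<le> 1" using t u by (auto simp: c_def)
        have "(1 - c) * u + c * t = u + c * (t - u)" by (simp add: algebra_simps)
        then have "(1 - c) * u + c * t = 1" using t u by (simp add: c_def)
        moreover have "(1 - c) *\<^sub>R x + c *\<^sub>R q = a + ((1 - c) * u + c * t) *\<^sub>R (b - a)"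
        proof -
          have xq: "x = a + u *\<^sub>R (b - a)" "q = a + t *\<^sub>R (b - a)"
            using xa \<open>q - a = t *\<^sub>R (b - a)\<close> by (simp_all add: algebra_simps)
          show ?thesis unfolding xq by (simp add: algebra_simps)
        qed
        ultimately have "b = (1 - c) *\<^sub>R x + c *\<^sub>R q" by simp
        then have "b \<in> closed_segment x q" using c unfolding in_segment by blast
        then show False using between ab_far by force
      qed
      have "q = (1 - t) *\<^sub>R a + t *\<^sub>R b" using t by (simp add: algebra_simps)
      then have q: "q \<in> closed_segment a b" using t0 t1 unfolding in_segment by blast
      then have qF: "q \<in> closure F" using side_frontier[OF ab(2)] by (auto simp: frontier_def)
      show ?thesis
      proof (cases "s = 0")
        case True
        then have "w \<in> closed_segment a b" using q by (simp add: q_def)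
        then show ?thesis using vertex_on_edge[OF wF(3) side_edge[OF ab(2)]] False by blast
      next
        case False
        then have s: "s > 0" using s0 by simp
        have "w = (1 - 1 / (1 + s)) *\<^sub>R p + (1 / (1 + s)) *\<^sub>R q"
        proof -
          have "(1 + s) *\<^sub>R w = s *\<^sub>R p + q" by (simp add: q_def algebra_simps)
          then have "w = (1 / (1 + s)) *\<^sub>R (s *\<^sub>R p + q)" using s
            by (metis add_pos_pos divide_self_if less_irrefl scaleR_one scaleR_scaleR
                times_divide_eq_left mult_1 zero_less_one)
          moreover have "1 - 1 / (1 + s) = s / (1 + s)" using s by (simp add: field_simps)
          ultimately show ?thesis by (simp add: scaleR_add_right)
        qed
        moreover have "p \<noteq> q"
        proof
          assume "p = q"
          then show False using p q side_frontier[OF ab(2)] frontier_face[OF F] by auto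
        qed
        moreover have "1 / (1 + s) > 0" "1 / (1 + s) < 1" using s by auto
        ultimately have "w \<in> open_segment p q" unfolding in_segment by blast
        then have "w \<in> interior F"
          using in_interior_closure_convex_segment[OF face_convex[OF F] _ qF] p face_open[OF F]
          by (metis interior_open subsetD)
        then show ?thesis using wF(2) interior_subset by blast
      qed
    qed
  qed
  then show ?thesis using that rho(1) by blast
qed

text \<open>A point \<open>z\<close> of \<open>F\<close> near \<open>w\<close> and a point
  \<open>q\<close> behind \<open>w\<close>, displaced sideways by the same amount, are joined by a
  segment that stays on the chosen side and leaves \<open>F\<close>. Here \<open>q\<close> is not in
  \<open>F\<close> because its reflection in \<open>w\<close> is, whereas \<open>w\<close> is
  not.\<close>

lemma frontier_near_vertex_on_each_side:
  assumes F: "F \<in> faces E" and w: "w \<in> frontier F" and p: "p \<in> F" and \<rho>: "\<rho> > 0"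
    and s: "s = 1 \<or> s = - 1"
  obtains x where "x \<in> frontier F" "dist x w < \<rho>" "s * crs (p - w) (x - w) > 0"
proof -
  have wF: "w \<in> closure F" "w \<notin> F" using w frontier_face[OF F] by auto
  define d where "d = p - w"
  have d: "norm d > 0" using p wF by (auto simp: d_def)
  obtain \<epsilon> where e: "\<epsilon> > 0" "ball p \<epsilon> \<subseteq> F" using face_open[OF F] p open_contains_ball by blast
  define \<delta> where "\<delta> = \<epsilon> / (2 * norm d)"
  have del: "\<delta> > 0" "\<delta> * norm d < \<epsilon>" using e d by (auto simp: \<delta>_def)
  define e' where "e' = (s * \<delta>) *\<^sub>R (\<i> * d)"
  have ne': "norm e' = \<delta> * norm d" using s del by (auto simp: e'_def norm_mult)
  have pe: "p + e' \<in> F" "p - e' \<in> F" using e(2) ne' del by (auto simp: dist_norm subset_iff)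
  have crs_e: "s * crs d e' = \<delta> * (norm d)\<^sup>2" using s by (auto simp: e'_def crs_i_mult)
  define t where "t = min 1 (\<rho> / (2 * (norm d + norm e')))"
  have nn: "norm d + norm e' > 0" using d by (simp add: add_pos_nonneg)
  have t: "0 < t" "t \<le> 1" "t * (norm d + norm e') < \<rho>"
  proof -
    show "0 < t" using nn \<rho> unfolding t_def by simp
    show "t \<le> 1" by (simp add: t_def)
    have "t * (norm d + norm e') \<le> \<rho> / (2 * (norm d + norm e')) * (norm d + norm e')"
      using nn by (intro mult_right_mono) (auto simp: t_def)
    also have "\<dots> = \<rho> / 2"
    proof -
      have "\<rho> / (2 * c) * c = \<rho> / 2" if "c > 0" for c using that by simp
      then show ?thesis using nn by blast
    qed
    finally show "t * (norm d + norm e') < \<rho>" using \<rho> by simp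
  qed
  define z where "z = w + t *\<^sub>R (d + e')"
  define z' where "z' = w + t *\<^sub>R (d - e')"
  define q where "q = w - t *\<^sub>R (d - e')"
  have inF: "w + t *\<^sub>R (y - w) \<in> F" if "y \<in> F" for y
  proof -
    have "w - t *\<^sub>R (w - y) \<in> interior F"
      using mem_interior_closure_convex_shrink[OF face_convex[OF F], of y w t] that wF t face_open[OF F]
      by (simp add: interior_open)
    then show ?thesis using face_open[OF F] by (simp add: interior_open algebra_simps)
  qed
  have z: "z \<in> F" using inF[OF pe(1)] by (simp add: z_def d_def algebra_simps)
  have z': "z' \<in> F" using inF[OF pe(2)] by (simp add: z'_def d_def algebra_simps)
  have q: "q \<notin> F"
  proof
    assume "q \<in> F"
    then have "(1/2) *\<^sub>R q + (1/2) *\<^sub>R z' \<in> F"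
      using convexD[OF face_convex[OF F] \<open>q \<in> F\<close> z'] by simp
    moreover have "(1/2) *\<^sub>R q + (1/2) *\<^sub>R z' = w"
      by (simp add: q_def z'_def scaleR_conv_of_real field_simps)
    ultimately show False using wF by simp
  qed
  have "closed_segment z q \<inter> frontier F \<noteq> {}"
    using z q by (intro connected_Int_frontier) auto
  then obtain x where x: "x \<in> closed_segment z q" "x \<in> frontier F" by blast
  then obtain u where u: "0 \<le> u" "u \<le> 1" "x = (1 - u) *\<^sub>R z + u *\<^sub>R q" by (auto simp: in_segment)
  have "norm (z - w) = t * norm (d + e')" "norm (q - w) = t * norm (d - e')"
    using t by (auto simp: z_def q_def)
  then have "norm (z - w) \<le> t * (norm d + norm e')" "norm (q - w) \<le> t * (norm d + norm e')"
    using t norm_triangle_ineq[of d e'] norm_triangle_ineq4[of d e'] by auto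
  then have "z \<in> ball w \<rho>" "q \<in> ball w \<rho>" using t(3) by (auto simp: dist_norm norm_minus_commute)
  then have "closed_segment z q \<subseteq> ball w \<rho>" by (intro closed_segment_subset) auto
  then have xw: "dist x w < \<rho>" using x by (auto simp: dist_commute)
  have "x - w = (1 - u) *\<^sub>R (z - w) + u *\<^sub>R (q - w)" by (simp add: u(3) algebra_simps)
  also have "crs d \<dots> = (1 - u) * (t * crs d e') + u * (t * crs d e')"
    by (simp add: z_def q_def crs_add crs_diff)
  finally have "crs d (x - w) = t * crs d e'" by (simp add: algebra_simps)
  then have "s * crs d (x - w) = t * (\<delta> * (norm d)\<^sup>2)" using crs_e by (simp add: mult.left_commute)
  then have "s * crs d (x - w) > 0" using t del d by simp
  then show ?thesis using that x xw unfolding d_def by blast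
qed

text \<open>Near an isolated vertex the frontier consists of sides at \<open>w\<close>, and it has
  points on both sides of the line from \<open>w\<close> to a point of the face.\<close>

lemma isolated_corner:
  assumes F: "F \<in> faces E" and w: "w \<in> verts F" "\<not> w islimpt verts F"
  obtains a b where "corner F w a b"
proof -
  obtain \<rho> where r: "\<rho> > 0"
    "\<And>x. x \<in> frontier F \<Longrightarrow> x \<noteq> w \<Longrightarrow> dist x w < \<rho> \<Longrightarrow> \<exists>a. side F w a \<and> x \<in> open_segment w a"
    using frontier_near_isolated_vertex[OF F w] by blast
  obtain p where p: "p \<in> F" using face_nonempty[OF F] by blast
  have wf: "w \<in> frontier F" using w by (simp add: verts_def)
  have one: "\<exists>a. side F w a \<and> s * crs (p - w) (a - w) > 0" if s: "s = 1 \<or> s = - 1" for s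
  proof -
    obtain x where x: "x \<in> frontier F" "dist x w < \<rho>" "s * crs (p - w) (x - w) > 0"
      using frontier_near_vertex_on_each_side[OF F wf p r(1) s] by blast
    then have "x \<noteq> w" by auto
    then obtain a where a: "side F w a" "x \<in> open_segment w a" using r(2) x by blast
    then obtain u where u: "0 < u" "x = (1 - u) *\<^sub>R w + u *\<^sub>R a" by (auto simp: in_segment)
    then have "x - w = u *\<^sub>R (a - w)" by (simp add: algebra_simps)
    then have "u * (s * crs (p - w) (a - w)) > 0" using x(3) by (simp add: mult.left_commute)
    then show ?thesis using a u by (auto simp: zero_less_mult_iff)
  qed
  obtain a where a: "side F w a" "crs (p - w) (a - w) < 0" using one[of "- 1"] by auto
  obtain b where b: "side F w b" "crs (p - w) (b - w) > 0" using one[of 1] by auto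
  have "crs (a - w) (p - w) > 0" "crs (b - w) (p - w) < 0"
    using a b crs_swap[of "p - w"] by auto
  then have "\<forall>y\<in>F. crs (a - w) (y - w) > 0" "\<forall>y\<in>F. crs (b - w) (y - w) < 0"
    using side_sign[OF F a(1)] side_sign[OF F b(1)] p by (meson less_asym)+
  then have "corner F w a b" unfolding corner_def using a b by blast
  then show ?thesis using that by blast
qed

lemma angle_at_inner:
  assumes "a \<noteq> v" "b \<noteq> v" "angle_at v a b \<le> pi - \<eta>"
  shows "(a - v) \<bullet> (b - v) \<ge> - \<kappa> * norm (a - v) * norm (b - v)"
proof -
  define z where "z = (a - v) / (b - v)"
  have z: "z \<noteq> 0" using assms by (simp add: z_def)
  have "cos (pi - \<eta>) \<le> cos \<bar>Arg z\<bar>"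
    using assms(3) eta pi_ge_two
    by (intro cos_monotone_0_pi_le) (auto simp: angle_at_def z_def)
  then have "- \<kappa> \<le> Re z / norm z" using cos_Arg[OF z] by simp
  then have "- \<kappa> * norm z \<le> Re z" using z by (simp add: field_simps)
  moreover have "Re z = ((a - v) \<bullet> (b - v)) / (norm (b - v))\<^sup>2"
    unfolding z_def by (rule Re_divide_inner)
  moreover have "norm z = norm (a - v) * norm (b - v) / (norm (b - v))\<^sup>2"
    using assms(2) by (simp add: z_def norm_divide power2_eq_square)
  ultimately have "(- \<kappa> * norm (a - v) * norm (b - v)) / (norm (b - v))\<^sup>2 \<le> ((a - v) \<bullet> (b - v)) / (norm (b - v))\<^sup>2"
    by simp
  then show ?thesis unfolding divide_le_cancel using assms(2) by auto
qed

lemma corner_props: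
  assumes F: "F \<in> faces E" and c: "corner F w a b"
  shows "(a - w) \<bullet> (b - w) \<ge> - \<kappa> * norm (a - w) * norm (b - w)"
    and "crs (a - w) (b - w) > 0"
    and "\<And>x. x \<in> closure F \<Longrightarrow> \<exists>\<alpha> \<beta>. x - w = \<alpha> *\<^sub>R (a - w) + \<beta> *\<^sub>R (b - w) \<and> \<alpha> \<ge> 0 \<and> \<beta> \<ge> 0"
proof -
  have s: "side F w a" "side F w b" and pos: "\<And>y. y \<in> F \<Longrightarrow> crs (a - w) (y - w) > 0"
    and neg: "\<And>y. y \<in> F \<Longrightarrow> crs (b - w) (y - w) < 0"
    using c by (auto simp: corner_def)
  obtain p where p: "p \<in> F" using face_nonempty[OF F] by blast
  have ne: "a \<noteq> b" using pos[OF p] neg[OF p] by auto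
  have "w \<noteq> a" "w \<noteq> b" using edge_ends(3) side_edge s by blast+
  then have "angle_at w a b \<le> pi - \<eta>"
    using good F s ne unfolding good_embedding_def inner_angles_bounded_def side_def by blast
  then show inner: "(a - w) \<bullet> (b - w) \<ge> - \<kappa> * norm (a - w) * norm (b - w)"
    using angle_at_inner \<open>w \<noteq> a\<close> \<open>w \<noteq> b\<close> by metis
  have "crs (a - w) (b - w) \<ge> 0"
    using crs_closure_nonneg[of F "a - w" w b] pos side_ends_closure(2)[OF s(2)] by force
  moreover have "crs (a - w) (b - w) \<noteq> 0"
  proof
    assume "crs (a - w) (b - w) = 0"
    then obtain t where t: "b - w = t *\<^sub>R (a - w)"
      using crs_eq_0_iff_collinear \<open>w \<noteq> a\<close> by (metis right_minus_eq)
    consider "t > 0" | "t = 0" | "t < 0" by linarith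
    then show False
    proof cases
      case 1
      then show False using pos[OF p] neg[OF p] by (simp add: t mult_less_0_iff)
    next
      case 2
      then show False using t \<open>w \<noteq> b\<close> by simp
    next
      \<comment> \<open>A straight angle has cosine -1, which is below the bound
        \<open>- \<kappa>\<close>.\<close>
      case 3
      have "(a - w) \<bullet> (b - w) = t * (norm (a - w))\<^sup>2"
        by (simp add: t power2_norm_eq_inner)
      moreover have "norm (a - w) * norm (b - w) = - t * (norm (a - w))\<^sup>2"
        using 3 by (simp add: t power2_eq_square)
      ultimately have "t * (norm (a - w))\<^sup>2 \<ge> \<kappa> * (t * (norm (a - w))\<^sup>2)"
        using inner by (simp add: mult.assoc)
      then have "(1 - \<kappa>) * (t * (norm (a - w))\<^sup>2) \<ge> 0" by (simp add: algebra_simps)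
      moreover have "t * (norm (a - w))\<^sup>2 < 0" using 3 \<open>w \<noteq> a\<close> by (simp add: mult_neg_pos)
      then have "(1 - \<kappa>) * (t * (norm (a - w))\<^sup>2) < 0"
        using kappa by (intro mult_pos_neg[of "1 - \<kappa>"]) linarith+
      ultimately show False by linarith
    qed
  qed
  ultimately show crs_pos: "crs (a - w) (b - w) > 0" by simp
  fix x assume x: "x \<in> closure F"
  have "crs (a - w) (x - w) \<ge> 0" "crs (b - w) (x - w) \<le> 0"
    using crs_closure_nonneg[of F "a - w" w x] crs_closure_nonpos[of F "b - w" w x] pos neg x by force+
  then have nn: "crs (a - w) (x - w) / crs (a - w) (b - w) \<ge> 0" "crs (x - w) (b - w) / crs (a - w) (b - w) \<ge> 0"
    using crs_pos crs_swap[of "b - w" "x - w"] by auto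
  have "x - w = (1 / crs (a - w) (b - w)) *\<^sub>R (crs (a - w) (b - w) *\<^sub>R (x - w))"
    using crs_pos by simp
  also have "\<dots> = (crs (x - w) (b - w) / crs (a - w) (b - w)) *\<^sub>R (a - w)
      + (crs (a - w) (x - w) / crs (a - w) (b - w)) *\<^sub>R (b - w)"
    unfolding crs_coords[of "a - w" "b - w" "x - w"] by (simp add: scaleR_add_right)
  finally show "\<exists>\<alpha> \<beta>. x - w = \<alpha> *\<^sub>R (a - w) + \<beta> *\<^sub>R (b - w) \<and> \<alpha> \<ge> 0 \<and> \<beta> \<ge> 0"
    using nn by blast
qed

text \<open>The sine of \<open>\<eta> / 2\<close>, by the half-angle formula.\<close>

definition \<delta> :: real where "\<delta> = sqrt ((1 - \<kappa>) / 2)"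

lemma delta: "0 < \<delta>" "\<delta> \<le> 1"
  using kappa by (auto simp: \<delta>_def)

text \<open>
  The direction of the bisector.  Those of two corners of a face make an angle that is bounded
  below, because each of the corners lies in the cone of the other one.
\<close>

lemma corner_normal:
  assumes F: "F \<in> faces E" and c: "corner F w a b"
  obtains n where "norm n = 1" "\<And>x. x \<in> closure F \<Longrightarrow> n \<bullet> (x - w) \<ge> \<delta> * dist x w"
proof
  have ne: "w \<noteq> a" "w \<noteq> b" using c edge_ends(3) side_edge unfolding corner_def by blast+
  define A where "A = (1 / norm (a - w)) *\<^sub>R (a - w)"
  define B where "B = (1 / norm (b - w)) *\<^sub>R (b - w)"
  have nA: "norm A = 1" "norm B = 1" using ne by (auto simp: A_def B_def)
  then have AA: "A \<bullet> A = 1" "B \<bullet> B = 1" by (simp_all add: norm_eq_sqrt_inner)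
  have aA: "a - w = norm (a - w) *\<^sub>R A" "b - w = norm (b - w) *\<^sub>R B" using ne by (auto simp: A_def B_def)
  have "A \<bullet> B = ((a - w) \<bullet> (b - w)) / (norm (a - w) * norm (b - w))"
    by (simp add: A_def B_def)
  moreover have "- \<kappa> * (norm (a - w) * norm (b - w)) \<le> (a - w) \<bullet> (b - w)"
    using corner_props(1)[OF F c] by (simp add: mult.assoc)
  ultimately have AB: "A \<bullet> B \<ge> - \<kappa>"
    using ne by (simp only: pos_le_divide_eq) (simp add: pos_le_divide_eq)
  define N where "N = norm (A + B)"
  have N2: "N\<^sup>2 = 2 + 2 * (A \<bullet> B)"
    unfolding N_def power2_norm_eq_inner by (simp add: inner_add_left inner_add_right AA inner_commute)
  have "(2 * \<delta>)\<^sup>2 = 2 * (1 - \<kappa>)" using kappa by (simp add: \<delta>_def power_mult_distrib)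
  then have "(2 * \<delta>)\<^sup>2 \<le> N\<^sup>2" using N2 AB by simp
  then have N: "2 * \<delta> \<le> N" by (rule power2_le_imp_le) (simp add: N_def)
  have N0: "N > 0" using N delta by simp
  show "norm ((1 / N) *\<^sub>R (A + B)) = 1" using N0 by (simp add: N_def)
  fix x assume "x \<in> closure F"
  then obtain \<alpha> \<beta> where x: "x - w = \<alpha> *\<^sub>R (a - w) + \<beta> *\<^sub>R (b - w)" "\<alpha> \<ge> 0" "\<beta> \<ge> 0"
    using corner_props(3)[OF F c] by blast
  have AN: "(A + B) \<bullet> A = N\<^sup>2 / 2" "(A + B) \<bullet> B = N\<^sup>2 / 2"
    unfolding N2 by (simp_all add: inner_add_left inner_add_right AA inner_commute)
  have ABa: "(A + B) \<bullet> (a - w) = norm (a - w) * (N\<^sup>2 / 2)" "(A + B) \<bullet> (b - w) = norm (b - w) * (N\<^sup>2 / 2)"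
    by (subst aA, simp add: AN)+
  then have "(A + B) \<bullet> (x - w) = (\<alpha> * norm (a - w) + \<beta> * norm (b - w)) * (N\<^sup>2 / 2)"
    unfolding x(1) inner_add_right[of "A + B"] inner_scaleR_right ABa by (simp only: distrib_right mult.assoc)
  then have "((1 / N) *\<^sub>R (A + B)) \<bullet> (x - w) = (\<alpha> * norm (a - w) + \<beta> * norm (b - w)) * (N / 2)"
    using N0 by (simp add: power2_eq_square)
  moreover have "dist x w \<le> \<alpha> * norm (a - w) + \<beta> * norm (b - w)"
    unfolding dist_norm x(1) using x(2,3) by (intro norm_triangle_le) simp
  then have "dist x w * \<delta> \<le> (\<alpha> * norm (a - w) + \<beta> * norm (b - w)) * (N / 2)"
    using N delta x(2,3) by (intro mult_mono) auto
  ultimately show "((1 / N) *\<^sub>R (A + B)) \<bullet> (x - w) \<ge> \<delta> * dist x w" by (simp add: mult.commute)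
qed

lemma card_corners:
  assumes F: "F \<in> faces E" and S: "\<And>w. w \<in> S \<Longrightarrow> \<exists>a b. corner F w a b"
  shows "finite S \<and> real (card S) \<le> (1 / \<delta> + 1)\<^sup>2"
proof -
  have "\<exists>n. norm n = 1 \<and> (\<forall>x\<in>closure F. n \<bullet> (x - w) \<ge> \<delta> * dist x w)" if "w \<in> S" for w
    using S[OF that] corner_normal[OF F] by metis
  then obtain n where n: "\<And>w. w \<in> S \<Longrightarrow> norm (n w) = 1"
    "\<And>w x. w \<in> S \<Longrightarrow> x \<in> closure F \<Longrightarrow> n w \<bullet> (x - w) \<ge> \<delta> * dist x w" by metis
  have cl: "w \<in> closure F" if "w \<in> S" for w
    using S[OF that] side_ends_closure unfolding corner_def by blast
  have "finite S \<and> real (card S) \<le> (2 * 1 / (2 * \<delta>) + 1)\<^sup>2"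
  proof (rule card_separated_points[where c = n and p = 0])
    fix w w' assume w: "w \<in> S" "w' \<in> S" "w \<noteq> w'"
    have "n w \<bullet> (w' - w) \<ge> \<delta> * dist w' w" "n w' \<bullet> (w - w') \<ge> \<delta> * dist w w'"
      using n(2) cl w by auto
    then have "2 * \<delta> * dist w w' \<le> n w \<bullet> (w' - w) + n w' \<bullet> (w - w')"
      by (simp add: dist_commute)
    also have "\<dots> = (n w - n w') \<bullet> (w' - w)"
      by (simp add: inner_diff_left inner_diff_right)
    also have "\<dots> \<le> dist (n w) (n w') * dist w w'"
      using norm_cauchy_schwarz[of "n w - n w'" "w' - w"] by (simp add: dist_norm norm_minus_commute)
    finally show "2 * \<delta> \<le> dist (n w) (n w')" using w(3) by simp
  qed (use n(1) delta in auto)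
  then show ?thesis by simp
qed

text \<open>
  A priori, the vertices of a face may accumulate.  By Baire's theorem the isolated ones are dense
  among them; being corners, they are finite in number, so there are no others.
\<close>

lemma vert_corner:
  assumes F: "F \<in> faces E" and w: "w \<in> verts F"
  obtains a b where "corner F w a b"
proof -
  let ?I = "{w\<in>verts F. \<not> w islimpt verts F}"
  have fin: "finite ?I"
    using card_corners[OF F, of ?I] isolated_corner[OF F] by blast
  have "countable (verts F)" using countable_V by (rule countable_subset[rotated]) (simp add: verts_def)
  then have "verts F \<subseteq> closure ?I"
    using countable_closed_isolated_dense closed_verts[OF F] by blast
  also have "closure ?I = ?I" using fin by (simp add: finite_imp_closed)
  finally show ?thesis using w isolated_corner[OF F, of w] that by blast
qed

lemma card_verts:
  assumes F: "F \<in> faces E"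
  shows "finite (verts F)" "real (card (verts F)) \<le> (1 / \<delta> + 1)\<^sup>2"
  using card_corners[OF F, of "verts F"] vert_corner[OF F] by blast+

end

section \<open>Size and shape of faces\<close>

context good_graph
begin

text \<open>A third side strictly between the two would have \<open>a\<close> and \<open>b\<close>
  on different sides of its line, but the face is on one side only.\<close>

lemma corner_sides:
  assumes F: "F \<in> faces E" and c: "corner F w a b" and x: "side F w x"
  shows "x = a \<or> x = b"
proof -
  have s: "side F w a" "side F w b" using c by (auto simp: corner_def)
  obtain \<alpha> \<beta> where ab: "x - w = \<alpha> *\<^sub>R (a - w) + \<beta> *\<^sub>R (b - w)" "\<alpha> \<ge> 0" "\<beta> \<ge> 0"
    using corner_props(3)[OF F c] side_ends_closure(2)[OF x] by blast
  have xw: "x \<noteq> w" using edge_ends(3)[OF side_edge[OF x]] by simp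
  consider "\<alpha> = 0" | "\<beta> = 0" | "\<alpha> > 0" "\<beta> > 0" using ab by fastforce
  then show ?thesis
  proof cases
    case 1
    then have "x - w = \<beta> *\<^sub>R (b - w)" "\<beta> > 0" using ab xw by (auto simp: less_le)
    then show ?thesis using edges_on_ray[OF side_edge[OF s(2)] side_edge[OF x]] by blast
  next
    case 2
    then have "x - w = \<alpha> *\<^sub>R (a - w)" "\<alpha> > 0" using ab xw by (auto simp: less_le)
    then show ?thesis using edges_on_ray[OF side_edge[OF s(1)] side_edge[OF x]] by blast
  next
    case 3
    have cAB: "crs (a - w) (b - w) > 0" using corner_props(2)[OF F c] .
    have "crs (x - w) (a - w) = - (\<beta> * crs (a - w) (b - w))"
      unfolding ab(1) by (simp add: crs_add crs_swap[of "b - w" "a - w"])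
    then have xa: "crs (x - w) (a - w) < 0" using cAB 3 by simp
    have "crs (x - w) (b - w) = \<alpha> * crs (a - w) (b - w)"
      unfolding ab(1) by (simp add: crs_add)
    then have xb: "crs (x - w) (b - w) > 0" using cAB 3 by simp
    show ?thesis
    proof (cases "\<forall>y\<in>F. crs (x - w) (y - w) > 0")
      case True
      then have "crs (x - w) (a - w) \<ge> 0"
        using crs_closure_nonneg[of F "x - w" w a] side_ends_closure(2)[OF s(1)] by force
      then show ?thesis using xa by simp
    next
      case False
      then have "\<forall>y\<in>F. crs (x - w) (y - w) < 0" using side_sign[OF F x] by blast
      then have "crs (x - w) (b - w) \<le> 0"
        using crs_closure_nonpos[of F "x - w" w b] side_ends_closure(2)[OF s(2)] by force
      then show ?thesis using xb by simp
    qed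
  qed
qed

text \<open>What is left of a corner when its orientation is forgotten, so that \<open>a\<close> and
  \<open>b\<close> may be exchanged.\<close>

definition wedge :: "complex set \<Rightarrow> complex \<Rightarrow> complex \<Rightarrow> complex \<Rightarrow> bool" where
  "wedge F w a b \<longleftrightarrow> side F w a \<and> side F w b \<and> crs (a - w) (b - w) \<noteq> 0 \<and>
     (a - w) \<bullet> (b - w) \<ge> - \<kappa> * norm (a - w) * norm (b - w) \<and>
     (\<forall>x\<in>closure F. \<exists>\<alpha> \<beta>. x - w = \<alpha> *\<^sub>R (a - w) + \<beta> *\<^sub>R (b - w) \<and> \<alpha> \<ge> 0 \<and> \<beta> \<ge> 0)"

lemma wedge_sym: "wedge F w a b \<Longrightarrow> wedge F w b a"
  unfolding wedge_def
  by (simp add: crs_swap[of "b - w" "a - w"] inner_commute mult_ac) (metis add.commute)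

lemma corner_wedge: "F \<in> faces E \<Longrightarrow> corner F w a b \<Longrightarrow> wedge F w a b"
  using corner_props[of F w a b] unfolding wedge_def corner_def by auto

lemma vert_wedge:
  assumes "F \<in> faces E" "w \<in> verts F"
  obtains a b where "wedge F w a b"
  using vert_corner[OF assms] corner_wedge[OF assms(1)] by metis

lemma side_wedge:
  assumes F: "F \<in> faces E" and a: "side F w a"
  obtains b where "wedge F w a b"
proof -
  obtain p q where c: "corner F w p q" using vert_corner[OF F] side_verts[OF F a] by blast
  then have "wedge F w p q" "wedge F w q p" using corner_wedge[OF F] wedge_sym by blast+
  then show ?thesis using corner_sides[OF F c a] that by blast
qed

text \<open>The constant of \<open>angle_lower_bound\<close>: a lower bound for the sine of every
  inner angle.\<close>

definition \<sigma> :: real where "\<sigma> = sqrt (1 - \<kappa>\<^sup>2) / (4 * D * (1 + D))"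

lemma sigma: "\<sigma> > 0"
proof -
  have "\<kappa> * \<kappa> < 1 * 1" using kappa by (intro mult_strict_mono') auto
  then show ?thesis using D by (simp add: \<sigma>_def power2_eq_square)
qed

lemma edge_ratio': "{u, v} \<in> E \<Longrightarrow> {u, w} \<in> E \<Longrightarrow> norm (w - u) \<le> D * norm (v - u)"
  using edge_ratio[of u v w] by (simp add: dist_norm norm_minus_commute)

lemma wedge_angle_lower:
  assumes F: "F \<in> faces E" and w: "wedge F b a c"
  shows "\<bar>crs (a - b) (c - b)\<bar> \<ge> \<sigma> * norm (a - b) * norm (c - b)"
proof -
  have sab: "side F a b" "side F c b" using w side_sym unfolding wedge_def by blast+
  obtain c' where c': "wedge F c b c'" using side_wedge[OF F sab(2)] .
  obtain d where d: "wedge F a b d" using side_wedge[OF F sab(1)] .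
  have cl: "c' \<in> closure F" "d \<in> closure F" "a \<in> closure F" "c \<in> closure F"
    using c' d w side_ends_closure unfolding wedge_def by blast+
  obtain \<alpha>1 \<beta>1 where 1: "c' - b = \<alpha>1 *\<^sub>R (a - b) + \<beta>1 *\<^sub>R (c - b)" "\<alpha>1 \<ge> 0" "\<beta>1 \<ge> 0"
    using w cl unfolding wedge_def by blast
  obtain \<alpha>2 \<beta>2 where 2: "d - b = \<alpha>2 *\<^sub>R (c - b) + \<beta>2 *\<^sub>R (a - b)" "\<alpha>2 \<ge> 0" "\<beta>2 \<ge> 0"
    using wedge_sym[OF w] cl unfolding wedge_def by blast
  obtain \<alpha>3 \<beta>3 where 3: "a - c = \<alpha>3 *\<^sub>R (c' - c) + \<beta>3 *\<^sub>R (b - c)" "\<alpha>3 \<ge> 0" "\<beta>3 \<ge> 0"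
    using wedge_sym[OF c'] cl unfolding wedge_def by blast
  obtain \<alpha>4 \<beta>4 where 4: "c - a = \<alpha>4 *\<^sub>R (d - a) + \<beta>4 *\<^sub>R (b - a)" "\<alpha>4 \<ge> 0" "\<beta>4 \<ge> 0"
    using wedge_sym[OF d] cl unfolding wedge_def by blast
  have e: "{c, b} \<in> E" "{c, c'} \<in> E" "{a, b} \<in> E" "{a, d} \<in> E"
    using c' d side_edge unfolding wedge_def by blast+
  have len: "norm (c - b) \<le> D * norm (c' - c)" "norm (c' - c) \<le> D * norm (c - b)"
      "norm (a - b) \<le> D * norm (d - a)" "norm (d - a) \<le> D * norm (a - b)"
    using edge_ratio'[OF e(2,1)] edge_ratio'[OF e(1,2)] edge_ratio'[OF e(4,3)] edge_ratio'[OF e(3,4)]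
    by (simp_all add: norm_minus_commute)
  show ?thesis
    by (rule angle_lower_bound[OF _ kappa \<sigma>_def _ _ _ _ 1 2 3 4 len])
      (use D w c' d in \<open>auto simp: wedge_def\<close>)
qed

text \<open>Otherwise there is a supporting line through an inner point of the triangle. Its
  functional attains its minimum over the triangle at an inner point, so it is constant on the
  triangle and hence 0.\<close>

lemma triangle_interior:
  assumes F: "F \<in> faces E" and cl: "v \<in> closure F" "a \<in> closure F" "b \<in> closure F"
    and ne: "crs (a - v) (b - v) \<noteq> 0" and ab: "\<alpha> > 0" "\<beta> > 0" "\<alpha> + \<beta> < 1"
  shows "v + \<alpha> *\<^sub>R (a - v) + \<beta> *\<^sub>R (b - v) \<in> F" (is "?x \<in> F")
proof (rule ccontr)
  assume "?x \<notin> F"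
  have "(1 - (\<alpha> + \<beta>)) *\<^sub>R v + \<alpha> *\<^sub>R a + \<beta> *\<^sub>R b \<in> convex hull {v, a, b}"
    unfolding convex_hull_3 using ab by (intro CollectI exI[of _ "1 - (\<alpha> + \<beta>)"] exI[of _ \<alpha>] exI[of _ \<beta>]) auto
  moreover have "convex hull {v, a, b} \<subseteq> closure F"
    using cl convex_closure[OF face_convex[OF F]] by (intro hull_minimal) auto
  moreover have "?x = (1 - (\<alpha> + \<beta>)) *\<^sub>R v + \<alpha> *\<^sub>R a + \<beta> *\<^sub>R b" by (simp add: algebra_simps)
  ultimately have "?x \<in> closure F" by auto
  moreover have "?x \<notin> rel_interior F"
    using \<open>?x \<notin> F\<close> face_open[OF F] by (simp add: rel_interior_open)
  ultimately obtain n where n: "n \<noteq> 0" "\<And>y. y \<in> closure F \<Longrightarrow> n \<bullet> ?x \<le> n \<bullet> y"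
    using supporting_hyperplane_relative_frontier[OF face_convex[OF F]] by metis
  define p where "p = n \<bullet> (a - v)"
  define q where "q = n \<bullet> (b - v)"
  define m where "m = \<alpha> * p + \<beta> * q"
  have xv: "n \<bullet> ?x = n \<bullet> v + m" by (simp add: m_def p_def q_def inner_add_right)
  have m: "m \<le> 0" "m \<le> p" "m \<le> q"
    using n(2)[OF cl(1)] n(2)[OF cl(2)] n(2)[OF cl(3)] unfolding xv
    by (auto simp: p_def q_def inner_diff_right)
  have m0: "m = 0"
  proof (rule ccontr)
    assume "m \<noteq> 0"
    then have "m < (\<alpha> + \<beta>) * m" using m ab(3) by (simp add: less_le mult_less_cancel_right2)
    also have "\<dots> \<le> m"
    proof -
      have "\<alpha> * m \<le> \<alpha> * p" "\<beta> * m \<le> \<beta> * q" using m ab by (simp_all add: mult_left_mono)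
      then show ?thesis using m_def by (simp only: distrib_right)
    qed
    finally show False by simp
  qed
  then have pq: "p \<ge> 0" "q \<ge> 0" "\<alpha> * p + \<beta> * q = 0" using m by (auto simp: m_def)
  then have "\<alpha> * p = 0" "\<beta> * q = 0" using ab by (auto simp: add_nonneg_eq_0_iff)
  then have "p = 0" "q = 0" using ab by auto
  have "crs (a - v) (b - v) * (n \<bullet> n) = n \<bullet> (crs (a - v) (b - v) *\<^sub>R n)" by simp
  also have "\<dots> = crs n (b - v) * p + crs (a - v) n * q"
    unfolding crs_coords[of "a - v" "b - v" n] by (simp add: inner_add_right p_def q_def)
  finally show False using \<open>p = 0\<close> \<open>q = 0\<close> ne n(1) by simp
qed

section \<open>Going around the frontier of a face\<close>

definition sides :: "complex set \<Rightarrow> (complex \<times> complex) set" where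
  "sides F = {(a, b). side F a b}"

definition nn :: nat where "nn = nat \<lceil>(1 / \<delta> + 1)\<^sup>2\<rceil>"

lemma card_verts_le: "F \<in> faces E \<Longrightarrow> card (verts F) \<le> nn"
  using card_verts(2)[of F] unfolding nn_def by linarith

lemma finite_sides: "F \<in> faces E \<Longrightarrow> finite (sides F)"
  and card_sides: "F \<in> faces E \<Longrightarrow> card (sides F) \<le> nn * nn"
proof -
  assume F: "F \<in> faces E"
  have sub: "sides F \<subseteq> verts F \<times> verts F" using side_verts[OF F] by (auto simp: sides_def)
  have fin: "finite (verts F \<times> verts F)" using card_verts(1)[OF F] by simp
  show "finite (sides F)" using sub fin finite_subset by blast
  have "card (sides F) \<le> card (verts F) * card (verts F)"
    using card_mono[OF fin sub] by (simp add: card_cartesian_product)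
  also have "\<dots> \<le> nn * nn" using card_verts_le[OF F] by (intro mult_mono) auto
  finally show "card (sides F) \<le> nn * nn" .
qed

lemma frontier_eq_sides:
  assumes F: "F \<in> faces E"
  shows "frontier F = (\<Union>(a, b)\<in>sides F. closed_segment a b)"
proof
  show "(\<Union>(a, b)\<in>sides F. closed_segment a b) \<subseteq> frontier F"
    using side_frontier by (auto simp: sides_def)
  show "frontier F \<subseteq> (\<Union>(a, b)\<in>sides F. closed_segment a b)"
  proof
    fix x assume x: "x \<in> frontier F"
    show "x \<in> (\<Union>(a, b)\<in>sides F. closed_segment a b)"
    proof (cases rule: frontier_face_cases[OF F x])
      case 1
      then obtain a b where "wedge F x a b" using vert_wedge[OF F] by blast
      then have "(x, a) \<in> sides F" by (auto simp: wedge_def sides_def)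
      then show ?thesis by force
    next
      case (2 a b)
      then show ?thesis by (force simp: sides_def open_segment_def)
    qed
  qed
qed

lemma bounded_frontier: "F \<in> faces E \<Longrightarrow> bounded (frontier F)"
  unfolding frontier_eq_sides using finite_sides by (intro bounded_UN) (auto simp: compact_imp_bounded)

text \<open>The frontier consists of finitely many segments. An unbounded face would therefore
  contain the complement of a disc and, by convexity, the whole plane.\<close>

lemma bounded_face:
  assumes F: "F \<in> faces E"
  shows "bounded F"
proof (rule ccontr)
  assume unb: "\<not> bounded F"
  obtain R where R: "frontier F \<subseteq> ball 0 R" "R > 0"
    using bounded_frontier[OF F] bounded_subset_ballD by blast
  have con: "connected (- ball (0::complex) R)"
    by (rule connected_complement_bounded_convex) auto
  have "- ball 0 R \<inter> F \<noteq> {}"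
    using unb bounded_subset[OF bounded_ball, of F 0 R] by blast
  moreover have "- ball 0 R \<inter> frontier F = {}" using R by blast
  ultimately have sub: "- ball 0 R \<subseteq> F" using connected_Int_frontier[OF con] by blast
  have "z \<in> F" for z
  proof -
    define M where "M = complex_of_real (R + norm z)"
    have nM: "norm M = R + norm z" using R by (simp add: M_def del: of_real_add)
    have "R \<le> norm (z + M)" "R \<le> norm (z - M)"
      using norm_triangle_ineq4[of "z + M" z] norm_triangle_ineq4[of z "z - M"] nM by auto
    then have "z + M \<in> F" "z - M \<in> F" using sub by auto
    then have "(1/2) *\<^sub>R (z + M) + (1/2) *\<^sub>R (z - M) \<in> F"
      using face_convex[OF F] by (intro convexD) auto
    moreover have "(1/2) *\<^sub>R (z + M) + (1/2) *\<^sub>R (z - M) = z"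
      by (simp add: scaleR_conv_of_real field_simps)
    ultimately show ?thesis by simp
  qed
  moreover obtain v where "v \<in> V" using infinite_V by (metis ex_in_conv finite.emptyI)
  ultimately show False using V_subset_skeleton face_disjoint_skeleton[OF F] by blast
qed

lemma connected_frontier: "F \<in> faces E \<Longrightarrow> connected (frontier F)"
  using connected_complement_bounded_convex[OF bounded_face face_convex] face_convex
  by (intro connected_frontier_simple) (auto simp: convex_connected)

lemma verts_nonempty:
  assumes F: "F \<in> faces E"
  shows "verts F \<noteq> {}"
proof -
  have "F \<noteq> UNIV" using bounded_face[OF F] by auto
  then have "frontier F \<noteq> {}" using face_nonempty[OF F] frontier_eq_empty by blast
  then obtain x where x: "x \<in> frontier F" by blast
  show ?thesis
    using x by (cases rule: frontier_face_cases[OF F x]) (use side_verts[OF F] in auto)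
qed

text \<open>Each of the at most \<open>nn * nn\<close> oriented sides contributes an interval of
  length \<open>2 * ln D\<close> to the chain of logarithms in
  \<open>sides_comparable\<close>.\<close>

definition \<Lambda> :: real where "\<Lambda> = D ^ (2 * (nn * nn))"

lemma sides_comparable:
  assumes F: "F \<in> faces E" and ab: "side F a b" and cd: "side F c d"
  shows "dist a b \<le> \<Lambda> * dist c d"
proof -
  have pos: "dist x y > 0" if "side F x y" for x y
    using edge_ends(3)[OF side_edge[OF that]] by simp
  \<comment> \<open>Intervals about the logarithm of the length; the slack \<open>ln D\<close> makes
    those of adjacent sides meet.\<close>
  define lo where "lo = (\<lambda>(x :: complex, y). ln (dist x y :: real) - ln D :: real)"
  define hi where "hi = (\<lambda>(x :: complex, y). ln (dist x y :: real) + ln D :: real)"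
  have lnD: "ln D > 0" using D by simp
  have ratio: "\<bar>ln (dist x y) - ln (dist x' y')\<bar> \<le> ln D"
    if s: "side F x y" "side F x' y'" and m: "z \<in> closed_segment x y" "z \<in> closed_segment x' y'" for x y x' y' z
  proof -
    have "dist x y \<le> D * dist x' y' \<and> dist x' y' \<le> D * dist x y"
    proof (cases "{x, y} = {x', y'}")
      case True
      then have "dist x y = dist x' y'" by (auto simp: doubleton_eq_iff dist_commute)
      then show ?thesis using D pos[OF s(1)] by simp
    next
      case False
      then have z: "z \<in> {x, y}" "z \<in> {x', y'}" using edges_meet[OF side_edge[OF s(1)] side_edge[OF s(2)] _ m] by auto
      obtain p where p: "{z, p} = {x, y}" using z(1) by auto
      obtain p' where p': "{z, p'} = {x', y'}" using z(2) by auto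
      have "dist x y = dist z p" "dist x' y' = dist z p'"
        using p p' by (auto simp: doubleton_eq_iff dist_commute)
      moreover have "{z, p} \<in> E" "{z, p'} \<in> E" using p p' s side_edge by auto
      ultimately show ?thesis using edge_ratio by simp
    qed
    moreover have "D * dist x y > 0" "D * dist x' y' > 0" "dist x y > 0" "dist x' y' > 0"
      using pos s D by simp_all
    ultimately have "ln (dist x y) \<le> ln (D * dist x' y')" "ln (dist x' y') \<le> ln (D * dist x y)"
      by (simp_all only: ln_le_cancel_iff)
    then show ?thesis using D pos[OF s(1)] pos[OF s(2)] by (simp add: ln_mult)
  qed
  have "\<bar>ln (dist a b) - ln (dist c d)\<bar> \<le> (\<Sum>j\<in>sides F. hi j - lo j)"
  proof (rule connected_interval_chain[where K = "\<lambda>(x, y). closed_segment x (y :: complex)"])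
    show "connected (frontier F)" by (rule connected_frontier[OF F])
    show "finite (sides F)" by (rule finite_sides[OF F])
    show "frontier F \<subseteq> (\<Union>(x, y)\<in>sides F. closed_segment x y)" using frontier_eq_sides[OF F] by simp
    show "(a, b) \<in> sides F" "(c, d) \<in> sides F" using ab cd by (auto simp: sides_def)
    show "ln (dist a b) \<in> {lo (a, b)..hi (a, b)}" "ln (dist c d) \<in> {lo (c, d)..hi (c, d)}"
      using lnD by (auto simp: lo_def hi_def)
    fix j assume j: "j \<in> sides F"
    then obtain x y where xy: "j = (x, y)" "side F x y" by (auto simp: sides_def)
    show "closed (case j of (x, y) \<Rightarrow> closed_segment x y)" using xy by simp
    show "(case j of (x, y) \<Rightarrow> closed_segment x y) \<inter> frontier F \<noteq> {}"
      using xy side_frontier[OF xy(2)] by auto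
    show "lo j \<le> hi j" using xy lnD by (simp add: lo_def hi_def)
    fix i assume i: "i \<in> sides F"
      and m: "(case i of (x, y) \<Rightarrow> closed_segment x y) \<inter> (case j of (x, y) \<Rightarrow> closed_segment x y) \<inter> frontier F \<noteq> {}"
    then obtain x' y' where xy': "i = (x', y')" "side F x' y'" by (auto simp: sides_def)
    then obtain z where "z \<in> closed_segment x' y'" "z \<in> closed_segment x y" using m xy by auto
    then have "\<bar>ln (dist x' y') - ln (dist x y)\<bar> \<le> ln D" using ratio xy(2) xy'(2) by blast
    then have "ln (dist x y) \<in> {lo i..hi i} \<inter> {lo j..hi j}"
      using xy xy' lnD by (auto simp: lo_def hi_def)
    then show "{lo i..hi i} \<inter> {lo j..hi j} \<noteq> {}" by blast
  qed
  also have "\<dots> = card (sides F) * (2 * ln D)"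
    by (simp add: lo_def hi_def case_prod_beta)
  also have "\<dots> \<le> real (nn * nn) * (2 * ln D)"
  proof -
    have "real (card (sides F)) \<le> real (nn * nn)" using card_sides[OF F] by (simp only: of_nat_le_iff)
    then show ?thesis using lnD by (intro mult_right_mono) auto
  qed
  also have "\<dots> = ln \<Lambda>" using D by (simp add: \<Lambda>_def ln_realpow)
  finally have "ln (dist a b) \<le> ln \<Lambda> + ln (dist c d)" by linarith
  also have "\<dots> = ln (\<Lambda> * dist c d)" using D pos[OF cd] by (simp add: \<Lambda>_def ln_mult)
  finally show ?thesis using D pos[OF ab] pos[OF cd] by (simp add: \<Lambda>_def)
qed

text \<open>The condition on \<open>f\<close> concerns only the vertices, where the sides meet, and
  the two end points, so that it covers arbitrary functions on the vertices as well as linear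
  functionals.\<close>

lemma chain_on_frontier:
  fixes f :: "complex \<Rightarrow> real"
  assumes F: "F \<in> faces E" and x: "x \<in> frontier F" and y: "y \<in> frontier F"
    and f: "\<And>a b z. side F a b \<Longrightarrow> z \<in> closed_segment a b \<Longrightarrow> z \<in> {x, y} \<union> verts F \<Longrightarrow>
      f z \<in> {min (f a) (f b)..max (f a) (f b)}"
  shows "\<bar>f x - f y\<bar> \<le> (\<Sum>(a, b)\<in>sides F. \<bar>f a - f b\<bar>)"
proof -
  define lo where "lo = (\<lambda>(a, b). min (f a) (f b))"
  define hi where "hi = (\<lambda>(a, b). max (f a) (f b))"
  obtain a b where ab: "side F a b" "x \<in> closed_segment a b"
    using x frontier_eq_sides[OF F] by (auto simp: sides_def)
  obtain c d where cd: "side F c d" "y \<in> closed_segment c d"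
    using y frontier_eq_sides[OF F] by (auto simp: sides_def)
  have "\<bar>f x - f y\<bar> \<le> (\<Sum>j\<in>sides F. hi j - lo j)"
  proof (rule connected_interval_chain[where K = "\<lambda>(x, y). closed_segment x (y :: complex)"])
    show "connected (frontier F)" by (rule connected_frontier[OF F])
    show "finite (sides F)" by (rule finite_sides[OF F])
    show "frontier F \<subseteq> (\<Union>(x, y)\<in>sides F. closed_segment x y)" using frontier_eq_sides[OF F] by simp
    show "(a, b) \<in> sides F" "(c, d) \<in> sides F" using ab cd by (auto simp: sides_def)
    show "f x \<in> {lo (a, b)..hi (a, b)}" "f y \<in> {lo (c, d)..hi (c, d)}"
      using f[OF ab] f[OF cd] by (auto simp: lo_def hi_def)
    fix j assume j: "j \<in> sides F"
    then obtain p q where pq: "j = (p, q)" "side F p q" by (auto simp: sides_def)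
    show "closed (case j of (x, y) \<Rightarrow> closed_segment x y)" using pq by simp
    show "(case j of (x, y) \<Rightarrow> closed_segment x y) \<inter> frontier F \<noteq> {}"
      using pq side_frontier[OF pq(2)] by auto
    show "lo j \<le> hi j" using pq by (simp add: lo_def hi_def)
    fix i assume i: "i \<in> sides F"
      and m: "(case i of (x, y) \<Rightarrow> closed_segment x y) \<inter> (case j of (x, y) \<Rightarrow> closed_segment x y) \<inter> frontier F \<noteq> {}"
    then obtain p' q' where pq': "i = (p', q')" "side F p' q'" by (auto simp: sides_def)
    then obtain z where z: "z \<in> closed_segment p' q'" "z \<in> closed_segment p q" using m pq by auto
    show "{lo i..hi i} \<inter> {lo j..hi j} \<noteq> {}"
    proof (cases "{p, q} = {p', q'}")
      case True
      then show ?thesis using pq pq' by (auto simp: lo_def hi_def doubleton_eq_iff min.commute max.commute)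
    next
      case False
      then have "z \<in> {p, q}" using edges_meet[OF side_edge[OF pq(2)] side_edge[OF pq'(2)] False z(2,1)] by blast
      then have "z \<in> verts F" using side_verts[OF F pq(2)] by auto
      then have "f z \<in> {lo i..hi i} \<inter> {lo j..hi j}"
        using f[OF pq(2) z(2)] f[OF pq'(2) z(1)] pq pq' by (auto simp: lo_def hi_def)
      then show ?thesis by blast
    qed
  qed
  also have "\<dots> = (\<Sum>(a, b)\<in>sides F. \<bar>f a - f b\<bar>)"
    by (intro sum.cong) (auto simp: lo_def hi_def)
  finally show ?thesis .
qed

lemma osc_verts:
  assumes F: "F \<in> faces E" and x: "x \<in> verts F" "y \<in> verts F"
  shows "\<bar>f x - f y\<bar> \<le> (\<Sum>(a, b)\<in>sides F. \<bar>f a - f b :: real\<bar>)"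
proof (rule chain_on_frontier[OF F])
  fix a b z assume s: "side F a b" "z \<in> closed_segment a b" "z \<in> {x, y} \<union> verts F"
  then have "z \<in> V" using x by (auto simp: verts_def)
  then have "z = a \<or> z = b" using vertex_on_edge side_edge s by blast
  then show "f z \<in> {min (f a) (f b)..max (f a) (f b)}" by auto
qed (use x in \<open>auto simp: verts_def\<close>)

definition M :: real where "M = real (nn * nn) * \<Lambda>"

text \<open>Two frontier points are compared by the linear functional in the direction of their
  difference, which the chain of sides controls. The other points are in the convex hull of the
  frontier by the Krein-Milman theorem, and discs are convex.\<close>

lemma face_diam:
  assumes F: "F \<in> faces E" and ab: "side F a b" and x: "x \<in> closure F" "y \<in> closure F"
  shows "dist x y \<le> M * dist a b"
proof -
  have fr: "dist x y \<le> M * dist a b" if "x \<in> frontier F" "y \<in> frontier F" for x y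
  proof -
    define n where "n = sgn (x - y)"
    have n: "norm n \<le> 1" by (simp add: n_def norm_sgn)
    have "\<bar>n \<bullet> x - n \<bullet> y\<bar> \<le> (\<Sum>(p, q)\<in>sides F. \<bar>n \<bullet> p - n \<bullet> q\<bar>)"
    proof (rule chain_on_frontier[OF F that])
      fix p q z :: complex assume "z \<in> closed_segment p q"
      then obtain u where u: "0 \<le> u" "u \<le> 1" "z = (1 - u) *\<^sub>R p + u *\<^sub>R q" by (auto simp: in_segment)
      then have z: "n \<bullet> z = (1 - u) * (n \<bullet> p) + u * (n \<bullet> q)" by (simp add: inner_add_right)
      show "n \<bullet> z \<in> {min (n \<bullet> p) (n \<bullet> q)..max (n \<bullet> p) (n \<bullet> q)}"
        unfolding z using convex_bound_le[of "n \<bullet> p" "max (n \<bullet> p) (n \<bullet> q)" "n \<bullet> q" "1 - u" u]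
          convex_bound_le[of "- (n \<bullet> p)" "- min (n \<bullet> p) (n \<bullet> q)" "- (n \<bullet> q)" "1 - u" u] u by auto
    qed
    also have "\<dots> \<le> (\<Sum>j\<in>sides F. \<Lambda> * dist a b)"
    proof (rule sum_mono)
      fix j assume "j \<in> sides F"
      then obtain p q where j: "j = (p, q)" "side F p q" by (auto simp: sides_def)
      have "\<bar>n \<bullet> p - n \<bullet> q\<bar> \<le> norm n * norm (p - q)"
        using Cauchy_Schwarz_ineq2[of n "p - q"] by (simp add: inner_diff_right)
      also have "\<dots> \<le> 1 * dist p q" using n by (intro mult_mono) (auto simp: dist_norm)
      also have "\<dots> \<le> \<Lambda> * dist a b" using sides_comparable[OF F j(2) ab] by simp
      finally show "(case j of (p, q) \<Rightarrow> \<bar>n \<bullet> p - n \<bullet> q\<bar>) \<le> \<Lambda> * dist a b" using j by simp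
    qed
    also have "\<dots> = real (card (sides F)) * (\<Lambda> * dist a b)" by simp
    also have "\<dots> \<le> real (nn * nn) * (\<Lambda> * dist a b)"
      using card_sides[OF F] D by (intro mult_right_mono) (simp_all only: of_nat_le_iff, simp add: \<Lambda>_def)
    finally have "\<bar>n \<bullet> x - n \<bullet> y\<bar> \<le> M * dist a b" by (simp add: M_def)
    moreover have "n \<bullet> x - n \<bullet> y = dist x y"
      unfolding inner_diff_right[symmetric] n_def sgn_div_norm
      by (cases "x = y") (simp_all add: dist_norm dot_square_norm power2_eq_square)
    ultimately show ?thesis by simp
  qed
  have comp: "compact (closure F)" using bounded_face[OF F] by simp
  have "F \<subseteq> interior (closure F)" by (simp add: closure_subset face_open[OF F] interior_maximal)
  then have "frontier (closure F) \<subseteq> frontier F" using frontier_face[OF F] by (auto simp: frontier_def)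
  then have hull: "closure F \<subseteq> convex hull (frontier F)"
    using Krein_Milman_frontier[OF convex_closure[OF face_convex[OF F]] comp] hull_mono by metis
  have "closure F \<subseteq> cball z (M * dist a b)" if "z \<in> frontier F" for z
  proof -
    have "frontier F \<subseteq> cball z (M * dist a b)" using fr[OF that] by auto
    then show ?thesis using hull hull_minimal[where S = convex, OF _ convex_cball] by blast
  qed
  then have "frontier F \<subseteq> cball x (M * dist a b)"
    using x(1) by (metis dist_commute mem_cball subsetD subsetI)
  then have "closure F \<subseteq> cball x (M * dist a b)"
    using hull hull_minimal[where S = convex, OF _ convex_cball] by blast
  then show ?thesis using x(2) by auto
qed

section \<open>The faces around a vertex\<close>

definition faces_at :: "complex \<Rightarrow> complex set set" where
  "faces_at v = {F \<in> faces E. v \<in> closure F}"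

lemma edge_face:
  assumes "{a, b} \<in> E"
  obtains F where "F \<in> faces E" "side F a b"
  using edge_two_faces[OF assms] .

lemma vertex_sector:
  assumes F: "F \<in> faces E" and va: "{v, a0} \<in> E" and v: "v \<in> closure F"
    and x: "x \<in> closure F" "x \<noteq> v" "dist x v < \<delta> * dist v a0 / D"
  shows "x \<in> F \<or> (\<exists>a. side F v a \<and> x \<in> open_segment v a)"
proof -
  obtain a b where w: "wedge F v a b"
    using vert_wedge[OF F] vertex_in_closure[OF F edge_ends(1)[OF va] v] by blast
  obtain \<alpha> \<beta> where ab: "x - v = \<alpha> *\<^sub>R (a - v) + \<beta> *\<^sub>R (b - v)" "\<alpha> \<ge> 0" "\<beta> \<ge> 0"
    using w x(1) unfolding wedge_def by blast
  have s: "side F v a" "side F v b" using w by (auto simp: wedge_def)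
  have len: "dist v a0 / D \<le> norm (a - v)" "dist v a0 / D \<le> norm (b - v)"
    using edge_ratio[OF side_edge[OF s(1)] va] edge_ratio[OF side_edge[OF s(2)] va] D
    by (auto simp: field_simps dist_norm norm_minus_commute)
  have L: "dist v a0 / D > 0" using edge_ends(3)[OF va] D by simp
  have "\<delta> * (\<alpha> * norm (a - v) + \<beta> * norm (b - v)) \<le> norm (x - v)"
    unfolding ab(1) \<delta>_def using w kappa ab by (intro norm_cone_ge) (auto simp: wedge_def)
  also have "\<dots> < \<delta> * (dist v a0 / D)" using x(3) by (simp add: dist_norm)
  finally have "\<alpha> * norm (a - v) + \<beta> * norm (b - v) < dist v a0 / D"
    using delta(1) by (simp only: mult_less_cancel_left_pos)
  moreover have "\<alpha> * (dist v a0 / D) + \<beta> * (dist v a0 / D) \<le> \<alpha> * norm (a - v) + \<beta> * norm (b - v)"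
    using len ab by (intro add_mono mult_left_mono) auto
  ultimately have "(\<alpha> + \<beta>) * (dist v a0 / D) < 1 * (dist v a0 / D)"
    unfolding distrib_right by linarith
  then have sum: "\<alpha> + \<beta> < 1" using L by (simp only: mult_less_cancel_right_pos)
  have seg: "x \<in> open_segment v c" if c: "x - v = \<gamma> *\<^sub>R (c - v)" "0 \<le> \<gamma>" "\<gamma> < 1" for \<gamma> c
  proof -
    have "\<gamma> \<noteq> 0" "v \<noteq> c" using c x(2) by auto
    moreover have "x = (1 - \<gamma>) *\<^sub>R v + \<gamma> *\<^sub>R c" using c(1) by (simp add: algebra_simps)
    ultimately show ?thesis unfolding in_segment using c by (intro conjI exI[of _ \<gamma>]) auto
  qed
  consider "\<alpha> = 0" | "\<beta> = 0" | "\<alpha> > 0" "\<beta> > 0" using ab by fastforce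
  then show ?thesis
  proof cases
    case 1
    then have "x \<in> open_segment v b" using seg[of \<beta> b] ab sum by simp
    then show ?thesis using s by blast
  next
    case 2
    then have "x \<in> open_segment v a" using seg[of \<alpha> a] ab sum by simp
    then show ?thesis using s by blast
  next
    case 3
    have "v + \<alpha> *\<^sub>R (a - v) + \<beta> *\<^sub>R (b - v) \<in> F"
      using triangle_interior[OF F v] side_ends_closure s w 3 sum unfolding wedge_def by blast
    also have "v + \<alpha> *\<^sub>R (a - v) + \<beta> *\<^sub>R (b - v) = x" using ab(1) by (simp add: algebra_simps)
    finally show ?thesis by blast
  qed
qed

text \<open>Serves to count the faces at \<open>v\<close>: as these are disjoint, the centres are
  separated, at bounded relative distance from \<open>v\<close>. The centre is on the bisector, and
  the lower bound on the angle leaves room for the ball.\<close>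

lemma face_contains_ball_near_vertex:
  assumes F: "F \<in> faces E" and va: "{v, a0} \<in> E" and v: "v \<in> closure F"
  obtains m where "dist v m \<le> dist v a0 / (2 * D)" "ball m (\<sigma> * dist v a0 / (4 * D)) \<subseteq> F"
proof -
  obtain a b where w: "wedge F v a b"
    using vert_wedge[OF F] vertex_in_closure[OF F edge_ends(1)[OF va] v] by blast
  have s: "side F v a" "side F v b" using w by (auto simp: wedge_def)
  define A where "A = a - v"
  define B where "B = b - v"
  define t where "t = dist v a0 / (4 * D)"
  have L: "dist v a0 / D > 0" using edge_ends(3)[OF va] D by simp
  have t: "t > 0" using L by (simp add: t_def)
  have len: "4 * t \<le> norm A" "4 * t \<le> norm B"
    using edge_ratio[OF side_edge[OF s(1)] va] edge_ratio[OF side_edge[OF s(2)] va] D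
    by (auto simp: field_simps dist_norm norm_minus_commute A_def B_def t_def)
  have nz: "norm A > 0" "norm B > 0" using len t by linarith+
  have cAB: "crs A B \<noteq> 0" "\<bar>crs A B\<bar> \<ge> \<sigma> * norm A * norm B"
    using w wedge_angle_lower[OF F w] by (auto simp: wedge_def A_def B_def)
  define m where "m = v + (t / norm A) *\<^sub>R A + (t / norm B) *\<^sub>R B"
  have "v - m = - ((t / norm A) *\<^sub>R A + (t / norm B) *\<^sub>R B)" by (simp add: m_def)
  then have "dist v m = norm ((t / norm A) *\<^sub>R A + (t / norm B) *\<^sub>R B)"
    unfolding dist_norm by (metis norm_minus_cancel)
  also have "\<dots> \<le> norm ((t / norm A) *\<^sub>R A) + norm ((t / norm B) *\<^sub>R B)" by (rule norm_triangle_ineq)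
  also have "\<dots> = 2 * t" using nz t by simp
  finally have "dist v m \<le> dist v a0 / (2 * D)" by (simp add: t_def)
  moreover have "ball m (\<sigma> * dist v a0 / (4 * D)) \<subseteq> F"
  proof
    fix y assume "y \<in> ball m (\<sigma> * dist v a0 / (4 * D))"
    then have e: "norm (y - m) < \<sigma> * t" by (simp add: t_def dist_norm norm_minus_commute)
    define \<alpha>' where "\<alpha>' = crs (y - m) B / crs A B"
    define \<beta>' where "\<beta>' = crs A (y - m) / crs A B"
    have ym: "y - m = \<alpha>' *\<^sub>R A + \<beta>' *\<^sub>R B"
    proof -
      have "y - m = (1 / crs A B) *\<^sub>R (crs A B *\<^sub>R (y - m))" using cAB by simp
      then show ?thesis unfolding crs_coords[of A B] by (simp add: scaleR_add_right \<alpha>'_def \<beta>'_def)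
    qed
    have "\<bar>\<alpha>'\<bar> \<le> (norm (y - m) * norm B) / (\<sigma> * norm A * norm B)"
      unfolding \<alpha>'_def abs_divide using abs_crs_le[of "y - m" B] cAB sigma nz
      by (intro frac_le) auto
    also have "\<dots> = norm (y - m) / (\<sigma> * norm A)" using nz by simp
    also have "\<dots> < \<sigma> * t / (\<sigma> * norm A)" using e sigma nz by (intro divide_strict_right_mono) auto
    finally have a1: "\<bar>\<alpha>'\<bar> < t / norm A" using sigma by simp
    have "\<bar>\<beta>'\<bar> \<le> (norm A * norm (y - m)) / (\<sigma> * norm A * norm B)"
      unfolding \<beta>'_def abs_divide using abs_crs_le[of A "y - m"] cAB sigma nz
      by (intro frac_le) auto
    also have "\<dots> = norm (y - m) / (\<sigma> * norm B)" using nz by simp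
    also have "\<dots> < \<sigma> * t / (\<sigma> * norm B)" using e sigma nz by (intro divide_strict_right_mono) auto
    finally have b1: "\<bar>\<beta>'\<bar> < t / norm B" using sigma by simp
    have q: "t / norm A \<le> 1 / 4" "t / norm B \<le> 1 / 4" using len nz by (simp_all add: field_simps)
    have "v + (t / norm A + \<alpha>') *\<^sub>R (a - v) + (t / norm B + \<beta>') *\<^sub>R (b - v) \<in> F"
    proof (rule triangle_interior[OF F v])
      show "t / norm A + \<alpha>' > 0" "t / norm B + \<beta>' > 0" "t / norm A + \<alpha>' + (t / norm B + \<beta>') < 1"
        using a1 b1 q by linarith+
    qed (use s side_ends_closure w in \<open>auto simp: wedge_def\<close>)
    also have "v + (t / norm A + \<alpha>') *\<^sub>R (a - v) + (t / norm B + \<beta>') *\<^sub>R (b - v) = m + (y - m)"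
      unfolding ym by (simp add: m_def A_def B_def algebra_simps)
    finally show "y \<in> F" by simp
  qed
  ultimately show ?thesis using that by blast
qed

lemma faces_at_bound:
  assumes v: "v \<in> V"
  shows "finite (faces_at v)" "real (card (faces_at v)) \<le> (4 / \<sigma> + 1)\<^sup>2"
proof -
  obtain a0 where va: "{v, a0} \<in> E" using has_edge[OF v] .
  define L where "L = dist v a0"
  have L: "L > 0" using edge_ends(3)[OF va] by (simp add: L_def)
  have "\<forall>F\<in>faces_at v. \<exists>m. dist v m \<le> L / (2 * D) \<and> ball m (\<sigma> * L / (4 * D)) \<subseteq> F"
  proof
    fix F assume "F \<in> faces_at v"
    then have "F \<in> faces E" "v \<in> closure F" by (auto simp: faces_at_def)
    then obtain m where "dist v m \<le> L / (2 * D)" "ball m (\<sigma> * L / (4 * D)) \<subseteq> F"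
      using face_contains_ball_near_vertex[OF _ va] unfolding L_def by blast
    then show "\<exists>m. dist v m \<le> L / (2 * D) \<and> ball m (\<sigma> * L / (4 * D)) \<subseteq> F" by blast
  qed
  from bchoice[OF this] obtain m where m: "\<And>F. F \<in> faces_at v \<Longrightarrow> dist v (m F) \<le> L / (2 * D)"
    "\<And>F. F \<in> faces_at v \<Longrightarrow> ball (m F) (\<sigma> * L / (4 * D)) \<subseteq> F" by blast
  have r: "\<sigma> * L / (4 * D) > 0" using sigma L D by simp
  have "finite (faces_at v) \<and> real (card (faces_at v)) \<le> (2 * (L / (2 * D)) / (\<sigma> * L / (4 * D)) + 1)\<^sup>2"
  proof (rule card_separated_points[where c = m and p = v])
    fix F G assume FG: "F \<in> faces_at v" "G \<in> faces_at v" "F \<noteq> G"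
    have "m G \<in> G" using m(2)[OF FG(2)] r by auto
    then have "m G \<notin> F" using faces_disjoint FG unfolding faces_at_def by blast
    then have "m G \<notin> ball (m F) (\<sigma> * L / (4 * D))" using m(2)[OF FG(1)] by blast
    then show "\<sigma> * L / (4 * D) \<le> dist (m F) (m G)" by simp
  qed (use m(1) r L D in auto)
  moreover have "2 * (L / (2 * D)) / (\<sigma> * L / (4 * D)) = 4 / \<sigma>" using L D sigma by simp
  ultimately show "finite (faces_at v)" "real (card (faces_at v)) \<le> (4 / \<sigma> + 1)\<^sup>2" by auto
qed

lemma edge_nbhd_faces_at:
  assumes va: "{v, a} \<in> E" and x: "x \<in> open_segment v a"
  obtains \<rho> F F' where "\<rho> > 0" "F \<in> faces_at v" "F' \<in> faces_at v" "side F v a" "side F' v a"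
    "ball x \<rho> \<subseteq> F \<union> F' \<union> open_segment v a" 
proof -
  obtain F F' where F: "F \<in> faces E" "F' \<in> faces E" "side F v a" "side F' v a"
    "\<And>y. y \<in> F \<Longrightarrow> crs (a - v) (y - v) > 0" "\<And>y. y \<in> F' \<Longrightarrow> crs (a - v) (y - v) < 0"
    using edge_two_faces[OF va] by blast
  obtain \<rho> where "\<rho> > 0" "ball x \<rho> \<subseteq> F \<union> F' \<union> open_segment v a"
    using edge_nbhd[OF va x F] by blast
  then show ?thesis using that F side_ends_closure unfolding faces_at_def by blast
qed

text \<open>
  The union of the closed faces at \<open>v\<close> is both open and closed in a small punctured disc.
\<close>

lemma vertex_star:
  assumes va: "{v, a0} \<in> E" and x: "dist x v < \<delta> * dist v a0 / D"
  obtains F where "F \<in> faces_at v" "x \<in> closure F"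
proof -
  define R where "R = \<delta> * dist v a0 / D"
  have v: "v \<in> V" and ne: "v \<noteq> a0" using edge_ends[OF va] by auto
  have R: "R > 0" using delta D ne by (simp add: R_def)
  define K where "K = (\<Union>F\<in>faces_at v. closure F)"
  have clK: "closed K" unfolding K_def using faces_at_bound(1)[OF v] by auto
  have vK: "v \<in> K"
  proof -
    obtain G where "G \<in> faces E" "side G v a0" using edge_face[OF va] .
    then show ?thesis using side_ends_closure(1)[of G v a0] unfolding K_def faces_at_def by auto
  qed
  have "ball v R - {v} \<subseteq> K"
  proof -
    have con: "connected (ball v R - {v})"
      using R by (intro connected_punctured_convex) (auto simp: aff_dim_open)
    have "ball v R - {v} \<subseteq> interior K \<union> - K"
    proof
      fix y assume y: "y \<in> ball v R - {v}"
      show "y \<in> interior K \<union> - K"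
      proof (cases "y \<in> K")
        case True
        then obtain F where F: "F \<in> faces_at v" "y \<in> closure F" by (auto simp: K_def)
        then have Ff: "F \<in> faces E" "v \<in> closure F" by (auto simp: faces_at_def)
        have FK: "G \<subseteq> K" if "G \<in> faces_at v" for G
          using that closure_subset[of G] by (auto simp: K_def)
        have "y \<in> F \<or> (\<exists>a. side F v a \<and> y \<in> open_segment v a)"
          using vertex_sector[OF Ff(1) va Ff(2) F(2)] y by (auto simp: R_def dist_commute)
        then show ?thesis
        proof
          assume "y \<in> F"
          then show ?thesis using face_open[OF Ff(1)] FK[OF F(1)] interiorI by blast
        next
          assume "\<exists>a. side F v a \<and> y \<in> open_segment v a"
          then obtain a where a: "side F v a" "y \<in> open_segment v a" by blast
          obtain \<rho> G G' where G: "\<rho> > 0" "G \<in> faces_at v" "G' \<in> faces_at v" "side G v a" "side G' v a"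
            "ball y \<rho> \<subseteq> G \<union> G' \<union> open_segment v a"
            using edge_nbhd_faces_at[OF side_edge[OF a(1)] a(2)] by blast
          have "open_segment v a \<subseteq> closure F"
            using side_frontier[OF a(1)] by (auto simp: open_segment_def frontier_def)
          then have "ball y \<rho> \<subseteq> K" using G(6) FK[OF G(2)] FK[OF G(3)] F(1) unfolding K_def by blast
          then have "y \<in> interior K" using G(1) by (meson centre_in_ball interiorI open_ball)
          then show ?thesis by simp
        qed
      qed simp
    qed
    then have "interior K \<inter> (ball v R - {v}) = {} \<or> - K \<inter> (ball v R - {v}) = {}"
      using clK interior_subset[of K] by (intro connectedD[OF con]) auto
    moreover have "interior K \<inter> (ball v R - {v}) \<noteq> {}"
    proof -
      obtain G where G: "G \<in> faces E" "side G v a0" using edge_face[OF va] .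
      have "v \<in> closure G" using side_ends_closure(1)[OF G(2)] .
      then obtain g where g: "g \<in> G" "dist g v < R" using R by (meson closure_approachable)
      have "G \<in> faces_at v" using G \<open>v \<in> closure G\<close> by (simp add: faces_at_def)
      then have "G \<subseteq> interior K"
        using face_open[OF G(1)] closure_subset[of G] by (intro interior_maximal) (auto simp: K_def)
      moreover have "g \<noteq> v" using g(1) v V_subset_skeleton face_disjoint_skeleton[OF G(1)] by blast
      ultimately show ?thesis using g by (auto simp: dist_commute)
    qed
    ultimately show ?thesis by blast
  qed
  then have "x \<in> K" using x vK by (cases "x = v") (auto simp: R_def dist_commute)
  then show ?thesis using that by (auto simp: K_def)
qed

text \<open>The star of \<open>v\<close> covers this disc, and there the closed faces at
  \<open>v\<close> consist of \<open>v\<close>, points of faces and inner points of edges at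
  \<open>v\<close>.\<close>

lemma vertices_far:
  assumes va: "{v, a0} \<in> E" and w: "w \<in> V" "w \<noteq> v"
  shows "\<delta> * dist v a0 / D \<le> dist v w"
proof (rule ccontr)
  assume "\<not> ?thesis"
  then have d: "dist w v < \<delta> * dist v a0 / D" by (simp add: dist_commute)
  obtain F where F: "F \<in> faces_at v" "w \<in> closure F" using vertex_star[OF va d] .
  then have Ff: "F \<in> faces E" "v \<in> closure F" by (auto simp: faces_at_def)
  have "w \<notin> F" using w(1) V_subset_skeleton face_disjoint_skeleton[OF Ff(1)] by blast
  then obtain a where "side F v a" "w \<in> open_segment v a"
    using vertex_sector[OF Ff(1) va Ff(2) F(2) w(2) d] by blast
  then show False using vertex_not_in_open_segment[OF w(1) side_edge] by blast
qed

section \<open>Isolation radii and the size of nearby faces\<close>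

abbreviation rad :: "complex \<Rightarrow> real" where "rad \<equiv> isolation_radius V"

lemma rad_le: "w \<in> V \<Longrightarrow> w \<noteq> v \<Longrightarrow> rad v \<le> dist v w"
  unfolding isolation_radius_def by (intro cINF_lower bdd_belowI2[of _ 0]) auto

lemma rad_le_edge: "{v, a} \<in> E \<Longrightarrow> rad v \<le> dist v a"
  using rad_le edge_ends by metis

lemma rad_ge:
  assumes "{v, a} \<in> E"
  shows "\<delta> * dist v a / D \<le> rad v"
  unfolding isolation_radius_def
proof (rule cINF_greatest)
  show "V - {v} \<noteq> {}" using edge_ends[OF assms] by blast
qed (use vertices_far[OF assms] in auto)

lemma rad_pos: "v \<in> V \<Longrightarrow> rad v > 0"
  using has_edge[of v] rad_ge[of v] edge_ends(3)[of v] delta D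
  by (metis divide_pos_pos dist_pos_lt less_le_trans mult_pos_pos less_trans zero_less_one)

lemma edge_le_rad:
  assumes "{v, a} \<in> E"
  shows "dist v a \<le> D / \<delta> * rad v"
  using rad_ge[OF assms] D delta by (simp add: field_simps)

lemma face_diam_rad:
  assumes F: "F \<in> faces E" and v: "v \<in> verts F" and x: "x \<in> closure F" "y \<in> closure F"
  shows "dist x y \<le> M * (D / \<delta>) * rad v"
proof -
  obtain a b where "wedge F v a b" using vert_wedge[OF F v] by blast
  then have a: "side F v a" by (simp add: wedge_def)
  have "M \<ge> 0" using D by (simp add: M_def \<Lambda>_def)
  have "dist x y \<le> M * dist v a" using face_diam[OF F a x] .
  also have "\<dots> \<le> M * (D / \<delta> * rad v)"
    using edge_le_rad[OF side_edge[OF a]] \<open>M \<ge> 0\<close> by (intro mult_left_mono)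
  finally show ?thesis by simp
qed

text \<open>In \<open>edge_le_dist_to_vertex\<close>, the first entry bounds the relative height of
  the vertex over the edge by 1/2, and the second one keeps the base point between the ends of the
  edge.\<close>

definition c1 :: real where "c1 = min (\<sigma> / (2 * D)) (\<delta> / (4 * D * (1 + D * M / \<sigma>)))"

lemma M_nonneg: "M \<ge> 0"
  using D by (simp add: M_def \<Lambda>_def)

lemma c1: "c1 > 0" "c1 \<le> \<sigma> / (2 * D)" "c1 * (1 + D * M / \<sigma>) \<le> \<delta> / (4 * D)" "c1 \<le> \<delta> / (4 * D)"
proof -
  have g: "1 + D * M / \<sigma> \<ge> 1" using D M_nonneg sigma by simp
  show "c1 > 0" using sigma delta D g by (simp add: c1_def)
  show "c1 \<le> \<sigma> / (2 * D)" by (simp add: c1_def)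
  have "c1 * (1 + D * M / \<sigma>) \<le> \<delta> / (4 * D * (1 + D * M / \<sigma>)) * (1 + D * M / \<sigma>)"
    using g by (intro mult_right_mono) (auto simp: c1_def)
  also have "\<dots> = \<delta> / (4 * D)"
  proof -
    have "\<delta> / (4 * D * e) * e = \<delta> / (4 * D)" if "e \<ge> 1" for e using that by simp
    then show ?thesis using g by blast
  qed
  finally show *: "c1 * (1 + D * M / \<sigma>) \<le> \<delta> / (4 * D)" .
  show "c1 \<le> \<delta> / (4 * D)" using * \<open>c1 > 0\<close> mult_left_mono[OF g, of c1] by linarith
qed

text \<open>
  Near the middle of an edge, the plane is covered by the triangles spanned by the edge and its
  successor on either of the two faces; near the ends, it is covered by the stars of the ends.
\<close>

lemma edge_le_dist_to_vertex:
  assumes ab: "{a, b} \<in> E" and v: "v \<in> V" "v \<noteq> a" "v \<noteq> b" and z: "z \<in> closed_segment a b"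
  shows "dist a b \<le> dist z v / c1 \<or> dist a b \<le> M * (D / \<delta>) * rad v"
proof (rule ccontr)
  assume neg: "\<not> ?thesis"
  define L where "L = dist a b"
  define s where "s = dist z v"
  have ne: "a \<noteq> b" using edge_ends[OF ab] by blast
  have L: "L > 0" using ne by (simp add: L_def)
  have s: "s < c1 * L" "s \<ge> 0" using neg c1(1) by (auto simp: L_def s_def field_simps)
  define m where "m = \<delta> * L / (2 * D)"
  have m0: "m > 0" using delta L D by (simp add: m_def)
  have "c1 * L \<le> \<delta> / (4 * D) * L" using c1(4) L by (intro mult_right_mono) auto
  then have sm: "s \<le> m / 2" using s by (simp add: m_def)
  have "2 * m \<le> dist a v" "2 * m \<le> dist b v"
    using vertices_far[OF ab v(1,2)] vertices_far[of b a v] ab v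
    by (auto simp: m_def L_def insert_commute dist_commute)
  then have zm: "dist z a \<ge> m" "dist z b \<ge> m"
    using sm m0 dist_triangle[of a v z] dist_triangle[of b v z] by (auto simp: s_def dist_commute)
  \<comment> \<open>The sign \<open>e\<close> tells on which side of the edge \<open>G\<close> and
    \<open>v\<close> lie, so that one argument serves both faces. The triangle has its apex at the
    successor \<open>p\<close> of the edge on \<open>G\<close>.\<close>
  have key: "v \<in> closure G" if G: "G \<in> faces E" "side G a b"
    and sg: "\<And>y. y \<in> G \<Longrightarrow> e * crs (b - a) (y - a) > 0" "e * crs (b - a) (v - a) \<ge> 0" "\<bar>e\<bar> = 1"
  for G and e :: real
  proof -
    obtain p where w: "wedge G b a p" using side_wedge[OF G(1) side_sym[OF G(2)]] .
    then have sp: "side G b p" by (simp add: wedge_def)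
    have pc: "p \<in> closure G" using side_ends_closure(2)[OF sp] .
    have "crs (a - b) (p - b) = - crs (b - a) (p - a)" by (rule crs_flip)
    then have h1: "\<bar>crs (b - a) (p - a)\<bar> \<ge> \<sigma> * L * norm (p - b)" "crs (b - a) (p - a) \<noteq> 0"
      using wedge_angle_lower[OF G(1) w] w by (auto simp: L_def dist_norm wedge_def)
    have "L \<le> D * norm (p - b)"
      using edge_ratio'[OF side_edge[OF sp] , of a] ab by (simp add: L_def dist_norm insert_commute)
    then have "L / D \<le> norm (p - b)" using D by (simp add: field_simps)
    then have "\<sigma> * L * (L / D) \<le> \<sigma> * L * norm (p - b)" using sigma L by (intro mult_left_mono) auto
    then have h: "\<bar>crs (b - a) (p - a)\<bar> \<ge> \<sigma> * L * (L / D)" using h1 by simp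
    have "crs (e *\<^sub>R (b - a)) (p - a) \<ge> 0"
      by (rule crs_closure_nonneg[OF _ pc]) (use sg(1) in \<open>auto intro: less_imp_le\<close>)
    then have ep: "e * crs (b - a) (p - a) \<ge> 0" by simp
    define t where "t = crs (b - a) (v - a) / crs (b - a) (p - a)"
    have "e = 1 \<or> e = - 1" using sg(3) by linarith
    then have t0: "t \<ge> 0"
      using sg(2) ep by (auto simp: t_def divide_nonneg_nonneg divide_nonpos_nonpos)
    obtain u where "z - a = u *\<^sub>R (b - a)"
      using z by (auto simp: in_segment algebra_simps)
    then have "crs (b - a) (z - a) = 0" by simp
    then have "crs (b - a) (v - a) = crs (b - a) (v - z)" by (simp add: crs_diff)
    then have num: "\<bar>crs (b - a) (v - a)\<bar> \<le> L * s"
      using abs_crs_le[of "b - a" "v - z"] by (simp add: L_def s_def dist_norm norm_minus_commute)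
    have "t = \<bar>t\<bar>" using t0 by simp
    also have "\<dots> \<le> (L * s) / (\<sigma> * L * (L / D))"
      unfolding t_def abs_divide using num h sigma L D s by (intro frac_le) auto
    also have "\<dots> = D / \<sigma> * (s / L)" using L by (simp add: field_simps)
    finally have ts: "t \<le> D / \<sigma> * (s / L)" .
    also have "\<dots> \<le> D / \<sigma> * c1" using s L D sigma by (intro mult_left_mono) (auto simp: field_simps)
    also have "\<dots> \<le> D / \<sigma> * (\<sigma> / (2 * D))" using c1(2) D sigma by (intro mult_left_mono) auto
    also have "\<dots> = 1 / 2" using D sigma by simp
    finally have t1: "t \<le> 1 / 2" .
    have zG: "z \<in> closure G" using z side_frontier[OF G(2)] by (auto simp: frontier_def)
    have "dist p z \<le> M * L" using face_diam[OF G pc zG] by (simp add: L_def)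
    then have "t * dist p z \<le> (D / \<sigma> * (s / L)) * (M * L)"
      using ts t0 by (intro mult_mono) auto
    also have "\<dots> = s * (D * M / \<sigma>)" using L by simp
    finally have "s + t * dist p z \<le> s * (1 + D * M / \<sigma>)" by (simp add: algebra_simps)
    also have "\<dots> \<le> (c1 * L) * (1 + D * M / \<sigma>)"
      using s D M_nonneg sigma by (intro mult_right_mono) auto
    also have "\<dots> = (c1 * (1 + D * M / \<sigma>)) * L" by simp
    also have "\<dots> \<le> \<delta> / (4 * D) * L" using c1(3) L by (intro mult_right_mono) auto
    also have "\<dots> = 1 / 2 * m" by (simp add: m_def)
    also have "\<dots> \<le> (1 - t) * m" using t1 m0 by (intro mult_right_mono) auto
    finally have close: "dist v z + t * dist p z \<le> (1 - t) * m" by (simp add: s_def dist_commute)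
    obtain z' where z': "z' \<in> closed_segment a b" "v = (1 - t) *\<^sub>R z' + t *\<^sub>R p"
      using segment_triangle_nbhd[OF ne z zm h1(2) t_def _ t0 close] t1 by auto
    have "z' \<in> closure G" using z'(1) side_frontier[OF G(2)] by (auto simp: frontier_def)
    then show ?thesis
      unfolding z'(2) using convexD[OF convex_closure[OF face_convex[OF G(1)]] _ pc] t0 t1 by auto
  qed
  obtain F F' where F: "F \<in> faces E" "F' \<in> faces E" "side F a b" "side F' a b"
    "\<And>y. y \<in> F \<Longrightarrow> crs (b - a) (y - a) > 0" "\<And>y. y \<in> F' \<Longrightarrow> crs (b - a) (y - a) < 0"
    using edge_two_faces[OF ab] by blast
  have "\<exists>G\<in>faces E. side G a b \<and> v \<in> closure G"
  proof (cases "crs (b - a) (v - a) \<ge> 0")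
    case True
    then show ?thesis using key[OF F(1,3), of 1] F by auto
  next
    case False
    then show ?thesis using key[OF F(2,4), of "- 1"] F by auto
  qed
  then obtain G where G: "G \<in> faces E" "side G a b" "v \<in> closure G" by blast
  have "dist a b \<le> M * (D / \<delta>) * rad v"
    using face_diam_rad[OF G(1) vertex_in_closure[OF G(1) v(1) G(3)]] side_ends_closure[OF G(2)] by blast
  then show False using neg by simp
qed

definition K8 :: real where "K8 = (M + 1) * (1 / c1 + M * (D / \<delta>))"

text \<open>If \<open>v\<close> is not on the face, the segment from \<open>v\<close> to
  \<open>z\<close> meets a side of the face within distance \<open>s\<close> of \<open>v\<close>,
  and a side that passes so close to a vertex cannot be long.\<close>

lemma face_diam_le_dist:
  assumes F: "F \<in> faces E" and v: "v \<in> V" "rad v \<le> s" and z: "z \<in> closure F" "dist z v \<le> s"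
    and xy: "x \<in> closure F" "y \<in> closure F"
  shows "dist x y \<le> K8 * s"
proof -
  have s: "s \<ge> 0" using z(2) zero_le_dist[of z v] by linarith
  let ?q = "M * (D / \<delta>)"
  have q: "?q \<ge> 0" using M_nonneg D delta by simp
  show ?thesis
  proof (cases "v \<in> closure F")
    case True
    have "dist x y \<le> ?q * rad v"
      using face_diam_rad[OF F vertex_in_closure[OF F v(1) True] xy] .
    also have "\<dots> \<le> ?q * s" using v(2) q by (intro mult_left_mono)
    also have "\<dots> \<le> K8 * s"
    proof (rule mult_right_mono[OF _ s])
      have "?q \<le> 1 * (1 / c1 + ?q)" using c1(1) by simp
      also have "\<dots> \<le> K8" unfolding K8_def using c1(1) q M_nonneg by (intro mult_right_mono) auto
      finally show "?q \<le> K8" .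
    qed
    finally show ?thesis .
  next
    case False
    have "closed_segment v z \<inter> frontier (closure F) \<noteq> {}"
      using False z(1) by (intro connected_Int_frontier) auto
    then obtain z' where z': "z' \<in> closed_segment v z" "z' \<in> frontier (closure F)" by blast
    have "F \<subseteq> interior (closure F)" by (simp add: closure_subset face_open[OF F] interior_maximal)
    then have "z' \<in> frontier F" using z'(2) frontier_face[OF F] by (auto simp: frontier_def)
    then obtain a b where ab: "side F a b" "z' \<in> closed_segment a b"
      using frontier_eq_sides[OF F] by (auto simp: sides_def)
    have "dist z' v \<le> dist z v" using dist_in_closed_segment[OF z'(1)] by (simp add: dist_commute)
    then have zs: "dist z' v \<le> s" using z(2) by simp
    have "v \<noteq> a" "v \<noteq> b" using False side_ends_closure[OF ab(1)] by auto
    then have "dist a b \<le> dist z' v / c1 \<or> dist a b \<le> ?q * rad v"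
      using edge_le_dist_to_vertex[OF side_edge[OF ab(1)] v(1) _ _ ab(2)] by blast
    moreover have "dist z' v / c1 \<le> s / c1" using zs c1(1) by (intro divide_right_mono) auto
    moreover have "?q * rad v \<le> ?q * s" using v(2) q by (intro mult_left_mono)
    moreover have "0 \<le> s / c1" using s c1(1) by simp
    moreover have "0 \<le> ?q * s" using mult_nonneg_nonneg[OF q s] .
    ultimately have "dist a b \<le> s / c1 + ?q * s" by linarith
    then have "M * dist a b \<le> M * (s / c1 + ?q * s)" using M_nonneg by (intro mult_left_mono)
    also have "\<dots> \<le> (M + 1) * (s / c1 + ?q * s)"
      using \<open>0 \<le> s / c1\<close> \<open>0 \<le> ?q * s\<close> by (intro mult_right_mono) auto
    also have "\<dots> = K8 * s" by (simp add: K8_def algebra_simps)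
    finally show ?thesis using face_diam[OF F ab(1) xy] by linarith
  qed
qed

text \<open>Faces may accumulate in the plane, but each point of the carrier has a neighbourhood
  that meets only one face, the two faces along an edge, or the faces at a vertex.\<close>

lemma faces_locally_finite:
  assumes "x \<in> carr E"
  obtains \<rho> where "\<rho> > 0" "finite {F \<in> faces E. closure F \<inter> ball x \<rho> \<noteq> {}}"
proof -
  obtain F where F: "F \<in> faces E" "x \<in> closure F" using assms by (auto simp: carr_def)
  have meet: "\<exists>y. y \<in> G \<and> y \<in> ball x \<rho>" if "closure G \<inter> ball x \<rho> \<noteq> {}" for G \<rho>
    using that open_Int_closure_eq_empty[OF open_ball, of x \<rho> G] by blast
  show ?thesis
  proof (cases "x \<in> F")
    case True
    then obtain \<rho> where r: "\<rho> > 0" "ball x \<rho> \<subseteq> F" using face_open[OF F(1)] open_contains_ball by blast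
    have "{G \<in> faces E. closure G \<inter> ball x \<rho> \<noteq> {}} \<subseteq> {F}"
      using meet r faces_disjoint[OF F(1)] by blast
    then show ?thesis using that r finite_subset by blast
  next
    case False
    then have fr: "x \<in> frontier F" using F frontier_face by blast
    show ?thesis
    proof (cases rule: frontier_face_cases[OF F(1) fr])
      case 1
      then have x: "x \<in> V" by (simp add: verts_def)
      obtain a0 where a0: "{x, a0} \<in> E" using has_edge[OF x] .
      define R where "R = \<delta> * dist x a0 / D"
      have R: "R > 0" using delta D edge_ends(3)[OF a0] by (simp add: R_def)
      have "G \<in> faces_at x" if G: "G \<in> faces E" "closure G \<inter> ball x R \<noteq> {}" for G
      proof -
        obtain y where y: "y \<in> G" "y \<in> ball x R" using meet G by blast
        then obtain H where "H \<in> faces_at x" "y \<in> closure H"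
          using vertex_star[OF a0, of y] by (auto simp: R_def dist_commute)
        then show ?thesis using faces_eqI[OF G(1) _ y(1)] by (auto simp: faces_at_def)
      qed
      then have "{G \<in> faces E. closure G \<inter> ball x R \<noteq> {}} \<subseteq> faces_at x" by blast
      then show ?thesis using that R faces_at_bound(1)[OF x] finite_subset by blast
    next
      case (2 a b)
      obtain \<rho> G G' where G: "\<rho> > 0" "G \<in> faces_at a" "G' \<in> faces_at a" "side G a b" "side G' a b"
        "ball x \<rho> \<subseteq> G \<union> G' \<union> open_segment a b"
        by (rule edge_nbhd_faces_at[OF side_edge[OF 2(1)] 2(2)])
      have "H = G \<or> H = G'" if H: "H \<in> faces E" "closure H \<inter> ball x \<rho> \<noteq> {}" for H
      proof -
        obtain y where y: "y \<in> H" "y \<in> ball x \<rho>" using meet H by blast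
        then have "y \<notin> open_segment a b"
          using edge_in_skeleton[OF side_edge[OF 2(1)]] face_disjoint_skeleton[OF H(1)]
          by (auto simp: open_segment_def)
        then have "y \<in> G \<or> y \<in> G'" using G(6) y(2) by blast
        moreover have "G \<in> faces E" "G' \<in> faces E" using G(2,3) by (auto simp: faces_at_def)
        ultimately show ?thesis using y(1) faces_disjoint[OF H(1)] by blast
      qed
      then have "{H \<in> faces E. closure H \<inter> ball x \<rho> \<noteq> {}} \<subseteq> {G, G'}" by blast
      then show ?thesis using that[OF G(1)] finite_subset by blast
    qed
  qed
qed

lemma finite_faces_meeting_compact:
  assumes C: "compact C" "C \<subseteq> carr E"
  shows "finite {F \<in> faces E. closure F \<inter> C \<noteq> {}}"
proof -
  have "\<forall>x\<in>C. \<exists>\<rho>. \<rho> > 0 \<and> finite {F \<in> faces E. closure F \<inter> ball x \<rho> \<noteq> {}}"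
  proof
    fix x assume "x \<in> C"
    then obtain \<rho> where "\<rho> > 0" "finite {F \<in> faces E. closure F \<inter> ball x \<rho> \<noteq> {}}"
      using faces_locally_finite[of x] C(2) by blast
    then show "\<exists>\<rho>. \<rho> > 0 \<and> finite {F \<in> faces E. closure F \<inter> ball x \<rho> \<noteq> {}}" by blast
  qed
  from bchoice[OF this] obtain \<rho> where r: "\<And>x. x \<in> C \<Longrightarrow> \<rho> x > 0"
    "\<And>x. x \<in> C \<Longrightarrow> finite {F \<in> faces E. closure F \<inter> ball x (\<rho> x) \<noteq> {}}" by blast
  have "C \<subseteq> (\<Union>x\<in>C. ball x (\<rho> x))" using r(1) by force
  then obtain C' where C': "C' \<subseteq> C" "finite C'" "C \<subseteq> (\<Union>x\<in>C'. ball x (\<rho> x))"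
    using compactE_image[OF C(1), of C "\<lambda>x. ball x (\<rho> x)"] by auto
  have "{F \<in> faces E. closure F \<inter> C \<noteq> {}} \<subseteq> (\<Union>x\<in>C'. {F \<in> faces E. closure F \<inter> ball x (\<rho> x) \<noteq> {}})"
    using C'(3) by blast
  moreover have "finite (\<Union>x\<in>C'. {F \<in> faces E. closure F \<inter> ball x (\<rho> x) \<noteq> {}})"
    using C' r(2) by blast
  ultimately show ?thesis using finite_subset by blast
qed

text \<open>If the common point is inside an edge, both faces have the whole edge as a side. This
  links consecutive faces when a function on the vertices is followed along a curve.\<close>

lemma common_vertex:
  assumes F: "F \<in> faces E" "G \<in> faces E" and x: "x \<in> closure F" "x \<in> closure G"
  shows "verts F \<inter> verts G \<noteq> {}"
proof (cases "F = G")
  case True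
  then show ?thesis using verts_nonempty[OF F(1)] by simp
next
  case False
  then have fr: "x \<in> frontier F" using faces_eqI[OF F _ x(2)] x(1) frontier_face[OF F(1)] by blast
  show ?thesis
  proof (cases rule: frontier_face_cases[OF F(1) fr])
    case 1
    then have "x \<in> V" by (simp add: verts_def)
    then show ?thesis using 1 vertex_in_closure[OF F(2) _ x(2)] by blast
  next
    case (2 a b)
    then have "side G a b" using side_of_closure[OF side_edge _ F(2) x(2)] by blast
    then show ?thesis using side_verts[OF F(1) 2(1)] side_verts[OF F(2)] by blast
  qed
qed

lemma neighbours_bound:
  assumes v: "v \<in> V"
  shows "finite (neighbours E v)" "card (neighbours E v) \<le> 2 * card (faces_at v)"
proof -
  have sub: "neighbours E v \<subseteq> (\<Union>F\<in>faces_at v. {a. side F v a})"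
  proof
    fix a assume "a \<in> neighbours E v"
    then have "{v, a} \<in> E" by (simp add: neighbours_def)
    then obtain F where "F \<in> faces E" "side F v a" using edge_two_faces by metis
    then show "a \<in> (\<Union>F\<in>faces_at v. {a. side F v a})"
      using side_ends_closure(1) by (auto simp: faces_at_def)
  qed
  have two: "finite {a. side F v a} \<and> card {a. side F v a} \<le> 2" if "F \<in> faces_at v" for F
  proof -
    have F: "F \<in> faces E" "v \<in> verts F" using that vertex_in_closure v by (auto simp: faces_at_def)
    obtain p q where "corner F v p q" using vert_corner[OF F] .
    then have "{a. side F v a} \<subseteq> {p, q}" using corner_sides[OF F(1)] by blast
    then have "finite {a. side F v a}" "card {a. side F v a} \<le> card {p, q}"
      using finite_subset[of _ "{p, q}"] card_mono[of "{p, q}"] by auto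
    moreover have "card {p, q} \<le> 2" by (simp add: card_insert_if)
    ultimately show ?thesis by linarith
  qed
  have fin: "finite (\<Union>F\<in>faces_at v. {a. side F v a})" using faces_at_bound(1)[OF v] two by blast
  show "finite (neighbours E v)" using sub fin finite_subset by blast
  have "card (neighbours E v) \<le> card (\<Union>F\<in>faces_at v. {a. side F v a})"
    using card_mono[OF fin sub] .
  also have "\<dots> \<le> (\<Sum>F\<in>faces_at v. card {a. side F v a})"
    using faces_at_bound(1)[OF v] by (rule card_UN_le)
  also have "\<dots> \<le> (\<Sum>F\<in>faces_at v. 2)" using two by (intro sum_mono) auto
  finally show "card (neighbours E v) \<le> 2 * card (faces_at v)" by simp
qed

end

section \<open>Dirichlet problems on finite sets of vertices\<close>

context good_graph
begin

text \<open>A single constant that absorbs all the geometric constants, and the bounds on the weights.\<close>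

definition K :: real where
  "K = 1 + D + D / \<delta> + M * (D / \<delta>) + 2 * (4 / \<sigma> + 1)\<^sup>2 + real (nn * nn) + K8"

lemma K_bounds:
  "K \<ge> 1" "D \<le> K" "D / \<delta> \<le> K" "M * (D / \<delta>) \<le> K" "2 * (4 / \<sigma> + 1)\<^sup>2 \<le> K" "(4 / \<sigma> + 1)\<^sup>2 \<le> K"
  "real (nn * nn) \<le> K" "K8 \<le> K"
proof -
  have "0 \<le> D / \<delta>" "0 \<le> M * (D / \<delta>)" "0 \<le> (4 / \<sigma> + 1)\<^sup>2" "0 \<le> real (nn * nn)" "0 \<le> K8"
    using D delta M_nonneg c1(1) by (auto simp: K8_def)
  then show "K \<ge> 1" "D \<le> K" "D / \<delta> \<le> K" "M * (D / \<delta>) \<le> K" "2 * (4 / \<sigma> + 1)\<^sup>2 \<le> K"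
    "(4 / \<sigma> + 1)\<^sup>2 \<le> K" "real (nn * nn) \<le> K" "K8 \<le> K"
    using D unfolding K_def by linarith+
qed

lemma face_diam_rad_K:
  assumes "F \<in> faces E" "v \<in> verts F" "x \<in> closure F" "y \<in> closure F"
  shows "dist x y \<le> K * rad v"
proof -
  have "v \<in> V" using assms(2) by (simp add: verts_def)
  then have "M * (D / \<delta>) * rad v \<le> K * rad v"
    using K_bounds(4) rad_pos by (intro mult_right_mono) (auto simp: less_imp_le)
  then show ?thesis using face_diam_rad[OF assms] by linarith
qed

lemma face_diam_le_dist_K:
  assumes "F \<in> faces E" "v \<in> V" "rad v \<le> s" "z \<in> closure F" "dist z v \<le> s" "x \<in> closure F" "y \<in> closure F"
  shows "dist x y \<le> K * s"
proof -
  have "s \<ge> 0" using assms(5) zero_le_dist[of z v] by linarith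
  then have "K8 * s \<le> K * s" using K_bounds(8) by (intro mult_right_mono)
  then show ?thesis using face_diam_le_dist[OF assms] by linarith
qed

lemma card_faces_at_K: "v \<in> V \<Longrightarrow> real (card (faces_at v)) \<le> K"
  using faces_at_bound(2)[of v] K_bounds(6) by linarith

lemma degree_K: "v \<in> V \<Longrightarrow> real (card (neighbours E v)) \<le> K"
  using faces_at_bound(2)[of v] neighbours_bound(2)[of v] K_bounds(5) by linarith

lemma card_sides_K: "F \<in> faces E \<Longrightarrow> real (card (sides F)) \<le> K"
  using card_sides[of F] K_bounds(7) by (smt (verit) of_nat_le_iff)

lemma edge_le_rad_K:
  assumes "{v, a} \<in> E"
  shows "dist v a \<le> K * rad v"
proof -
  have "D / \<delta> * rad v \<le> K * rad v"
    using K_bounds(3) rad_pos edge_ends(1)[OF assms] by (intro mult_right_mono) (auto simp: less_imp_le)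
  then show ?thesis using edge_le_rad[OF assms] by linarith
qed

lemma vertex_star_K:
  assumes v: "v \<in> V" and x: "dist x v < rad v / K"
  obtains F where "F \<in> faces_at v" "x \<in> closure F"
proof -
  obtain a where a: "{v, a} \<in> E" using has_edge[OF v] .
  have "rad v / K \<le> rad v / (D / \<delta>)"
    using K_bounds(1,3) D delta rad_pos[OF v] by (intro divide_left_mono) auto
  also have "\<dots> = \<delta> * rad v / D" by simp
  also have "\<dots> \<le> \<delta> * dist v a / D"
    using rad_le_edge[OF a] delta D by (intro divide_right_mono mult_left_mono) auto
  finally show ?thesis using vertex_star[OF a] x that by (metis less_le_trans)
qed

lemma rad_ball_disjoint:
  assumes "v \<in> V" "w \<in> V" "v \<noteq> w" "t \<le> 1 / 2"
  shows "ball v (t * rad v) \<inter> ball w (t * rad w) = {}"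
proof (rule disjoint_ballI)
  have "rad v \<le> dist v w" "rad w \<le> dist v w"
    using rad_le[of w v] rad_le[of v w] assms by (auto simp: dist_commute)
  moreover have "t * rad v \<le> 1 / 2 * rad v" "t * rad w \<le> 1 / 2 * rad w"
    using assms rad_pos by (auto intro!: mult_right_mono simp: less_imp_le)
  ultimately show "t * rad v + t * rad w \<le> dist v w" by linarith
qed

abbreviation m :: "complex \<Rightarrow> real" where "m v \<equiv> (rad v)\<^sup>2"

lemma rad_le_radius:
  assumes u: "u \<in> V" "rad u \<le> r" and v: "v \<in> V_euc V u r"
  shows "rad v \<le> r"
  using rad_le[of u v] u v by (cases "v = u") (auto simp: V_euc_def dist_commute)

text \<open>The discs of half the isolation radius are disjoint and lie in the disc of radius
  \<open>2 * r\<close>; the factor 16 is the square of 2 divided by 1/2.\<close>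

lemma sum_m_V_euc:
  assumes u: "u \<in> V" "rad u \<le> r" and fin: "finite S" "S \<subseteq> V_euc V u r"
  shows "(\<Sum>v\<in>S. m v) \<le> 16 * r\<^sup>2"
proof -
  have r: "r > 0" using u rad_pos[OF u(1)] by linarith
  have "(\<Sum>v\<in>S. (1 / 2 * rad v)\<^sup>2) \<le> (2 * r)\<^sup>2"
  proof (rule sum_sq_radii_disjoint_balls[where c = "\<lambda>v. v" and p = u])
    show "disjoint_family_on (\<lambda>v. ball v (1 / 2 * rad v)) S"
      unfolding disjoint_family_on_def
    proof (intro ballI impI)
      fix v w assume "v \<in> S" "w \<in> S" "v \<noteq> w"
      then show "ball v (1 / 2 * rad v) \<inter> ball w (1 / 2 * rad w) = {}"
        using fin by (intro rad_ball_disjoint) (auto simp: V_euc_def)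
    qed
    fix v assume v: "v \<in> S"
    then have "v \<in> V_euc V u r" "v \<in> V" using fin by (auto simp: V_euc_def)
    then show "0 \<le> 1 / 2 * rad v" using rad_pos by (simp add: less_imp_le)
    have "rad v \<le> r" "dist u v \<le> r"
      using rad_le_radius[OF u] \<open>v \<in> V_euc V u r\<close> by (auto simp: V_euc_def)
    then have "dist u x < 2 * r" if "dist v x < 1 / 2 * rad v" for x
      using dist_triangle[of u x v] that r by linarith
    then show "ball v (1 / 2 * rad v) \<subseteq> ball u (2 * r)" by auto
  qed (use fin r in auto)
  then show ?thesis by (simp add: power_mult_distrib power_divide sum_divide_distrib[symmetric])
qed

lemma finite_V_euc:
  assumes "cball u r \<subseteq> carr E"
  shows "finite (V_euc V u r)"
proof -
  let ?\<F> = "{F \<in> faces E. closure F \<inter> cball u r \<noteq> {}}"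
  have fin: "finite ?\<F>" using finite_faces_meeting_compact[OF _ assms] by simp
  have "V_euc V u r \<subseteq> (\<Union>F\<in>?\<F>. verts F)"
  proof
    fix v assume v: "v \<in> V_euc V u r"
    then obtain F where F: "F \<in> faces E" "v \<in> closure F"
      using assms by (auto simp: V_euc_def carr_def)
    then have "F \<in> ?\<F>" "v \<in> verts F"
      using vertex_in_closure[OF F(1) _ F(2)] v by (auto simp: V_euc_def)
    then show "v \<in> (\<Union>F\<in>?\<F>. verts F)" by blast
  qed
  then show ?thesis using fin card_verts(1) finite_subset by (metis (no_types, lifting) finite_UN_I mem_Collect_eq)
qed

lemma boundary_edge:
  assumes A: "finite A" "A \<subseteq> V" "A \<noteq> {}"
  obtains x y where "x \<in> A" "y \<in> V - A" "{x, y} \<in> E"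
proof -
  obtain a where a: "a \<in> A" using A(3) by blast
  obtain b where b: "b \<in> V" "b \<notin> A" using infinite_V A(1) by (meson finite_subset subsetI)
  have "(\<lambda>x y. {x, y} \<in> E)\<^sup>*\<^sup>* a b"
    using connected a b A unfolding connected_graph_def by blast
  then have "b \<notin> A \<longrightarrow> (\<exists>x y. x \<in> A \<and> y \<in> V - A \<and> {x, y} \<in> E)"
  proof (induction rule: rtranclp_induct)
    case base
    then show ?case using a by blast
  next
    case (step y z)
    then show ?case using edge_ends(2)[OF step(2)] by (cases "y \<in> A") auto
  qed
  then show ?thesis using that b by blast
qed

end

section \<open>Laplacian and Dirichlet energy\<close>

locale weighted_graph = good_graph +
  fixes wt :: "complex set \<Rightarrow> real"
  assumes wt: "\<And>e. e \<in> E \<Longrightarrow> wt e \<in> {1 / D .. D}"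
begin

abbreviation nb :: "complex \<Rightarrow> complex set" where "nb \<equiv> neighbours E"

definition c :: "complex \<Rightarrow> complex \<Rightarrow> real" where
  "c x y = (if {x, y} \<in> E then wt {x, y} else 0)"

lemma c_sym: "c x y = c y x"
  by (simp add: c_def insert_commute)

lemma c_nonneg: "c x y \<ge> 0"
  using wt[of "{x, y}"] D by (auto simp: c_def intro: order_trans[of 0 "1 / D"])

lemma c_bounds: "{x, y} \<in> E \<Longrightarrow> 1 / K \<le> c x y" "c x y \<le> K"
proof -
  show "c x y \<le> K" using wt[of "{x, y}"] K_bounds(1,2) by (auto simp: c_def)
  assume e: "{x, y} \<in> E"
  have "1 / K \<le> 1 / D" using K_bounds(2) D by (intro divide_left_mono) auto
  then show "1 / K \<le> c x y" using wt[OF e] e by (auto simp: c_def)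
qed

lemma nb_iff: "y \<in> nb x \<longleftrightarrow> {x, y} \<in> E"
  by (simp add: neighbours_def)

lemma nb_V: "nb x \<subseteq> V"
  using edge_ends by (auto simp: nb_iff)

lemma finite_nb: "x \<in> V \<Longrightarrow> finite (nb x)"
  by (rule neighbours_bound(1))

lemma nb_nonempty: "x \<in> V \<Longrightarrow> nb x \<noteq> {}"
  using has_edge[of x] nb_iff by blast

definition deg :: "complex \<Rightarrow> real" where "deg x = (\<Sum>y\<in>nb x. c x y)"

lemma deg_bounds:
  assumes "x \<in> V"
  shows "1 / K \<le> deg x" "deg x \<le> K\<^sup>2" "0 < deg x"
proof -
  obtain y where y: "y \<in> nb x" using nb_nonempty[OF assms] by blast
  then have "1 / K \<le> c x y" using c_bounds(1) nb_iff by blast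
  also have "\<dots> \<le> deg x"
    unfolding deg_def using y finite_nb[OF assms] c_nonneg by (intro member_le_sum) auto
  finally show *: "1 / K \<le> deg x" .
  show "0 < deg x" using * K_bounds(1) by (smt (verit) divide_pos_pos)
  have "deg x \<le> (\<Sum>y\<in>nb x. K)" unfolding deg_def using c_bounds(2) by (intro sum_mono)
  also have "\<dots> \<le> K * K" using degree_K[OF assms] K_bounds(1) by (simp add: mult_right_mono)
  finally show "deg x \<le> K\<^sup>2" by (simp add: power2_eq_square)
qed

text \<open>The sign is that of the nonnegative operator: \<open>Lap f \<ge> 0\<close> means that
  \<open>f\<close> is superharmonic.\<close>

definition Lap :: "(complex \<Rightarrow> real) \<Rightarrow> complex \<Rightarrow> real" where
  "Lap f x = (\<Sum>y\<in>nb x. c x y * (f x - f y))"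

lemma Lap_eq: "Lap f x = deg x * f x - (\<Sum>y\<in>nb x. c x y * f y)"
  by (simp add: Lap_def deg_def sum_distrib_right right_diff_distrib sum_subtractf)

end

locale dirichlet_problem = weighted_graph +
  fixes B :: "complex set"
  assumes B: "B \<subseteq> V" "finite B"
begin

text \<open>Contains both ends of every edge that meets \<open>B\<close>, so the finite double sum
  in \<open>En\<close> sees all the edges on which a function supported in \<open>B\<close> can
  vary.\<close>

definition N :: "complex set" where "N = B \<union> (\<Union>x\<in>B. nb x)"

lemma N: "finite N" "N \<subseteq> V" "B \<subseteq> N" "x \<in> B \<Longrightarrow> nb x \<subseteq> N"
  using B finite_nb nb_V by (auto simp: N_def)

definition En :: "(complex \<Rightarrow> real) \<Rightarrow> (complex \<Rightarrow> real) \<Rightarrow> real" where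
  "En f g = (\<Sum>x\<in>N. \<Sum>y\<in>N. c x y * ((f x - f y) * (g x - g y))) / 2"

lemma En_sym: "En f g = En g f"
  by (simp add: En_def mult.commute)

text \<open>Green's formula; there are no boundary terms because \<open>\<phi>\<close> vanishes
  outside of \<open>B\<close>.\<close>

lemma En_eq:
  assumes supp: "\<And>x. x \<notin> B \<Longrightarrow> \<phi> x = 0"
  shows "En f \<phi> = (\<Sum>x\<in>B. \<phi> x * Lap f x)"
proof -
  let ?S = "\<Sum>x\<in>N. \<Sum>y\<in>N. c x y * (f x - f y) * \<phi> x"
  have "c x y * ((f x - f y) * (\<phi> x - \<phi> y)) = c x y * (f x - f y) * \<phi> x - c x y * (f x - f y) * \<phi> y" for x y
    by (simp add: algebra_simps)
  then have En: "En f \<phi> = (?S - (\<Sum>x\<in>N. \<Sum>y\<in>N. c x y * (f x - f y) * \<phi> y)) / 2"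
    by (simp only: En_def sum_subtractf)
  have "(\<Sum>x\<in>N. \<Sum>y\<in>N. c x y * (f x - f y) * \<phi> y) = (\<Sum>y\<in>N. \<Sum>x\<in>N. c x y * (f x - f y) * \<phi> y)"
    by (rule sum.swap)
  also have "\<dots> = - ?S"
    unfolding sum_negf[symmetric] by (intro sum.cong refl) (simp add: c_sym algebra_simps)
  finally have "En f \<phi> = ?S" using En by simp
  also have "?S = (\<Sum>x\<in>N. \<phi> x * (\<Sum>y\<in>N. c x y * (f x - f y)))"
    by (simp add: sum_distrib_left mult_ac)
  also have "\<dots> = (\<Sum>x\<in>B. \<phi> x * (\<Sum>y\<in>N. c x y * (f x - f y)))"
    using N supp by (intro sum.mono_neutral_right) auto
  also have "\<dots> = (\<Sum>x\<in>B. \<phi> x * Lap f x)"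
  proof (intro sum.cong refl)
    fix x assume "x \<in> B"
    then have "(\<Sum>y\<in>N. c x y * (f x - f y)) = (\<Sum>y\<in>nb x. c x y * (f x - f y))"
      using N by (intro sum.mono_neutral_right) (auto simp: c_def nb_iff)
    then show "\<phi> x * (\<Sum>y\<in>N. c x y * (f x - f y)) = \<phi> x * Lap f x" by (simp add: Lap_def)
  qed
  finally show ?thesis .
qed

lemma En_mono:
  assumes "\<And>x y. {x, y} \<in> E \<Longrightarrow> (f x - f y) * (g x - g y) \<le> (f' x - f' y) * (g' x - g' y)"
  shows "En f g \<le> En f' g'"
  unfolding En_def
proof (intro divide_right_mono sum_mono)
  fix x y
  show "c x y * ((f x - f y) * (g x - g y)) \<le> c x y * ((f' x - f' y) * (g' x - g' y))"
    using assms[of x y] c_nonneg[of x y] by (cases "{x, y} \<in> E") (auto simp: c_def intro: mult_left_mono)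
qed simp

lemma En_nonneg: "En f f \<ge> 0"
  unfolding En_def using c_nonneg by (intro divide_nonneg_pos sum_nonneg) auto

lemma En_Cauchy_Schwarz: "(En f g)\<^sup>2 \<le> En f f * En g g"
proof -
  let ?f = "\<lambda>p. sqrt (c (fst p) (snd p)) * (f (fst p) - f (snd p))"
  let ?g = "\<lambda>p. sqrt (c (fst p) (snd p)) * (g (fst p) - g (snd p))"
  have eq: "En h k = (\<Sum>p\<in>N \<times> N. (sqrt (c (fst p) (snd p)) * (h (fst p) - h (snd p))) *
      (sqrt (c (fst p) (snd p)) * (k (fst p) - k (snd p)))) / 2" for h k
  proof -
    have *: "(sqrt (c x y) * s) * (sqrt (c x y) * t) = c x y * (s * t)" for x y s t
    proof -
      have "(sqrt (c x y) * s) * (sqrt (c x y) * t) = (sqrt (c x y) * sqrt (c x y)) * (s * t)"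
        by (simp only: mult_ac)
      then show ?thesis using c_nonneg[of x y] by simp
    qed
    show ?thesis unfolding * En_def by (simp add: sum.cartesian_product case_prod_beta)
  qed
  have "(\<Sum>p\<in>N \<times> N. ?f p * ?g p)\<^sup>2 \<le> (\<Sum>p\<in>N \<times> N. (?f p)\<^sup>2) * (\<Sum>p\<in>N \<times> N. (?g p)\<^sup>2)"
    by (rule Cauchy_Schwarz_ineq_sum)
  then show ?thesis unfolding eq by (simp add: power_divide power2_eq_square)
qed

text \<open>Fixed-point iteration for \<open>Lap h = s\<close> with zero boundary values. For
  \<open>s x = deg x * f x\<close> the recursion is a step of the walk killed outside of
  \<open>B\<close>, which makes the iterates expected sums of \<open>f\<close> over the first
  \<open>n\<close> times.\<close>

primrec pot :: "(complex \<Rightarrow> real) \<Rightarrow> nat \<Rightarrow> complex \<Rightarrow> real" where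
  "pot s 0 = (\<lambda>_. 0)"
| "pot s (Suc n) = (\<lambda>x. if x \<in> B then (s x + (\<Sum>y\<in>nb x. c x y * pot s n y)) / deg x else 0)"

lemma pot_outside: "x \<notin> B \<Longrightarrow> pot s n x = 0"
  by (cases n) auto

context
  fixes s :: "complex \<Rightarrow> real"
  assumes s: "\<And>x. s x \<ge> 0"
begin

lemma pot_nonneg: "pot s n x \<ge> 0"
proof (induction n arbitrary: x)
  case (Suc n)
  then show ?case using s c_nonneg deg_bounds(3)[of x] B
    by (auto intro!: divide_nonneg_pos add_nonneg_nonneg sum_nonneg mult_nonneg_nonneg)
qed simp

lemma pot_mono: "pot s n x \<le> pot s (Suc n) x"
proof (induction n arbitrary: x)
  case 0
  then show ?case using pot_nonneg[of "Suc 0" x] by simp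
next
  case (Suc n)
  have "(\<Sum>y\<in>nb x. c x y * pot s n y) \<le> (\<Sum>y\<in>nb x. c x y * pot s (Suc n) y)"
    using Suc c_nonneg by (intro sum_mono mult_left_mono) auto
  then show ?case using deg_bounds(3)[of x] B
    by (auto simp del: pot.simps(2) simp: pot.simps(2)[of s n] pot.simps(2)[of s "Suc n"] intro!: divide_right_mono)
qed

text \<open>The iterates are subsolutions. That is enough for the truncation argument, which can
  thus bound them before a limit is known to exist.\<close>

lemma Lap_pot_le:
  assumes x: "x \<in> B"
  shows "Lap (pot s n) x \<le> s x"
proof -
  have d: "deg x > 0" using deg_bounds(3) x B by blast
  have "deg x * pot s n x \<le> deg x * pot s (Suc n) x" using pot_mono d by (intro mult_left_mono) auto
  also have "\<dots> = s x + (\<Sum>y\<in>nb x. c x y * pot s n y)" using d x by simp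
  finally show ?thesis by (simp add: Lap_eq)
qed

text \<open>
  Stampacchia's truncation argument: testing with \<open>(h - k)\<^sup>+\<close> and using the Faber-Krahn inequality,
  the mass of \<open>{h > k}\<close> is halved each time that \<open>k\<close> grows by a multiple of this mass.
\<close>

lemma pot_bounded:
  assumes Q: "Q > 0" and b: "b > 0" "\<And>x. x \<in> B \<Longrightarrow> s x \<le> b * m x"
    and FK: "\<And>f. (\<And>x. f x \<ge> 0) \<Longrightarrow> (\<And>x. x \<notin> B \<Longrightarrow> f x = 0) \<Longrightarrow>
      (\<Sum>x\<in>B. m x * (f x)\<^sup>2) \<le> Q * (\<Sum>x | x \<in> B \<and> f x > 0. m x) * En f f"
  shows "pot s n x \<le> 4 * b * Q * (\<Sum>x\<in>B. m x)"
proof (cases "x \<in> B")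
  case False
  then show ?thesis using pot_outside Q b by (simp add: sum_nonneg)
next
  case True
  define h where "h = pot s n"
  define A where "A = (\<lambda>k. \<Sum>x | x \<in> B \<and> h x > k. m x)"
  define mB where "mB = (\<Sum>x\<in>B. m x)"
  have mx: "m x > 0" if "x \<in> B" for x using rad_pos[of x] that B by auto
  have "m x \<le> mB" unfolding mB_def using True B by (intro member_le_sum) auto
  then have mB: "mB > 0" using mx[OF True] by linarith
  have A_nonneg: "A k \<ge> 0" for k unfolding A_def by (intro sum_nonneg) auto
  have h0: "h x \<ge> 0" "x \<notin> B \<Longrightarrow> h x = 0" for x using pot_nonneg pot_outside by (auto simp: h_def)
  have step: "(l - k) * A l \<le> Q * b * (A k)\<^sup>2" if "0 \<le> k" "k < l" for k l
  proof -
    define \<phi> where "\<phi> = (\<lambda>x. max 0 (h x - k))"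
    have phi: "\<phi> x \<ge> 0" "x \<notin> B \<Longrightarrow> \<phi> x = 0" for x using h0[of x] that by (auto simp: \<phi>_def)
    define Y where "Y = (\<Sum>x\<in>B. m x * \<phi> x)"
    have Y0: "Y \<ge> 0" unfolding Y_def using phi by (intro sum_nonneg) auto
    have pos_set: "{x. x \<in> B \<and> \<phi> x > 0} = {x. x \<in> B \<and> h x > k}" by (auto simp: \<phi>_def)
    \<comment> \<open>Truncation shrinks each increment of \<open>h\<close> and does not reverse its
      sign.\<close>
    have "En \<phi> \<phi> \<le> En h \<phi>"
    proof (rule En_mono)
      fix x y
      show "(\<phi> x - \<phi> y) * (\<phi> x - \<phi> y) \<le> (h x - h y) * (\<phi> x - \<phi> y)"
      proof -
        consider "h x \<ge> k" "h y \<ge> k" | "h x \<ge> k" "h y < k" | "h x < k" "h y \<ge> k" | "h x < k" "h y < k"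
          by linarith
        then show ?thesis
        proof cases
          case 2
          then show ?thesis by (intro mult_right_mono) (auto simp: \<phi>_def)
        next
          case 3
          then show ?thesis by (intro mult_right_mono_neg) (auto simp: \<phi>_def)
        qed (auto simp: \<phi>_def)
      qed
    qed
    also have "\<dots> = (\<Sum>x\<in>B. \<phi> x * Lap h x)" using phi by (intro En_eq) auto
    also have "\<dots> \<le> (\<Sum>x\<in>B. \<phi> x * (b * m x))"
      using phi Lap_pot_le b(2) unfolding h_def by (intro sum_mono mult_left_mono) (meson order_trans)+
    also have "\<dots> = b * Y" by (simp add: Y_def sum_distrib_left mult_ac)
    finally have E: "En \<phi> \<phi> \<le> b * Y" .
    have "Y = (\<Sum>x | x \<in> B \<and> h x > k. rad x * (rad x * \<phi> x))"
      unfolding Y_def using B by (intro sum.mono_neutral_cong_right) (auto simp: \<phi>_def power2_eq_square)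
    then have "Y\<^sup>2 \<le> (\<Sum>x | x \<in> B \<and> h x > k. m x) * (\<Sum>x | x \<in> B \<and> h x > k. (rad x * \<phi> x)\<^sup>2)"
      using Cauchy_Schwarz_ineq_sum by metis
    also have "\<dots> \<le> A k * (\<Sum>x\<in>B. m x * (\<phi> x)\<^sup>2)"
      unfolding A_def using B
      by (intro mult_left_mono sum_nonneg) (auto simp: power_mult_distrib intro!: sum_mono2)
    also have "\<dots> \<le> A k * (Q * A k * En \<phi> \<phi>)"
      using FK[of \<phi>] phi A_nonneg unfolding pos_set A_def by (intro mult_left_mono) auto
    also have "\<dots> \<le> A k * (Q * A k * (b * Y))"
      using E Q A_nonneg by (intro mult_left_mono) auto
    finally have "Y * Y \<le> (Q * b * (A k)\<^sup>2) * Y" by (simp add: power2_eq_square mult_ac)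
    then have YA: "Y \<le> Q * b * (A k)\<^sup>2"
      using Y0 Q b(1) by (cases "Y = 0") auto
    have "(l - k) * A l = (\<Sum>x | x \<in> B \<and> h x > l. m x * (l - k))"
      by (simp add: A_def sum_distrib_left mult.commute)
    also have "\<dots> \<le> (\<Sum>x | x \<in> B \<and> h x > l. m x * \<phi> x)"
      by (intro sum_mono mult_left_mono) (auto simp: \<phi>_def)
    also have "\<dots> \<le> Y" unfolding Y_def using B phi by (intro sum_mono2) auto
    finally show ?thesis using YA by linarith
  qed
  \<comment> \<open>The levels \<open>t * (1 - (1 / 2) ^ j)\<close> increase to \<open>t\<close>
    with gaps \<open>t / 2 ^ (j + 1)\<close>; the factor 4 is what \<open>step\<close> needs to
    halve the mass across each gap.\<close>
  define t where "t = 4 * b * Q * mB"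
  have t: "t > 0" using b Q mB by (simp add: t_def)
  have iter: "A (t * (1 - (1 / 2) ^ j)) \<le> mB * (1 / 2) ^ j" for j
  proof (induction j)
    case 0
    show ?case unfolding A_def mB_def using B by (auto intro!: sum_mono2)
  next
    case (Suc j)
    let ?p = "(1 / 2 :: real) ^ j"
    have p: "0 < ?p" "?p \<le> 1" by (auto simp: power_le_one)
    have "(t * (1 - (1 / 2) ^ Suc j) - t * (1 - ?p)) * A (t * (1 - (1 / 2) ^ Suc j))
        \<le> Q * b * (A (t * (1 - ?p)))\<^sup>2"
      using p t by (intro step) (auto simp: algebra_simps)
    also have "\<dots> \<le> Q * b * (mB * ?p)\<^sup>2"
      using Suc A_nonneg Q b by (intro mult_left_mono power_mono) auto
    also have "\<dots> = (t * ?p / 2) * (mB * (1 / 2) ^ Suc j)"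
      by (simp add: t_def power2_eq_square)
    also have "t * (1 - (1 / 2) ^ Suc j) - t * (1 - ?p) = t * ?p / 2" by (simp add: algebra_simps)
    finally show ?case using t p by simp
  qed
  have "A t \<le> mB * (1 / 2) ^ j" for j
  proof -
    have "A t \<le> A (t * (1 - (1 / 2) ^ j))"
      unfolding A_def using B t by (intro sum_mono2) (auto simp: mult_less_cancel_left2 elim!: le_less_trans[rotated])
    then show ?thesis using iter[of j] by linarith
  qed
  moreover have "(\<lambda>j. mB * (1 / 2 :: real) ^ j) \<longlonglongrightarrow> mB * 0"
    by (intro tendsto_mult tendsto_const LIMSEQ_power_zero) auto
  ultimately have "A t \<le> 0" using LIMSEQ_le_const[of _ "mB * 0" "A t"] by auto
  have "\<not> h x > t"
  proof
    assume "h x > t"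
    then have "m x \<le> A t" unfolding A_def using True B by (intro member_le_sum) auto
    then show False using mx[OF True] \<open>A t \<le> 0\<close> by linarith
  qed
  then show ?thesis by (simp add: h_def t_def mB_def)
qed

lemma pot_limit:
  assumes bound: "\<And>n x. pot s n x \<le> c0"
  obtains h where "\<And>x. (\<lambda>n. pot s n x) \<longlonglongrightarrow> h x" "\<And>x. h x \<ge> 0" "\<And>x. x \<notin> B \<Longrightarrow> h x = 0"
    "\<And>x. x \<in> B \<Longrightarrow> Lap h x = s x" "\<And>x. h x \<le> c0" "\<And>n x. pot s n x \<le> h x"
proof -
  have inc: "incseq (\<lambda>n. pot s n x)" for x using pot_mono by (intro incseq_SucI)
  have "\<exists>l. (\<lambda>n. pot s n x) \<longlonglongrightarrow> l" for x
    using incseq_convergent[OF inc, of x c0] bound by metis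
  then obtain h where h: "\<And>x. (\<lambda>n. pot s n x) \<longlonglongrightarrow> h x" by metis
  have "pot s n x \<le> h x" for n x by (rule incseq_le[OF inc h])
  moreover have "h x \<le> c0" for x using LIMSEQ_le_const2[OF h[of x]] bound by blast
  moreover have "h x \<ge> 0" for x using pot_nonneg[of 0 x] \<open>\<And>n x. pot s n x \<le> h x\<close> order_trans by blast
  moreover have "h x = 0" if "x \<notin> B" for x
    using h[of x] pot_outside[OF that] by (simp add: LIMSEQ_const_iff)
  moreover have "Lap h x = s x" if "x \<in> B" for x
  proof -
    have d: "deg x > 0" using deg_bounds(3) that B by blast
    have "(\<lambda>n. pot s (Suc n) x) \<longlonglongrightarrow> (s x + (\<Sum>y\<in>nb x. c x y * h y)) / deg x"
      using that d by (simp, intro tendsto_intros h) auto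
    then have "h x = (s x + (\<Sum>y\<in>nb x. c x y * h y)) / deg x"
      using LIMSEQ_unique LIMSEQ_Suc[OF h] by blast
    then show ?thesis using d by (simp add: Lap_eq field_simps)
  qed
  ultimately show ?thesis using that h by blast
qed

end

end

section \<open>A Faber-Krahn inequality\<close>

context good_graph
begin

text \<open>Plays the part of the gradient of \<open>f\<close> on the face times its diameter: by
  \<open>osc_verts\<close> it bounds the difference of any two values at vertices of the
  face.\<close>

definition osc :: "(complex \<Rightarrow> real) \<Rightarrow> complex set \<Rightarrow> real" where
  "osc f F = (\<Sum>(a, b)\<in>sides F. \<bar>f a - f b\<bar>)"

lemma osc_nonneg: "osc f F \<ge> 0"
  unfolding osc_def by (intro sum_nonneg) auto

text \<open>Closed faces that meet on \<open>G\<close> share a vertex, so the ranges of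
  \<open>f\<close> on their vertices overlap and \<open>connected_interval_chain\<close>
  applies.\<close>

lemma walk_along:
  assumes G: "compact G" "connected G" "G \<subseteq> carr E"
    and F: "F \<in> faces E" "closure F \<inter> G \<noteq> {}" "x \<in> verts F"
    and F': "F' \<in> faces E" "closure F' \<inter> G \<noteq> {}" "y \<in> verts F'"
  shows "\<bar>f x - f y\<bar> \<le> (\<Sum>H | H \<in> faces E \<and> closure H \<inter> G \<noteq> {}. osc f H)"
proof -
  let ?J = "{H \<in> faces E. closure H \<inter> G \<noteq> {}}"
  define lo where "lo = (\<lambda>H. Min (f ` verts H))"
  define hi where "hi = (\<lambda>H. Max (f ` verts H))"
  have range: "f v \<in> {lo H..hi H}" if "H \<in> faces E" "v \<in> verts H" for H v
    using that card_verts(1)[of H] by (auto simp: lo_def hi_def)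
  have "\<bar>f x - f y\<bar> \<le> (\<Sum>H\<in>?J. hi H - lo H)"
  proof (rule connected_interval_chain[where K = closure])
    show "connected G" by fact
    show "finite ?J" by (rule finite_faces_meeting_compact[OF G(1,3)])
    show "G \<subseteq> (\<Union>H\<in>?J. closure H)" using G(3) unfolding carr_def by blast
    show "F \<in> ?J" "F' \<in> ?J" using F F' by auto
    show "f x \<in> {lo F..hi F}" "f y \<in> {lo F'..hi F'}" using range F F' by auto
    fix H assume H: "H \<in> ?J"
    show "closed (closure H)" "closure H \<inter> G \<noteq> {}" using H by auto
    show "lo H \<le> hi H" using range[of H] verts_nonempty[of H] H by force
    fix H' assume H': "H' \<in> ?J" "closure H' \<inter> closure H \<inter> G \<noteq> {}"
    then obtain v where "v \<in> verts H" "v \<in> verts H'"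
      using common_vertex[of H' H] H by blast
    then show "{lo H'..hi H'} \<inter> {lo H..hi H} \<noteq> {}" using range H H' by blast
  qed
  also have "\<dots> \<le> (\<Sum>H\<in>?J. osc f H)"
  proof (rule sum_mono)
    fix H assume "H \<in> ?J"
    then have H: "H \<in> faces E" by simp
    have "finite (f ` verts H)" "f ` verts H \<noteq> {}" using card_verts(1)[OF H] verts_nonempty[OF H] by auto
    then obtain a b where "a \<in> verts H" "b \<in> verts H" "lo H = f a" "hi H = f b"
      using Min_in[of "f ` verts H"] Max_in[of "f ` verts H"] unfolding lo_def hi_def by (metis imageE)
    then show "hi H - lo H \<le> osc f H"
      using osc_verts[OF H, of b a f] by (simp add: osc_def)
  qed
  finally show ?thesis .
qed

text \<open>A vertex is chosen by at most \<open>K\<close> faces; the other two factors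
  \<open>K\<close> come from the square.\<close>

lemma sum_rad_faces:
  assumes S: "finite S" and A: "finite A" "A \<subseteq> V"
    and p: "\<And>F. F \<in> S \<Longrightarrow> p F \<in> A \<and> F \<in> faces_at (p F)"
  shows "(\<Sum>F\<in>S. (K * rad (p F))\<^sup>2) \<le> K ^ 3 * (\<Sum>v\<in>A. m v)"
proof -
  have "(\<Sum>F\<in>S. (K * rad (p F))\<^sup>2) = (\<Sum>v\<in>A. \<Sum>F | F \<in> S \<and> p F = v. (K * rad (p F))\<^sup>2)"
    using S A p by (intro sum.group[symmetric]) auto
  also have "\<dots> \<le> (\<Sum>v\<in>A. K ^ 3 * m v)"
  proof (rule sum_mono)
    fix v assume v: "v \<in> A"
    have "(\<Sum>F | F \<in> S \<and> p F = v. (K * rad (p F))\<^sup>2) = real (card {F. F \<in> S \<and> p F = v}) * (K\<^sup>2 * m v)"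
      by (simp add: power_mult_distrib)
    also have "card {F. F \<in> S \<and> p F = v} \<le> card (faces_at v)"
      using p faces_at_bound(1) v A by (intro card_mono) auto
    then have "real (card {F. F \<in> S \<and> p F = v}) * (K\<^sup>2 * m v) \<le> K * (K\<^sup>2 * m v)"
      using card_faces_at_K[of v] v A by (intro mult_right_mono) auto
    finally show "(\<Sum>F | F \<in> S \<and> p F = v. (K * rad (p F))\<^sup>2) \<le> K ^ 3 * m v"
      by (simp add: power2_eq_square power3_eq_cube mult_ac)
  qed
  finally show ?thesis by (simp add: sum_distrib_left)
qed

end

context dirichlet_problem
begin

text \<open>The three factors \<open>K\<close> bound the number of sides of a face, the number of
  faces that share an edge, and the inverse of a conductance. The factor 2 undoes the halving in
  \<open>En\<close>.\<close>

lemma sum_osc_sq_le_energy: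
  assumes S: "finite S" "S \<subseteq> faces E" and f: "\<And>x. x \<notin> B \<Longrightarrow> f x = 0"
  shows "(\<Sum>F\<in>S. (osc f F)\<^sup>2) \<le> 2 * K ^ 3 * En f f"
proof -
  define P where "P = {p \<in> N \<times> N. {fst p, snd p} \<in> E}"
  define df where "df = (\<lambda>p. (f (fst p) - f (snd p))\<^sup>2)"
  have finP: "finite P" using N(1) by (simp add: P_def)
  have df0: "df p \<ge> 0" for p by (simp add: df_def)
  have one: "(osc f F)\<^sup>2 \<le> K * (\<Sum>p\<in>P. if p \<in> sides F then df p else 0)" if F: "F \<in> S" for F
  proof -
    have Ff: "F \<in> faces E" using F S by auto
    have "(osc f F)\<^sup>2 = (\<Sum>p\<in>sides F. 1 * \<bar>f (fst p) - f (snd p)\<bar>)\<^sup>2"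
      by (simp add: osc_def case_prod_beta)
    also have "\<dots> \<le> (\<Sum>p\<in>sides F. 1\<^sup>2) * (\<Sum>p\<in>sides F. \<bar>f (fst p) - f (snd p)\<bar>\<^sup>2)"
      by (rule Cauchy_Schwarz_ineq_sum)
    also have "\<dots> = real (card (sides F)) * (\<Sum>p\<in>sides F. df p)" by (simp add: df_def)
    also have "\<dots> \<le> K * (\<Sum>p\<in>sides F. df p)"
      using card_sides_K[OF Ff] df0 by (intro mult_right_mono sum_nonneg) auto
    also have "(\<Sum>p\<in>sides F. df p) = (\<Sum>p\<in>sides F \<inter> P. df p)"
    proof (rule sum.mono_neutral_right[OF finite_sides[OF Ff]])
      show "\<forall>p\<in>sides F - sides F \<inter> P. df p = 0"
      proof
        fix p assume p: "p \<in> sides F - sides F \<inter> P"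
        obtain a b where ab: "p = (a, b)" by force
        then have e: "{a, b} \<in> E" using p side_edge by (auto simp: sides_def)
        have "a \<notin> B" "b \<notin> B"
          using p ab e N(3,4) nb_iff[of b a] nb_iff[of a b] by (auto simp: P_def insert_commute)
        then show "df p = 0" using f ab by (simp add: df_def)
      qed
    qed auto
    also have "\<dots> = (\<Sum>p\<in>P. if p \<in> sides F then df p else 0)"
      using finP by (simp add: sum.inter_restrict Int_commute)
    finally show ?thesis .
  qed
  have "(\<Sum>F\<in>S. (osc f F)\<^sup>2) \<le> (\<Sum>F\<in>S. K * (\<Sum>p\<in>P. if p \<in> sides F then df p else 0))"
    using one by (rule sum_mono)
  also have "\<dots> = K * (\<Sum>p\<in>P. \<Sum>F\<in>S. if p \<in> sides F then df p else 0)"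
    by (subst sum.swap) (simp add: sum_distrib_left)
  also have "\<dots> \<le> K * (\<Sum>p\<in>P. K * (K * (c (fst p) (snd p) * df p)))"
  proof (intro mult_left_mono sum_mono)
    fix p assume p: "p \<in> P"
    have pV: "fst p \<in> V" using p N(2) by (auto simp: P_def)
    have "(\<Sum>F\<in>S. if p \<in> sides F then df p else 0) = real (card {F \<in> S. p \<in> sides F}) * df p"
      using S by (simp add: sum.inter_filter[symmetric])
    also have "card {F \<in> S. p \<in> sides F} \<le> card (faces_at (fst p))"
    proof (rule card_mono[OF faces_at_bound(1)[OF pV]])
      show "{F \<in> S. p \<in> sides F} \<subseteq> faces_at (fst p)"
        using S side_ends_closure(1) by (auto simp: sides_def faces_at_def)
    qed
    then have "real (card {F \<in> S. p \<in> sides F}) * df p \<le> K * df p"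
      using card_faces_at_K[OF pV] df0 by (intro mult_right_mono) auto
    also have "\<dots> \<le> K * (K * (c (fst p) (snd p) * df p))"
    proof (rule mult_left_mono)
      have "1 / K \<le> c (fst p) (snd p)" using c_bounds(1) p by (auto simp: P_def)
      then have "1 \<le> K * c (fst p) (snd p)" using K_bounds(1) by (simp add: field_simps)
      then have "1 * df p \<le> (K * c (fst p) (snd p)) * df p" using df0 by (intro mult_right_mono)
      then show "df p \<le> K * (c (fst p) (snd p) * df p)" by (simp add: mult.assoc)
    qed (use K_bounds(1) in simp)
    finally show "(\<Sum>F\<in>S. if p \<in> sides F then df p else 0) \<le> K * (K * (c (fst p) (snd p) * df p))" .
  qed (use K_bounds(1) in simp)
  also have "\<dots> = K ^ 3 * (\<Sum>p\<in>P. c (fst p) (snd p) * df p)"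
    by (simp add: sum_distrib_left power3_eq_cube mult.assoc)
  also have "(\<Sum>p\<in>P. c (fst p) (snd p) * df p) = (\<Sum>p\<in>N \<times> N. c (fst p) (snd p) * df p)"
    using N(1) by (intro sum.mono_neutral_left) (auto simp: P_def c_def)
  also have "\<dots> = 2 * En f f"
    by (simp add: En_def df_def sum.cartesian_product case_prod_beta power2_eq_square)
  finally show ?thesis by simp
qed

text \<open>
  Walking from near \<open>v\<close> in a fixed direction until \<open>f\<close> vanishes bounds \<open>f v\<close> by the oscillations on the
  faces that are met.  Here \<open>l\<close> is the coordinate that is constant along the walk.
\<close>

lemma value_le_sum_osc:
  assumes u: "u \<in> V" "rad u \<le> r" and BV: "B \<subseteq> V_euc V u r" and carr: "cball u ((K + 6) * r) \<subseteq> carr E"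
    and f: "\<And>x. f x \<ge> 0" "\<And>x. x \<notin> B \<Longrightarrow> f x = 0"
    and A: "A = {x \<in> B. f x > 0}" and S: "S = (\<Union>v\<in>A. faces_at v)"
    and p: "\<And>F. F \<in> S \<Longrightarrow> p F \<in> A \<and> F \<in> faces_at (p F)"
    and e: "norm e = 1" and l: "\<And>z t. l (z + t *\<^sub>R e) = l z" "\<And>x y. \<bar>l x - l y\<bar> \<le> dist x y"
    and v: "v \<in> A" and z: "dist z v < rad v / K"
  shows "f v \<le> (\<Sum>F\<in>S. osc f F * indicator {z. \<bar>l z - l (p F)\<bar> \<le> K * rad (p F)} z)"
proof -
  have r: "r > 0" using u rad_pos[OF u(1)] by linarith
  have K1: "K \<ge> 1" using K_bounds(1) .
  have vB: "v \<in> B" "v \<in> V" "v \<in> V_euc V u r" using v A BV by (auto simp: V_euc_def)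
  have "rad v \<le> r" using rad_le_radius[OF u vB(3)] .
  moreover have "rad v / K \<le> rad v / 1" using K1 rad_pos[OF vB(2)] by (intro divide_left_mono) auto
  ultimately have zv: "dist z v \<le> r" using z by simp
  moreover have "dist u v \<le> r" using vB by (simp add: V_euc_def)
  ultimately have zu: "dist u z \<le> 2 * r" using dist_triangle[of u z v] by (simp add: dist_commute)
  \<comment> \<open>As \<open>z\<close> is within \<open>2 * r\<close> of \<open>u\<close>, the
    point \<open>z'\<close> has distance at least \<open>(K + 2) * r\<close> from \<open>u\<close>.
    A face there with a vertex in the ball would have diameter at most \<open>K * r\<close> and
    reach only up to \<open>(K + 1) * r\<close>.\<close>
  define z' where "z' = z + ((K + 4) * r) *\<^sub>R e"
  define G where "G = closed_segment z z'"
  have G: "compact G" "connected G" by (auto simp: G_def)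
  have T: "(K + 4) * r \<ge> 0" using K1 r by simp
  have zz': "dist z z' = (K + 4) * r" using T e by (simp add: z'_def dist_norm)
  have "dist u x \<le> (K + 6) * r" if "x \<in> G" for x
  proof -
    have "dist z x \<le> dist z z'" using dist_in_closed_segment(1)[of x z z'] that by (simp add: G_def dist_commute)
    then show ?thesis using zz' zu dist_triangle[of u x z] by (simp add: algebra_simps)
  qed
  then have Gc: "G \<subseteq> carr E" using carr by (auto simp: subset_iff)
  obtain F0 where F0: "F0 \<in> faces_at v" "z \<in> closure F0" using vertex_star_K[OF vB(2) z] .
  then have F0': "F0 \<in> faces E" "v \<in> verts F0"
    using vertex_in_closure vB(2) by (auto simp: faces_at_def)
  have "z' \<in> carr E" using Gc by (auto simp: G_def)
  then obtain F1 where F1: "F1 \<in> faces E" "z' \<in> closure F1" by (auto simp: carr_def)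
  obtain y where y: "y \<in> verts F1" using verts_nonempty[OF F1(1)] by blast
  have yc: "y \<in> closure F1" using y by (simp add: verts_def frontier_def)
  have "f y = 0"
  proof (rule ccontr)
    assume "f y \<noteq> 0"
    then have "y \<in> V_euc V u r" using f(2) BV by blast
    then have yu: "dist y u \<le> r" by (simp add: V_euc_def dist_commute)
    have "dist z' y \<le> K * r" using face_diam_le_dist_K[OF F1(1) u yc yu F1(2) yc] .
    then have "dist z' u \<le> (K + 1) * r" using yu dist_triangle[of z' u y] by (simp add: algebra_simps)
    moreover have "dist z z' \<le> dist z' u + dist u z"
      using dist_triangle[of z z' u] by (simp add: dist_commute)
    ultimately show False using zz' zu r by (simp add: algebra_simps)
  qed
  then have "f v \<le> \<bar>f v - f y\<bar>" by simp
  also have "\<dots> \<le> (\<Sum>H | H \<in> faces E \<and> closure H \<inter> G \<noteq> {}. osc f H)"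
  proof (rule walk_along[OF G Gc F0'(1) _ F0'(2) F1(1) _ y])
    show "closure F0 \<inter> G \<noteq> {}" using F0(2) by (auto simp: G_def)
    show "closure F1 \<inter> G \<noteq> {}" using F1(2) by (auto simp: G_def)
  qed
  also have "\<dots> = (\<Sum>H | H \<in> faces E \<and> closure H \<inter> G \<noteq> {} \<and> H \<in> S. osc f H)"
  proof (rule sum.mono_neutral_right[OF finite_faces_meeting_compact[OF G(1) Gc]])
    show "\<forall>H\<in>{H \<in> faces E. closure H \<inter> G \<noteq> {}} - {H \<in> faces E. closure H \<inter> G \<noteq> {} \<and> H \<in> S}. osc f H = 0"
    proof
      fix H assume "H \<in> {H \<in> faces E. closure H \<inter> G \<noteq> {}} - {H \<in> faces E. closure H \<inter> G \<noteq> {} \<and> H \<in> S}"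
      then have H: "H \<in> faces E" "H \<notin> S" by auto
      have "f a = 0" if "a \<in> closure H" for a
      proof (rule ccontr)
        assume "f a \<noteq> 0"
        then have "a \<in> A" using f A by (force simp: less_le)
        then show False using H that unfolding S faces_at_def by blast
      qed
      then show "osc f H = 0"
        unfolding osc_def using side_ends_closure by (intro sum.neutral) (auto simp: sides_def)
    qed
  qed auto
  \<comment> \<open>The walk meets \<open>H\<close> at a point with the same \<open>l\<close> as
    \<open>z\<close>, and \<open>H\<close> is within \<open>K * rad (p H)\<close> of
    \<open>p H\<close>; so the indicator is 1 for all faces that are met.\<close>
  also have "\<dots> = (\<Sum>H | H \<in> faces E \<and> closure H \<inter> G \<noteq> {} \<and> H \<in> S.
      osc f H * indicator {z. \<bar>l z - l (p H)\<bar> \<le> K * rad (p H)} z)"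
  proof (intro sum.cong refl)
    fix H assume "H \<in> {H \<in> faces E. closure H \<inter> G \<noteq> {} \<and> H \<in> S}"
    then obtain q where H: "H \<in> faces E" "H \<in> S" "q \<in> closure H" "q \<in> closed_segment z z'" by (auto simp: G_def)
    obtain t where "q = (1 - t) *\<^sub>R z + t *\<^sub>R z'" using H(4) by (auto simp: in_segment)
    then have "q = z + (t * ((K + 4) * r)) *\<^sub>R e" by (simp add: z'_def algebra_simps)
    then have lq: "l q = l z" using l(1) by simp
    have "p H \<in> verts H" "p H \<in> closure H"
      using p[OF H(2)] vertex_in_closure B(1) A by (auto simp: faces_at_def)
    then have "dist q (p H) \<le> K * rad (p H)" using face_diam_rad_K[OF H(1) _ H(3)] by blast
    then have "\<bar>l z - l (p H)\<bar> \<le> K * rad (p H)" using l(2)[of q "p H"] lq by simp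
    then show "osc f H = osc f H * indicator {z. \<bar>l z - l (p H)\<bar> \<le> K * rad (p H)} z" by simp
  qed
  also have "\<dots> \<le> (\<Sum>F\<in>S. osc f F * indicator {z. \<bar>l z - l (p F)\<bar> \<le> K * rad (p F)} z)"
    using faces_at_bound(1) B osc_nonneg unfolding S A by (intro sum_mono2) auto
  finally show ?thesis .
qed

text \<open>The argument of Gagliardo and Nirenberg. A horizontal and a vertical walk from near
  \<open>v\<close> bound the square of \<open>f v\<close> by a product of two sums over faces, each
  face being restricted to a strip. Integration over disjoint discs about the vertices turns pairs
  of strips into rectangles of area \<open>4 * d F * d F'\<close>, so the bound becomes four times
  the square of the sum of \<open>w F * d F\<close>. The Cauchy-Schwarz inequality splits this into
  the energy and the mass of the support.\<close>

lemma faber_krahn: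
  assumes u: "u \<in> V" "rad u \<le> r" and BV: "B \<subseteq> V_euc V u r" and carr: "cball u ((K + 6) * r) \<subseteq> carr E"
    and f: "\<And>x. f x \<ge> 0" "\<And>x. x \<notin> B \<Longrightarrow> f x = 0"
  shows "(\<Sum>x\<in>B. m x * (f x)\<^sup>2) \<le> 16 * K ^ 8 * (\<Sum>x | x \<in> B \<and> f x > 0. m x) * En f f"
proof -
  define A where "A = {x \<in> B. f x > 0}"
  define S where "S = (\<Union>v\<in>A. faces_at v)"
  have A: "finite A" "A \<subseteq> V" using B by (auto simp: A_def)
  have S: "finite S" "S \<subseteq> faces E"
    using faces_at_bound(1) A by (auto simp: S_def faces_at_def)
  have "\<forall>F\<in>S. \<exists>v. v \<in> A \<and> F \<in> faces_at v" by (auto simp: S_def)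
  from bchoice[OF this] obtain p where p: "\<And>F. F \<in> S \<Longrightarrow> p F \<in> A \<and> F \<in> faces_at (p F)" by blast
  define d where "d = (\<lambda>F. K * rad (p F))"
  have K1: "K \<ge> 1" using K_bounds(1) .
  have d0: "d F \<ge> 0" if "F \<in> S" for F
    using p[OF that] A(2) rad_pos[of "p F"] K1 by (auto simp: d_def)
  define w where "w = osc f"
  have w0: "w F \<ge> 0" for F using osc_nonneg by (simp add: w_def)
  define Y where "Y = (\<lambda>F. {z. \<bar>Im z - Im (p F)\<bar> \<le> d F})"
  define X where "X = (\<lambda>F. {z. \<bar>Re z - Re (p F)\<bar> \<le> d F})"
  \<comment> \<open>The factor 1/2 makes the discs disjoint, and \<open>1 / K\<close> keeps them
    inside the stars of their centres, where \<open>value_le_sum_osc\<close> applies.\<close>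
  define t where "t = 1 / (2 * K)"
  have t: "0 < t" "t \<le> 1 / 2" using K1 by (auto simp: t_def field_simps)
  let ?b = "\<lambda>v. ball v (t * rad v)"
  have le: "f v \<le> (\<Sum>F\<in>S. w F * indicator (Y F) z)" "f v \<le> (\<Sum>F\<in>S. w F * indicator (X F) z)"
    if v: "v \<in> A" "z \<in> ?b v" for v z
  proof -
    have "t * rad v < rad v / K" using rad_pos[of v] v(1) A(2) K1 by (auto simp: t_def field_simps)
    then have z: "dist z v < rad v / K" using v(2) by (simp add: dist_commute)
    show "f v \<le> (\<Sum>F\<in>S. w F * indicator (Y F) z)"
      unfolding w_def Y_def d_def
      by (rule value_le_sum_osc[OF u BV carr f A_def S_def p, where e = 1])
        (use v z abs_Im_le_cmod in \<open>auto simp: dist_norm simp flip: minus_complex.sel\<close>)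
    show "f v \<le> (\<Sum>F\<in>S. w F * indicator (X F) z)"
      unfolding w_def X_def d_def
      by (rule value_le_sum_osc[OF u BV carr f A_def S_def p, where e = \<i>])
        (use v z abs_Re_le_cmod in \<open>auto simp: dist_norm simp flip: minus_complex.sel\<close>)
  qed
  have sum2: "ennreal (\<Sum>F\<in>S. \<Sum>F'\<in>S. g F F') = (\<Sum>F\<in>S. \<Sum>F'\<in>S. ennreal (g F F'))"
    if "\<And>F F'. F \<in> S \<Longrightarrow> F' \<in> S \<Longrightarrow> g F F' \<ge> 0" for g
  proof -
    have "(\<Sum>F'\<in>S. ennreal (g F F')) = ennreal (\<Sum>F'\<in>S. g F F')" if "F \<in> S" for F
      using \<open>\<And>F F'. F \<in> S \<Longrightarrow> F' \<in> S \<Longrightarrow> g F F' \<ge> 0\<close> that by (intro sum_ennreal) auto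
    then have "(\<Sum>F\<in>S. \<Sum>F'\<in>S. ennreal (g F F')) = (\<Sum>F\<in>S. ennreal (\<Sum>F'\<in>S. g F F'))"
      by (intro sum.cong refl)
    also have "\<dots> = ennreal (\<Sum>F\<in>S. \<Sum>F'\<in>S. g F F')"
      using that by (intro sum_ennreal sum_nonneg) auto
    finally show ?thesis by simp
  qed
  have point: "(\<Sum>v\<in>A. ennreal ((f v)\<^sup>2) * indicator (?b v) z)
      \<le> (\<Sum>F\<in>S. \<Sum>F'\<in>S. ennreal (w F * w F') * indicator (Y F \<inter> X F') z)" for z
  proof (cases "\<exists>v\<in>A. z \<in> ?b v")
    case False
    then have "(\<Sum>v\<in>A. ennreal ((f v)\<^sup>2) * indicator (?b v) z) = 0" by (intro sum.neutral) auto
    then show ?thesis by simp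
  next
    case True
    then obtain v where v: "v \<in> A" "z \<in> ?b v" by blast
    have other: "z \<notin> ?b v'" if "v' \<in> A" "v' \<noteq> v" for v'
      using rad_ball_disjoint[of v v' t] that v A(2) t by blast
    have "(\<Sum>v\<in>A. ennreal ((f v)\<^sup>2) * indicator (?b v) z) = (\<Sum>v'\<in>{v}. ennreal ((f v')\<^sup>2) * indicator (?b v') z)"
      using A(1) v(1) other by (intro sum.mono_neutral_right) auto
    also have "\<dots> = ennreal (f v * f v)" using v(2) by (simp add: power2_eq_square)
    also have "\<dots> \<le> ennreal ((\<Sum>F\<in>S. w F * indicator (Y F) z) * (\<Sum>F\<in>S. w F * indicator (X F) z))"
      using le[OF v] f(1)[of v] by (intro ennreal_leI mult_mono) auto
    also have "(\<Sum>F\<in>S. w F * indicator (Y F) z) * (\<Sum>F\<in>S. w F * indicator (X F) z) =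
        (\<Sum>F\<in>S. \<Sum>F'\<in>S. w F * w F' * indicator (Y F \<inter> X F') z)"
      unfolding sum_product by (intro sum.cong refl) (simp add: indicator_inter_arith mult_ac)
    also have "ennreal \<dots> = (\<Sum>F\<in>S. \<Sum>F'\<in>S. ennreal (w F * w F' * indicator (Y F \<inter> X F') z))"
      using w0 by (intro sum2) simp
    also have "\<dots> = (\<Sum>F\<in>S. \<Sum>F'\<in>S. ennreal (w F * w F') * indicator (Y F \<inter> X F') z)"
      by (intro sum.cong refl) (simp add: indicator_def)
    finally show ?thesis .
  qed
  have box: "Y F \<inter> X F' = cbox (Complex (Re (p F') - d F') (Im (p F) - d F)) (Complex (Re (p F') + d F') (Im (p F) + d F))" for F F'
    by (auto simp: Y_def X_def in_cbox_complex_iff abs_le_iff)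
  have box_meas: "emeasure lborel (Y F \<inter> X F') = ennreal (4 * d F * d F')" if "F \<in> S" "F' \<in> S" for F F'
    unfolding box using d0 that
    by (subst emeasure_lborel_cbox) (auto simp: Basis_complex_def inner_complex_def mult_ac complex_eq_iff)
  have "(\<Sum>v\<in>A. ennreal ((f v)\<^sup>2 * (pi * (t * rad v)\<^sup>2))) = (\<Sum>v\<in>A. ennreal ((f v)\<^sup>2) * emeasure lborel (?b v))"
  proof (intro sum.cong refl)
    fix v assume "v \<in> A"
    then have "t * rad v \<ge> 0" using rad_pos[of v] A(2) t by auto
    then show "ennreal ((f v)\<^sup>2 * (pi * (t * rad v)\<^sup>2)) = ennreal ((f v)\<^sup>2) * emeasure lborel (?b v)"
      by (simp add: emeasure_ball unit_ball_vol_2 ennreal_mult)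
  qed
  also have "\<dots> = (\<integral>\<^sup>+z. (\<Sum>v\<in>A. ennreal ((f v)\<^sup>2) * indicator (?b v) z) \<partial>lborel)"
  proof -
    have b: "?b v \<in> sets lborel" for v by simp
    then have "(\<lambda>z. ennreal ((f v)\<^sup>2) * indicator (?b v) z) \<in> borel_measurable lborel" for v
      by (intro borel_measurable_times_ennreal borel_measurable_const borel_measurable_indicator)
    then have "(\<integral>\<^sup>+z. (\<Sum>v\<in>A. ennreal ((f v)\<^sup>2) * indicator (?b v) z) \<partial>lborel)
        = (\<Sum>v\<in>A. \<integral>\<^sup>+z. ennreal ((f v)\<^sup>2) * indicator (?b v) z \<partial>lborel)"
      by (intro nn_integral_sum)
    also have "\<dots> = (\<Sum>v\<in>A. ennreal ((f v)\<^sup>2) * emeasure lborel (?b v))"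
      using b by (intro sum.cong refl nn_integral_cmult_indicator)
    finally show ?thesis by simp
  qed
  also have "\<dots> \<le> (\<integral>\<^sup>+z. (\<Sum>F\<in>S. \<Sum>F'\<in>S. ennreal (w F * w F') * indicator (Y F \<inter> X F') z) \<partial>lborel)"
    using point by (intro nn_integral_mono)
  also have "\<dots> = (\<Sum>F\<in>S. \<Sum>F'\<in>S. ennreal (w F * w F') * emeasure lborel (Y F \<inter> X F'))"
    unfolding box by (simp add: nn_integral_sum nn_integral_cmult_indicator)
  also have "\<dots> = (\<Sum>F\<in>S. \<Sum>F'\<in>S. ennreal ((w F * w F') * (4 * d F * d F')))"
    using box_meas w0 d0 by (intro sum.cong refl) (simp add: ennreal_mult[symmetric])
  also have "\<dots> = ennreal (\<Sum>F\<in>S. \<Sum>F'\<in>S. (w F * w F') * (4 * d F * d F'))"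
    using w0 d0 by (intro sum2[symmetric]) simp
  finally have "ennreal (\<Sum>v\<in>A. (f v)\<^sup>2 * (pi * (t * rad v)\<^sup>2)) \<le> ennreal (\<Sum>F\<in>S. \<Sum>F'\<in>S. (w F * w F') * (4 * d F * d F'))"
    by (subst (asm) sum_ennreal) auto
  then have "(\<Sum>v\<in>A. (f v)\<^sup>2 * (pi * (t * rad v)\<^sup>2)) \<le> (\<Sum>F\<in>S. \<Sum>F'\<in>S. (w F * w F') * (4 * d F * d F'))"
    using w0 d0 by (subst (asm) ennreal_le_iff) (auto intro!: sum_nonneg)
  also have "\<dots> = 4 * (\<Sum>F\<in>S. w F * d F)\<^sup>2"
    by (simp add: power2_eq_square sum_product sum_distrib_left mult_ac)
  also have "\<dots> \<le> 4 * ((\<Sum>F\<in>S. (w F)\<^sup>2) * (\<Sum>F\<in>S. (d F)\<^sup>2))"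
    using Cauchy_Schwarz_ineq_sum[of w d S] by simp
  also have "\<dots> \<le> 4 * ((2 * K ^ 3 * En f f) * (K ^ 3 * (\<Sum>v\<in>A. m v)))"
    using sum_osc_sq_le_energy[OF S f(2)] sum_rad_faces[OF S(1) A p] K1 En_nonneg
    by (intro mult_left_mono mult_mono) (auto simp: w_def d_def sum_nonneg)
  finally have main: "(\<Sum>v\<in>A. (f v)\<^sup>2 * (pi * (t * rad v)\<^sup>2)) \<le> 8 * K ^ 6 * (\<Sum>v\<in>A. m v) * En f f"
    by (simp add: mult_ac flip: power_add)
  have "(\<Sum>v\<in>A. (f v)\<^sup>2 * (pi * (t * rad v)\<^sup>2)) = pi / (4 * K\<^sup>2) * (\<Sum>v\<in>A. m v * (f v)\<^sup>2)"
    by (simp add: t_def power_mult_distrib power_divide sum_distrib_left mult_ac)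
  moreover have "2 / (4 * K\<^sup>2) * (\<Sum>v\<in>A. m v * (f v)\<^sup>2) \<le> pi / (4 * K\<^sup>2) * (\<Sum>v\<in>A. m v * (f v)\<^sup>2)"
    using pi_ge_two by (intro mult_right_mono divide_right_mono sum_nonneg) auto
  ultimately have "2 / (4 * K\<^sup>2) * (\<Sum>v\<in>A. m v * (f v)\<^sup>2) \<le> 8 * K ^ 6 * (\<Sum>v\<in>A. m v) * En f f"
    using main by linarith
  then have "2 * K\<^sup>2 * (2 / (4 * K\<^sup>2) * (\<Sum>v\<in>A. m v * (f v)\<^sup>2)) \<le> 2 * K\<^sup>2 * (8 * K ^ 6 * (\<Sum>v\<in>A. m v) * En f f)"
    using K1 by (intro mult_left_mono) auto
  moreover have "2 * K\<^sup>2 * (2 / (4 * K\<^sup>2) * (\<Sum>v\<in>A. m v * (f v)\<^sup>2)) = (\<Sum>v\<in>A. m v * (f v)\<^sup>2)"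
    using K1 by simp
  moreover have "2 * K\<^sup>2 * (8 * K ^ 6 * (\<Sum>v\<in>A. m v) * En f f) = 16 * K ^ 8 * (\<Sum>v\<in>A. m v) * En f f"
    by (simp add: mult_ac flip: power_add)
  moreover have "(\<Sum>v\<in>A. m v * (f v)\<^sup>2) = (\<Sum>x\<in>B. m x * (f x)\<^sup>2)"
    using B f(1) by (intro sum.mono_neutral_left) (auto simp: A_def less_le)
  ultimately show ?thesis by (simp add: A_def)
qed

end

section \<open>A lower bound for the Green function\<close>

context good_graph
begin

text \<open>
  The level set \<open>{g \<ge> k0}\<close> reaches distance \<open>\<theta> r\<close>.  Below this distance there are \<open>n0\<close> annuli, whose radii
  decrease by factors \<open>lam0\<close> that are so large that no face meets two of them; one of the
  annuli has at most the fraction \<open>1 / n0\<close> of the energy, and it lies outside of the disc of radius \<open>\<Theta> r\<close>.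
\<close>

definition k0 :: real where "k0 = 1 / (128 * K ^ 4)"
definition \<theta> :: real where "\<theta> = 1 / (2 * (1 + K))"
definition lam0 :: real where "lam0 = 4 + 4 * K"
definition n0 :: nat where "n0 = nat \<lceil>2048 * K ^ 6 * (2 + 2 * K)\<^sup>2 / k0\<rceil> + 1"
definition \<Theta> :: real where "\<Theta> = \<theta> / (4 * lam0 ^ n0)"
definition c2 :: real where "c2 = k0 / 2 * (\<Theta> / (1 + K))\<^sup>2 / K\<^sup>2"

lemma k0: "k0 > 0"
  using K_bounds(1) by (simp add: k0_def)

lemma Theta: "\<Theta> > 0"
  using K_bounds(1) by (simp add: \<Theta>_def \<theta>_def lam0_def)

lemma c2: "c2 > 0"
  using K_bounds(1) k0 Theta by (simp add: c2_def)

text \<open>A face that meets the disc of radius \<open>s / (1 + K)\<close> has diameter at most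
  \<open>K * s / (1 + K)\<close>, so its vertices are within \<open>s\<close> of \<open>u\<close>,
  and the disc of radius \<open>K * rad v\<close> about any of them covers it.\<close>

lemma sum_m_lower:
  assumes u: "u \<in> V" "rad u \<le> s / (1 + K)" and carr: "cball u s \<subseteq> carr E"
  shows "(s / (1 + K))\<^sup>2 / K\<^sup>2 \<le> (\<Sum>v\<in>V_euc V u s. m v)"
proof -
  define s' where "s' = s / (1 + K)"
  have K1: "K \<ge> 1" using K_bounds(1) .
  have s': "s' > 0" "s' + K * s' = s" "s' \<le> s" using u rad_pos[OF u(1)] K1
  proof -
    show "s' > 0" using u rad_pos[OF u(1)] by (simp add: s'_def)
    have "(1 + K) * s' = s" using K1 by (simp add: s'_def)
    then show *: "s' + K * s' = s" by (simp add: distrib_right)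
    show "s' \<le> s" using * \<open>s' > 0\<close> K1 by (smt (verit) mult_nonneg_nonneg)
  qed
  have "s'\<^sup>2 \<le> (\<Sum>v\<in>V_euc V u s. (K * rad v)\<^sup>2)"
  proof (rule sum_sq_radii_covering_balls[where c = "\<lambda>v. v" and p = u])
    show "finite (V_euc V u s)" by (rule finite_V_euc[OF carr])
    fix v assume "v \<in> V_euc V u s"
    then show "0 \<le> K * rad v" using rad_pos[of v] K1 by (auto simp: V_euc_def)
  next
    show "ball u s' \<subseteq> (\<Union>v\<in>V_euc V u s. cball v (K * rad v))"
    proof
      fix x assume x: "x \<in> ball u s'"
      then have "x \<in> carr E" using carr s'(3) by (auto simp: subset_iff)
      then obtain F where F: "F \<in> faces E" "x \<in> closure F" by (auto simp: carr_def)
      obtain v where v: "v \<in> verts F" using verts_nonempty[OF F(1)] by blast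
      then have vc: "v \<in> closure F" "v \<in> V" by (auto simp: verts_def frontier_def)
      have xu: "dist x u \<le> s'" using x by (simp add: dist_commute)
      have "dist x v \<le> K * s'"
        using face_diam_le_dist_K[OF F(1) u(1) _ F(2) xu F(2) vc(1)] u(2) by (simp add: s'_def)
      then have "dist u v \<le> s" using xu s'(2) dist_triangle[of u v x] by (simp add: dist_commute)
      moreover have "dist v x \<le> K * rad v" using face_diam_rad_K[OF F(1) v vc(1) F(2)] .
      ultimately show "x \<in> (\<Union>v\<in>V_euc V u s. cball v (K * rad v))"
        using vc by (auto simp: V_euc_def)
    qed
  qed (use s' in simp)
  also have "\<dots> = K\<^sup>2 * (\<Sum>v\<in>V_euc V u s. m v)"
    by (simp add: power_mult_distrib sum_distrib_left)
  finally show ?thesis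
    using K1 by (simp only: s'_def[symmetric]) (simp add: pos_divide_le_eq mult.commute)
qed

end

section \<open>Flux and the minimum principle\<close>

context weighted_graph
begin

text \<open>A discrete divergence theorem: the edges inside \<open>A\<close> cancel by
  antisymmetry.\<close>

lemma sum_Lap:
  assumes A: "A \<subseteq> V" "finite A"
  shows "(\<Sum>x\<in>A. Lap f x) = (\<Sum>x\<in>A. \<Sum>y\<in>nb x - A. c x y * (f x - f y))"
proof -
  let ?Z = "\<Sum>x\<in>A. \<Sum>y\<in>A. c x y * (f x - f y)"
  have "?Z = (\<Sum>y\<in>A. \<Sum>x\<in>A. c x y * (f x - f y))" by (rule sum.swap)
  also have "\<dots> = - ?Z"
    unfolding sum_negf[symmetric] by (intro sum.cong refl) (simp add: c_sym algebra_simps)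
  finally have Z: "?Z = 0" by simp
  have "Lap f x = (\<Sum>y\<in>A. c x y * (f x - f y)) + (\<Sum>y\<in>nb x - A. c x y * (f x - f y))" if "x \<in> A" for x
  proof -
    have fin: "finite (nb x)" using finite_nb that A by blast
    have "Lap f x = (\<Sum>y\<in>nb x \<inter> A. c x y * (f x - f y)) + (\<Sum>y\<in>nb x - A. c x y * (f x - f y))"
      unfolding Lap_def using sum.Int_Diff[OF fin] .
    also have "(\<Sum>y\<in>nb x \<inter> A. c x y * (f x - f y)) = (\<Sum>y\<in>A. c x y * (f x - f y))"
      using A by (intro sum.mono_neutral_left) (auto simp: c_def nb_iff)
    finally show ?thesis .
  qed
  then have "(\<Sum>x\<in>A. Lap f x) = ?Z + (\<Sum>x\<in>A. \<Sum>y\<in>nb x - A. c x y * (f x - f y))"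
    by (simp add: sum.distrib)
  then show ?thesis using Z by simp
qed

text \<open>A nonempty \<open>A\<close> has a boundary edge, as the graph is connected and infinite;
  hence the sum over the boundary edges is negative, while it equals the sum of
  \<open>Lap f\<close>. The conclusion has this form because \<open>A\<close> will be the set of
  vertices that violate a claim.\<close>

lemma minimum_principle:
  assumes A: "A \<subseteq> V" "finite A" and L: "\<And>x. x \<in> A \<Longrightarrow> Lap f x \<ge> 0"
    and less: "\<And>x y. x \<in> A \<Longrightarrow> y \<in> V - A \<Longrightarrow> {x, y} \<in> E \<Longrightarrow> f x < f y"
  shows "A = {}"
proof (rule ccontr)
  assume ne: "A \<noteq> {}"
  obtain a b where ab: "a \<in> A" "b \<in> V - A" "{a, b} \<in> E" using boundary_edge[OF A(2,1) ne] .
  have neg: "c x y * (f x - f y) < 0" if "x \<in> A" "y \<in> nb x - A" for x y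
  proof -
    have e: "{x, y} \<in> E" using that by (simp add: nb_iff)
    then have "c x y > 0" using c_bounds(1)[OF e] K_bounds(1) by (smt (verit) divide_pos_pos)
    then show ?thesis using less[of x y] that e edge_ends(2)[OF e] by (simp add: mult_pos_neg)
  qed
  have inner: "(\<Sum>y\<in>nb x - A. c x y * (f x - f y)) \<le> 0" if "x \<in> A" for x
    using neg[OF that] by (intro sum_nonpos) (auto simp: less_imp_le)
  have "(\<Sum>x\<in>A. \<Sum>y\<in>nb x - A. c x y * (f x - f y)) < (\<Sum>x\<in>A. 0)"
  proof (rule sum_strict_mono_ex1[OF A(2)])
    show "\<forall>x\<in>A. (\<Sum>y\<in>nb x - A. c x y * (f x - f y)) \<le> 0" using inner by blast
    have "(\<Sum>y\<in>nb a - A. - (c a y * (f a - f y))) > 0"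
      using ab neg[OF ab(1)] finite_nb[of a] A by (intro sum_pos) (auto simp: nb_iff)
    then show "\<exists>x\<in>A. (\<Sum>y\<in>nb x - A. c x y * (f x - f y)) < 0"
      using ab(1) by (auto simp: sum_negf)
  qed
  moreover have "(\<Sum>x\<in>A. Lap f x) \<ge> 0" using L by (rule sum_nonneg)
  ultimately show False using sum_Lap[OF A] by simp
qed

end

section \<open>Circles and the faces that they meet\<close>

lemma segment_meets_sphere:
  fixes x y u :: complex
  assumes "dist x u \<le> s" "s < dist y u"
  obtains z where "z \<in> closed_segment x y" "z \<in> sphere u s"
proof -
  have "closed_segment x y \<inter> frontier (cball u s) \<noteq> {}"
    using assms by (intro connected_Int_frontier) (auto simp: dist_commute)
  then show ?thesis using that unfolding frontier_cball by blast
qed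

context good_graph
begin

lemma edge_meets_sphere:
  assumes xy: "{x, y} \<in> E" and d: "dist x u \<le> s" "s < dist y u"
  obtains F where "F \<in> faces E" "x \<in> verts F" "closure F \<inter> sphere u s \<noteq> {}"
proof -
  obtain z where z: "z \<in> closed_segment x y" "z \<in> sphere u s" using segment_meets_sphere[OF d] .
  obtain F where F: "F \<in> faces E" "side F x y" using edge_face[OF xy] .
  have "z \<in> closure F" using z side_frontier[OF F(2)] by (auto simp: frontier_def)
  then show ?thesis using that[OF F(1)] side_verts[OF F] z(2) by blast
qed

text \<open>Averaging over the radius of the circle, as in the Courant-Lebesgue lemma.\<close>

lemma circle_with_small_osc:
  assumes u: "u \<in> V" "rad u \<le> t" and carr: "cball u ((2 + 2 * K) * t) \<subseteq> carr E"
  obtains s where "t \<le> s" "s \<le> 2 * t"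
    "(\<Sum>F | F \<in> faces E \<and> closure F \<inter> sphere u s \<noteq> {}. osc f F)\<^sup>2
      \<le> 256 * K ^ 3 * (2 + 2 * K)\<^sup>2 * (\<Sum>F | F \<in> faces E \<and> closure F \<inter> (cball u (2 * t) - ball u t) \<noteq> {}. (osc f F)\<^sup>2)"
proof -
  define S where "S = {F \<in> faces E. closure F \<inter> (cball u (2 * t) - ball u t) \<noteq> {}}"
  have K1: "K \<ge> 1" using K_bounds(1) .
  have t: "t > 0" using u rad_pos[OF u(1)] by linarith
  have "2 * t \<le> (2 + 2 * K) * t" using K1 t by (intro mult_right_mono) auto
  then have carr2: "cball u (2 * t) \<subseteq> carr E" using carr by (auto simp: subset_iff)
  have finS: "finite S"
    unfolding S_def using carr2 by (intro finite_faces_meeting_compact compact_diff) auto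
  define A where "A = V_euc V u ((2 + 2 * K) * t)"
  have A: "finite A" "A \<subseteq> V" using finite_V_euc[OF carr] by (auto simp: A_def V_euc_def)
  have "\<forall>F\<in>S. \<exists>v. v \<in> verts F" using verts_nonempty unfolding S_def by blast
  from bchoice[OF this] obtain p where p: "\<And>F. F \<in> S \<Longrightarrow> p F \<in> verts F" by blast
  have pc: "p F \<in> closure F" "p F \<in> V" if "F \<in> S" for F using p[OF that] by (auto simp: verts_def frontier_def)
  have pA: "p F \<in> A \<and> F \<in> faces_at (p F)" if F: "F \<in> S" for F
  proof -
    obtain z where z: "z \<in> closure F" "dist z u \<le> 2 * t" "F \<in> faces E"
      using F by (auto simp: S_def dist_commute)
    have "dist z (p F) \<le> K * (2 * t)"
      using face_diam_le_dist_K[OF z(3) u(1) _ z(1,2,1) pc(1)[OF F]] u(2) t by simp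
    then have "dist u (p F) \<le> (2 + 2 * K) * t"
      using z(2) dist_triangle[of u "p F" z] by (simp add: dist_commute algebra_simps)
    then show ?thesis using pc[OF F] z(3) by (auto simp: A_def V_euc_def faces_at_def)
  qed
  define d where "d = (\<lambda>F. K * rad (p F))"
  define w where "w = osc f"
  have w0: "w F \<ge> 0" for F using osc_nonneg by (simp add: w_def)
  have d0: "d F > 0" if "F \<in> S" for F using rad_pos pc(2)[OF that] K1 by (simp add: d_def)
  define W where "W = (\<lambda>s. \<Sum>F | F \<in> faces E \<and> closure F \<inter> sphere u s \<noteq> {}. w F)"
  \<comment> \<open>Contains the radii of all circles about \<open>u\<close> that meet
    \<open>F\<close>, and has length \<open>2 * d F\<close>.\<close>
  define I where "I = (\<lambda>F. {dist (p F) u - d F .. dist (p F) u + d F})"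
  have W_le: "W s \<le> (\<Sum>F\<in>S. w F * indicator (I F) s)" if s: "s \<in> {t..2 * t}" for s
  proof -
    have sub: "{F \<in> faces E. closure F \<inter> sphere u s \<noteq> {}} \<subseteq> S" using s by (force simp: S_def)
    have "W s = (\<Sum>F | F \<in> faces E \<and> closure F \<inter> sphere u s \<noteq> {}. w F * indicator (I F) s)"
      unfolding W_def
    proof (intro sum.cong refl)
      fix F assume F: "F \<in> {F \<in> faces E. closure F \<inter> sphere u s \<noteq> {}}"
      then obtain z where "z \<in> closure F \<inter> sphere u s" by blast
      then have z: "z \<in> closure F" "dist u z = s" "F \<in> faces E" using F by auto
      have FS: "F \<in> S" using F sub by blast
      have "dist z (p F) \<le> d F"
        unfolding d_def using face_diam_rad_K[OF z(3) p[OF FS] z(1) pc(1)[OF FS]] .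
      then have "\<bar>s - dist (p F) u\<bar> \<le> d F"
        using z(2) dist_triangle[of u z "p F"] dist_triangle[of u "p F" z] by (simp add: dist_commute)
      then have "s \<in> I F" by (auto simp: I_def)
      then show "w F = w F * indicator (I F) s" by simp
    qed
    also have "\<dots> \<le> (\<Sum>F\<in>S. w F * indicator (I F) s)"
      using sub finS w0 by (intro sum_mono2) auto
    finally show ?thesis .
  qed
  define T where "T = (\<Sum>F\<in>S. w F * (2 * d F))"
  have T0: "T \<ge> 0" unfolding T_def using w0 d0 by (intro sum_nonneg) (auto simp: less_imp_le)
  \<comment> \<open>Averaging over radii, which range over an interval of length \<open>t\<close>:
    if all \<open>W s\<close> were larger, the constant \<open>2 * T / t\<close> would integrate to
    \<open>2 * T \<le> T\<close>. The case \<open>T = 0\<close>, where all the oscillations vanish,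
    is separate.\<close>
  have "\<exists>s\<in>{t..2 * t}. W s \<le> 2 * T / t"
  proof (cases "T = 0")
    case True
    then have "\<forall>F\<in>S. w F * (2 * d F) = 0"
      unfolding T_def using finS w0 d0 by (subst (asm) sum_nonneg_eq_0_iff) (auto simp: less_imp_le)
    then have "\<forall>F\<in>S. w F = 0" using d0 by force
    then have "W t \<le> 0" using W_le[of t] t by simp
    then show ?thesis using True t by (intro bexI[of _ t]) auto
  next
    case False
    show ?thesis
    proof (rule ccontr)
      assume neg: "\<not> ?thesis"
      have pw: "ennreal (2 * T / t) * indicator {t..2 * t} s \<le> (\<Sum>F\<in>S. ennreal (w F) * indicator (I F) s)" for s
      proof (cases "s \<in> {t..2 * t}")
        case True
        then have "2 * T / t \<le> (\<Sum>F\<in>S. w F * indicator (I F) s)" using neg W_le[OF True] by force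
        then have "ennreal (2 * T / t) \<le> ennreal (\<Sum>F\<in>S. w F * indicator (I F) s)" by (rule ennreal_leI)
        also have "\<dots> = (\<Sum>F\<in>S. ennreal (w F * indicator (I F) s))"
          using w0 by (intro sum_ennreal[symmetric]) auto
        also have "\<dots> = (\<Sum>F\<in>S. ennreal (w F) * indicator (I F) s)"
          by (intro sum.cong refl) (simp add: indicator_def)
        finally show ?thesis using True by simp
      qed simp
      have "ennreal (2 * T) = ennreal (2 * T / t) * ennreal t"
        using t T0 by (simp add: ennreal_mult[symmetric])
      also have "\<dots> = (\<integral>\<^sup>+s. ennreal (2 * T / t) * indicator {t..2 * t} s \<partial>lborel)"
        using t by (simp add: nn_integral_cmult_indicator)
      also have "\<dots> \<le> (\<integral>\<^sup>+s. (\<Sum>F\<in>S. ennreal (w F) * indicator (I F) s) \<partial>lborel)"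
        using pw by (intro nn_integral_mono)
      also have "\<dots> = (\<Sum>F\<in>S. ennreal (w F) * emeasure lborel (I F))"
        unfolding I_def by (simp add: nn_integral_sum nn_integral_cmult_indicator)
      also have "\<dots> = (\<Sum>F\<in>S. ennreal (w F * (2 * d F)))"
        using w0 d0 by (intro sum.cong refl) (simp add: I_def ennreal_mult less_imp_le)
      also have "\<dots> = ennreal T"
        unfolding T_def using w0 d0 by (intro sum_ennreal) (auto simp: less_imp_le)
      finally show False using T0 False by (simp add: ennreal_le_iff)
    qed
  qed
  then obtain s where s: "s \<in> {t..2 * t}" "W s \<le> 2 * T / t" by blast
  have W0: "W s \<ge> 0" unfolding W_def using w0 by (intro sum_nonneg) auto
  have "rad u \<le> (2 + 2 * K) * t" using u(2) K1 t by (smt (verit) mult_le_cancel_right1)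
  then have mA: "(\<Sum>v\<in>A. m v) \<le> 16 * ((2 + 2 * K) * t)\<^sup>2"
    using sum_m_V_euc[OF u(1) _ A(1)] by (simp add: A_def)
  have "(W s * t)\<^sup>2 \<le> (2 * T)\<^sup>2" using s(2) W0 t by (intro power_mono) (auto simp: field_simps)
  also have "\<dots> = 16 * (\<Sum>F\<in>S. w F * d F)\<^sup>2"
  proof -
    have "T = 2 * (\<Sum>F\<in>S. w F * d F)" by (simp add: T_def sum_distrib_left mult_ac)
    then show ?thesis by (simp add: power_mult_distrib)
  qed
  also have "\<dots> \<le> 16 * ((\<Sum>F\<in>S. (w F)\<^sup>2) * (\<Sum>F\<in>S. (d F)\<^sup>2))"
    using Cauchy_Schwarz_ineq_sum[of w d S] by simp
  also have "\<dots> \<le> 16 * ((\<Sum>F\<in>S. (w F)\<^sup>2) * (K ^ 3 * (16 * ((2 + 2 * K) * t)\<^sup>2)))"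
  proof -
    have "(\<Sum>F\<in>S. (d F)\<^sup>2) \<le> K ^ 3 * (\<Sum>v\<in>A. m v)"
      unfolding d_def using sum_rad_faces[OF finS A pA] by blast
    also have "\<dots> \<le> K ^ 3 * (16 * ((2 + 2 * K) * t)\<^sup>2)" using mA K1 by (intro mult_left_mono) auto
    finally show ?thesis by (intro mult_left_mono) (auto intro: sum_nonneg)
  qed
  also have "\<dots> = (256 * K ^ 3 * (2 + 2 * K)\<^sup>2 * (\<Sum>F\<in>S. (w F)\<^sup>2)) * t\<^sup>2"
    unfolding power_mult_distrib by (simp only: mult_ac)
  finally have "(W s)\<^sup>2 * t\<^sup>2 \<le> (256 * K ^ 3 * (2 + 2 * K)\<^sup>2 * (\<Sum>F\<in>S. (w F)\<^sup>2)) * t\<^sup>2"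
    by (simp add: power_mult_distrib)
  then have "(W s)\<^sup>2 \<le> 256 * K ^ 3 * (2 + 2 * K)\<^sup>2 * (\<Sum>F\<in>S. (w F)\<^sup>2)"
    using t by simp
  then show ?thesis using that[of s] s(1) by (simp add: W_def w_def S_def)
qed

end

section \<open>The Green function with pole u\<close>

context dirichlet_problem
begin

context
  fixes u :: complex and r :: real and g :: "complex \<Rightarrow> real"
  assumes u: "u \<in> V" and B_eq: "B = V_euc V u r" and carr: "cball u r \<subseteq> carr E"
    and ur: "rad u \<le> r"
    and g_nonneg: "\<And>x. g x \<ge> 0" and g_out: "\<And>x. x \<notin> B \<Longrightarrow> g x = 0"
    and Lap_g: "\<And>x. x \<in> B \<Longrightarrow> Lap g x = (if x = u then 1 else 0)"
begin

lemma r_pos: "r > 0" and u_B: "u \<in> B"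
  using ur rad_pos[OF u] u by (auto simp: B_eq V_euc_def)

text \<open>The reproducing property of the Green function.\<close>

lemma En_green: "(\<And>x. x \<notin> B \<Longrightarrow> \<phi> x = 0) \<Longrightarrow> En g \<phi> = \<phi> u"
  using En_eq[of \<phi> g] Lap_g u_B B by (simp add: if_distrib sum.delta cong: if_cong sum.cong)

definition g_cut :: "real \<Rightarrow> complex \<Rightarrow> real" where "g_cut k x = min (g x) k"

text \<open>Truncation shrinks the increments, so the energy is at most
  \<open>En g (g_cut k)\<close>, which the reproducing property evaluates.\<close>

lemma En_cut:
  assumes "k \<ge> 0"
  shows "En (g_cut k) (g_cut k) \<le> k"
proof -
  have "En (g_cut k) (g_cut k) \<le> En g (g_cut k)"
  proof (rule En_mono)
    fix x y
    consider "g x \<le> k" "g y \<le> k" | "g x \<le> k" "g y > k" | "g x > k" "g y \<le> k" | "g x > k" "g y > k"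
      by linarith
    then show "(g_cut k x - g_cut k y) * (g_cut k x - g_cut k y) \<le> (g x - g y) * (g_cut k x - g_cut k y)"
    proof cases
      case 2
      then show ?thesis by (intro mult_right_mono_neg) (auto simp: g_cut_def)
    next
      case 3
      then show ?thesis by (intro mult_right_mono) (auto simp: g_cut_def)
    qed (auto simp: g_cut_def)
  qed
  also have "\<dots> = g_cut k u" using assms g_out by (intro En_green) (auto simp: g_cut_def)
  also have "\<dots> \<le> k" by (simp add: g_cut_def)
  finally show ?thesis .
qed

text \<open>A cutoff function \<open>\<phi>\<close> that is 1 within \<open>r / 2\<close> of
  \<open>u\<close> has \<open>En g \<phi> = 1\<close>. If the level set stayed within
  \<open>\<theta> * r\<close>, then \<open>\<phi>\<close> would be constant on all edges at it, by
  the choice of \<open>\<theta>\<close>, and \<open>g\<close> could be replaced by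
  \<open>g_cut k0\<close>. The Cauchy-Schwarz inequality would then give
  \<open>1 \<le> k0 * (64 * K ^ 4)\<close>, which is 1/2 by the choice of \<open>k0\<close>.\<close>

lemma level_set_reaches:
  assumes ur': "rad u \<le> \<theta> * r"
  shows "\<exists>x\<in>B. g x \<ge> k0 \<and> dist x u > \<theta> * r"
proof (rule ccontr)
  assume neg: "\<not> ?thesis"
  have K1: "K \<ge> 1" using K_bounds(1) .
  have r: "r > 0" by (rule r_pos)
  define ch where "ch = (\<lambda>x. max 0 (min 1 (2 - 2 * dist x u / r)))"
  have chi_out: "ch x = 0" if "dist x u \<ge> r" for x using that r by (auto simp: ch_def field_simps)
  have chi_in: "ch x = 1" if "dist x u \<le> r / 2" for x using that r by (auto simp: ch_def field_simps)
  have chi_B: "x \<in> V \<Longrightarrow> x \<notin> B \<Longrightarrow> ch x = 0" for x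
    using chi_out[of x] by (auto simp: B_eq V_euc_def dist_commute)
  \<comment> \<open>At the vertices this agrees with \<open>ch\<close>; the restriction makes it
    vanish also at the points of the ball that are not vertices, as \<open>En_green\<close>
    demands.\<close>
  define \<phi> where "\<phi> = (\<lambda>x. if x \<in> B then ch x else 0)"
  have phi: "\<phi> x = ch x" if "x \<in> V" for x using chi_B that by (auto simp: \<phi>_def)
  have lip: "\<bar>ch x - ch y\<bar> \<le> 2 / r * dist x y" for x y
  proof -
    have "\<bar>dist x u - dist y u\<bar> \<le> dist x y"
      using dist_triangle[of x u y] dist_triangle[of y u x] by (simp add: dist_commute)
    then have "2 / r * \<bar>dist x u - dist y u\<bar> \<le> 2 / r * dist x y" using r by (intro mult_left_mono) auto
    moreover have "\<bar>ch x - ch y\<bar> \<le> \<bar>2 * dist x u / r - 2 * dist y u / r\<bar>"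
      unfolding ch_def by linarith
    moreover have "\<bar>2 * dist x u / r - 2 * dist y u / r\<bar> = 2 / r * \<bar>dist x u - dist y u\<bar>"
    proof -
      have "2 * dist x u / r - 2 * dist y u / r = 2 / r * (dist x u - dist y u)"
        by (simp add: right_diff_distrib)
      then show ?thesis using r by (simp only: abs_mult) simp
    qed
    ultimately show ?thesis by linarith
  qed
  have E_chi: "En \<phi> \<phi> \<le> 64 * K ^ 4"
  proof -
    let ?e = "\<lambda>x y. c x y * ((\<phi> x - \<phi> y) * (\<phi> x - \<phi> y))"
    have "2 * En \<phi> \<phi> = (\<Sum>x\<in>N. \<Sum>y\<in>N. ?e x y)" by (simp add: En_def)
    \<comment> \<open>An edge on which \<open>\<phi>\<close> varies has an end in \<open>B\<close>
      and may be counted from there; the resulting factor 2 cancels the one in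
      \<open>En\<close>.\<close>
    also have "\<dots> \<le> (\<Sum>x\<in>N. \<Sum>y\<in>N. (if x \<in> B then ?e x y else 0) + (if y \<in> B then ?e x y else 0))"
      using c_nonneg by (intro sum_mono) (auto simp: \<phi>_def)
    also have "\<dots> = (\<Sum>x\<in>N. \<Sum>y\<in>N. if x \<in> B then ?e x y else 0) + (\<Sum>x\<in>N. \<Sum>y\<in>N. if y \<in> B then ?e x y else 0)"
      by (simp add: sum.distrib)
    also have "(\<Sum>x\<in>N. \<Sum>y\<in>N. if y \<in> B then ?e x y else 0) = (\<Sum>y\<in>N. \<Sum>x\<in>N. if y \<in> B then ?e x y else 0)"
      by (rule sum.swap)
    also have "\<dots> = (\<Sum>x\<in>N. \<Sum>y\<in>N. if x \<in> B then ?e x y else 0)"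
    proof (intro sum.cong refl if_cong)
      fix x y
      have "(\<phi> y - \<phi> x) * (\<phi> y - \<phi> x) = (\<phi> x - \<phi> y) * (\<phi> x - \<phi> y)" by (simp add: algebra_simps)
      then show "?e y x = ?e x y" by (simp add: c_sym)
    qed
    finally have "En \<phi> \<phi> \<le> (\<Sum>x\<in>N. \<Sum>y\<in>N. if x \<in> B then ?e x y else 0)" by simp
    also have "\<dots> = (\<Sum>x\<in>B. \<Sum>y\<in>N. ?e x y)"
      using N by (intro sum.mono_neutral_cong_right) auto
    also have "\<dots> \<le> (\<Sum>x\<in>B. 4 * K ^ 4 / r\<^sup>2 * m x)"
    proof (rule sum_mono)
      fix x assume x: "x \<in> B"
      then have xV: "x \<in> V" using B by blast
      have "(\<Sum>y\<in>N. ?e x y) = (\<Sum>y\<in>nb x. ?e x y)"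
        using N x by (intro sum.mono_neutral_right) (auto simp: c_def nb_iff)
      also have "\<dots> \<le> (\<Sum>y\<in>nb x. K * (2 / r * (K * rad x))\<^sup>2)"
      proof (rule sum_mono)
        fix y assume y: "y \<in> nb x"
        have yV: "y \<in> V" using y nb_V by blast
        have "dist x y \<le> K * rad x" using edge_le_rad_K y by (simp add: nb_iff)
        then have "2 / r * dist x y \<le> 2 / r * (K * rad x)" using r by (intro mult_left_mono) auto
        then have "\<bar>\<phi> x - \<phi> y\<bar> \<le> 2 / r * (K * rad x)" using lip[of x y] phi xV yV by simp
        then have "(\<phi> x - \<phi> y)\<^sup>2 \<le> (2 / r * (K * rad x))\<^sup>2" by (metis abs_ge_zero power2_abs power_mono)
        then show "?e x y \<le> K * (2 / r * (K * rad x))\<^sup>2"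
          using c_bounds(2) c_nonneg K1 by (auto simp: power2_eq_square[of "\<phi> x - \<phi> y", symmetric] intro!: mult_mono)
      qed
      also have "\<dots> = real (card (nb x)) * (K * (2 / r * (K * rad x))\<^sup>2)" by simp
      also have "\<dots> \<le> K * (K * (2 / r * (K * rad x))\<^sup>2)"
        using degree_K[OF xV] K1 by (intro mult_right_mono) auto
      also have "\<dots> = 4 * K ^ 4 / r\<^sup>2 * m x"
        by (simp add: power_mult_distrib power_divide power2_eq_square power4_eq_xxxx)
      finally show "(\<Sum>y\<in>N. ?e x y) \<le> 4 * K ^ 4 / r\<^sup>2 * m x" .
    qed
    also have "\<dots> = 4 * K ^ 4 / r\<^sup>2 * (\<Sum>x\<in>B. m x)" by (simp add: sum_distrib_left)
    also have "\<dots> \<le> 4 * K ^ 4 / r\<^sup>2 * (16 * r\<^sup>2)"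
      using sum_m_V_euc[OF u ur B(2)] B_eq K1 by (intro mult_left_mono) auto
    also have "\<dots> = 64 * K ^ 4" using r by simp
    finally show ?thesis .
  qed
  have same: "(g x - g y) * (\<phi> x - \<phi> y) = (g_cut k0 x - g_cut k0 y) * (\<phi> x - \<phi> y)" if e: "{x, y} \<in> E" for x y
  proof -
    have xy: "x \<in> V" "y \<in> V" using edge_ends[OF e] by auto
    have near: "\<phi> x = \<phi> y" if e: "{x, y} \<in> E" and x: "g x \<ge> k0" for x y
    proof -
      have "x \<in> B" by (rule ccontr) (use x k0 g_out[of x] in auto)
      then have xu: "dist x u \<le> \<theta> * r" using neg x by force
      have "rad x \<le> \<theta> * r"
        using rad_le_radius[OF u ur'] xu edge_ends(1)[OF e] by (auto simp: V_euc_def dist_commute)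
      then have "K * rad x \<le> K * (\<theta> * r)" using K1 by (intro mult_left_mono) auto
      then have "dist y u \<le> (1 + K) * (\<theta> * r)"
        using edge_le_rad_K[OF e] xu dist_triangle[of y u x] by (simp add: dist_commute algebra_simps)
      also have "\<dots> = r / 2" using K1 by (simp add: \<theta>_def field_simps)
      finally have yu: "dist y u \<le> r / 2" .
      have "\<theta> * r \<le> 1 / 2 * r" using K1 r by (intro mult_right_mono) (auto simp: \<theta>_def field_simps)
      then have "dist x u \<le> r / 2" using xu by simp
      then show ?thesis using phi chi_in yu edge_ends[OF e] by metis
    qed
    show ?thesis
    proof (cases "g x \<ge> k0 \<or> g y \<ge> k0")
      case True
      then have "\<phi> x = \<phi> y" using near[of x y] near[of y x] e by (auto simp: insert_commute)
      then show ?thesis by simp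
    next
      case False
      then show ?thesis by (simp add: g_cut_def)
    qed
  qed
  have "En g \<phi> = \<phi> u" by (intro En_green) (auto simp: \<phi>_def)
  also have "\<dots> = 1" using phi[OF u] chi_in[of u] r by simp
  finally have "En g \<phi> = 1" .
  moreover have "En g \<phi> = En (g_cut k0) \<phi>"
    unfolding En_def using same by (intro arg_cong2[where f = "(/)"] sum.cong refl) (auto simp: c_def)
  ultimately have "1 \<le> En (g_cut k0) (g_cut k0) * En \<phi> \<phi>"
    using En_Cauchy_Schwarz[of "g_cut k0" \<phi>] by simp
  also have "\<dots> \<le> k0 * (64 * K ^ 4)"
    using En_cut[of k0] E_chi k0 En_nonneg by (intro mult_mono) auto
  also have "\<dots> = 1 / 2" using K1 by (simp add: k0_def)
  finally show False by simp
qed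

text \<open>On a part of the level set that is not connected to the pole, \<open>- g\<close> would
  be harmonic and smaller than at all neighbours outside of this part.\<close>

lemma level_set_connected:
  assumes x: "x \<in> B" "g x \<ge> k" and k: "k > 0"
  shows "(\<lambda>x y. {x, y} \<in> E \<and> g x \<ge> k \<and> g y \<ge> k)\<^sup>*\<^sup>* u x"
proof -
  let ?R = "\<lambda>x y. {x, y} \<in> E \<and> g x \<ge> k \<and> g y \<ge> k"
  define A where "A = {x \<in> B. g x \<ge> k \<and> \<not> ?R\<^sup>*\<^sup>* u x}"
  have "A = {}"
  proof (rule minimum_principle[where f = "\<lambda>x. - g x"])
    show "A \<subseteq> V" "finite A" using B by (auto simp: A_def)
    fix x assume xA: "x \<in> A"
    then have "x \<noteq> u" by (auto simp: A_def)
    then have "Lap g x = 0" using Lap_g xA by (simp add: A_def)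
    moreover have "Lap (\<lambda>x. - g x) x = - Lap g x"
      unfolding Lap_def sum_negf[symmetric] by (intro sum.cong refl) (simp add: algebra_simps)
    ultimately show "Lap (\<lambda>x. - g x) x \<ge> 0" by simp
    fix y assume y: "y \<in> V - A" "{x, y} \<in> E"
    have "\<not> g y \<ge> k"
    proof
      assume gy: "g y \<ge> k"
      then have "y \<in> B" using g_out[of y] k by force
      then have "?R\<^sup>*\<^sup>* u y" using y gy by (simp add: A_def)
      moreover have "?R y x" using y xA gy by (simp add: A_def insert_commute)
      ultimately have "?R\<^sup>*\<^sup>* u x" by (rule rtranclp.rtrancl_into_rtrancl)
      then show False using xA by (simp add: A_def)
    qed
    then show "- g x < - g y" using xA by (simp add: A_def)
  qed
  then show ?thesis using x by (auto simp: A_def)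
qed

lemma level_set_crosses:
  assumes ur': "rad u \<le> \<theta> * r" and s: "0 \<le> s" "s < \<theta> * r"
  obtains x y where "{x, y} \<in> E" "g x \<ge> k0" "g y \<ge> k0" "dist x u \<le> s" "s < dist y u"
proof -
  let ?R = "\<lambda>x y. {x, y} \<in> E \<and> g x \<ge> k0 \<and> g y \<ge> k0"
  obtain v where v: "v \<in> B" "g v \<ge> k0" "dist v u > \<theta> * r" using level_set_reaches[OF ur'] by blast
  have "?R\<^sup>*\<^sup>* u v" using level_set_connected[OF v(1,2) k0] .
  then have "dist v u > s \<longrightarrow> (\<exists>x y. ?R x y \<and> dist x u \<le> s \<and> s < dist y u)"
  proof (induction rule: rtranclp_induct)
    case base
    then show ?case using s by simp
  next
    case (step y z)
    then show ?case by (cases "dist y u > s") force+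
  qed
  then show ?thesis using that v(3) s by auto
qed

text \<open>An edge that leaves the disc crosses the circle, so its inner end is a vertex of a face
  that meets the circle. Hence the vertices of the disc with \<open>g\<close> below \<open>k\<close>
  have all their other neighbours in the disc, with larger values.\<close>

lemma green_ge_inside:
  assumes s: "s \<le> r" and ge: "\<And>F x. F \<in> faces E \<Longrightarrow> closure F \<inter> sphere u s \<noteq> {} \<Longrightarrow> x \<in> verts F \<Longrightarrow> g x \<ge> k"
    and x: "x \<in> V" "dist x u \<le> s"
  shows "g x \<ge> k"
proof -
  define A where "A = {x \<in> V. dist x u \<le> s \<and> g x < k}"
  have AB: "A \<subseteq> B" using s by (auto simp: A_def B_eq V_euc_def dist_commute)
  have "A = {}"
  proof (rule minimum_principle[where f = g])
    show "A \<subseteq> V" "finite A" using AB B finite_subset by blast+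
    fix x assume xA: "x \<in> A"
    then show "Lap g x \<ge> 0" using Lap_g AB by auto
    fix y assume y: "y \<in> V - A" "{x, y} \<in> E"
    have "dist y u \<le> s"
    proof (rule ccontr)
      assume "\<not> dist y u \<le> s"
      then obtain F where "F \<in> faces E" "x \<in> verts F" "closure F \<inter> sphere u s \<noteq> {}"
        using edge_meets_sphere[OF y(2), of u s] xA by (auto simp: A_def)
      then show False using ge xA by (force simp: A_def)
    qed
    then show "g x < g y" using y xA by (auto simp: A_def)
  qed
  then show ?thesis using x by (auto simp: A_def)
qed

lemma green_mass:
  assumes big: "(1 + K) * rad u \<le> \<Theta> * r"
  shows "c2 * r\<^sup>2 \<le> (\<Sum>x\<in>B. m x * g x)"
proof -
  have K1: "K \<ge> 1" using K_bounds(1) .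
  have r: "r > 0" by (rule r_pos)
  have lam: "lam0 > 1" using K1 by (simp add: lam0_def)
  have th: "\<theta> > 0" "\<theta> \<le> 1 / 2" using K1 by (auto simp: \<theta>_def field_simps)
  \<comment> \<open>The annuli lie between the radii \<open>t j\<close> and \<open>2 * t j\<close>.
    The factor 1/4 keeps them below \<open>\<theta> * r\<close>, and the disc of radius
    \<open>(2 + 2 * K) * t j\<close> inside the carrier.\<close>
  define t where "t = (\<lambda>j. \<theta> * r / 4 / lam0 ^ j)"
  have t_pos: "t j > 0" for j using th r lam by (simp add: t_def)
  have t_le: "t j \<le> \<theta> * r / 4" for j
  proof -
    have "\<theta> * r / 4 / lam0 ^ j \<le> \<theta> * r / 4 / 1"
      using th r lam by (intro divide_left_mono) (auto simp: one_le_power)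
    then show ?thesis by (simp add: t_def)
  qed
  have t_n0: "t n0 = \<Theta> * r" by (simp add: t_def \<Theta>_def)
  have t_ge: "t n0 \<le> t j" if "j < n0" for j
    unfolding t_def using that lam th r by (intro divide_left_mono power_increasing) auto
  have ru: "(1 + K) * rad u \<le> t j" if "j < n0" for j using big t_ge[OF that] t_n0 by linarith
  have "rad u \<le> (1 + K) * rad u" using K1 rad_pos[OF u] by (simp add: mult_le_cancel_right1)
  then have ru1: "rad u \<le> t j" if "j < n0" for j using ru[OF that] by linarith
  have ur': "rad u \<le> \<theta> * r"
    using \<open>rad u \<le> (1 + K) * rad u\<close> big t_le[of n0] t_n0 th r mult_pos_pos[OF th(1) r] by linarith
  have t_lam: "lam0 * t j \<le> t i" if "i < j" for i j
  proof -
    have "lam0 * lam0 ^ i \<le> lam0 ^ j" using power_increasing[of "Suc i" j lam0] that lam by simp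
    then have "\<theta> * r / 4 / lam0 ^ j \<le> \<theta> * r / 4 / (lam0 * lam0 ^ i)"
      using lam th r by (intro divide_left_mono) auto
    then have "lam0 * (\<theta> * r / 4 / lam0 ^ j) \<le> lam0 * (\<theta> * r / 4 / (lam0 * lam0 ^ i))"
      using lam by (intro mult_left_mono) auto
    then show ?thesis using lam by (simp add: t_def)
  qed
  have t_carr: "cball u ((2 + 2 * K) * t j) \<subseteq> carr E" for j
  proof -
    have "(2 + 2 * K) * t j \<le> (2 + 2 * K) * (\<theta> * r / 4)" using t_le K1 by (intro mult_left_mono) auto
    also have "\<dots> = r / 4" using K1 by (simp add: \<theta>_def field_simps)
    finally show ?thesis using carr r by (auto simp: subset_iff)
  qed
  define f where "f = g_cut k0"
  define S where "S = (\<lambda>j. {F \<in> faces E. closure F \<inter> (cball u (2 * t j) - ball u (t j)) \<noteq> {}})"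
  have finS: "finite (S j)" for j
  proof -
    have "2 * t j \<le> (2 + 2 * K) * t j" using K1 t_pos[of j] by (intro mult_right_mono) auto
    then have "cball u (2 * t j) - ball u (t j) \<subseteq> carr E" using t_carr[of j] by (auto simp: subset_iff)
    then show ?thesis unfolding S_def by (intro finite_faces_meeting_compact compact_diff) auto
  qed
  have disj: "S i \<inter> S j = {}" if ij: "i < j" "j < n0" for i j
  proof (rule ccontr)
    assume "S i \<inter> S j \<noteq> {}"
    then obtain F x y where F: "F \<in> faces E" and x: "x \<in> closure F" "t i \<le> dist x u"
      and y: "y \<in> closure F" "dist y u \<le> 2 * t j"
      by (auto simp: S_def dist_commute not_less)
    have "rad u \<le> 2 * t j" using ru1[OF ij(2)] t_pos[of j] by linarith
    then have "dist x y \<le> K * (2 * t j)" using face_diam_le_dist_K[OF F u _ y x(1) y(1)] by blast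
    then have "dist x u \<le> (2 + 2 * K) * t j" using y(2) dist_triangle[of x u y] by (simp add: algebra_simps)
    also have "\<dots> < lam0 * t j" using t_pos[of j] K1 by (intro mult_strict_right_mono) (auto simp: lam0_def)
    also have "\<dots> \<le> t i" using t_lam[OF ij(1)] .
    finally show False using x(2) by simp
  qed
  have "(\<Sum>j<n0. \<Sum>F\<in>S j. (osc f F)\<^sup>2) = (\<Sum>F\<in>(\<Union>j<n0. S j). (osc f F)\<^sup>2)"
    using finS disj by (intro sum.UNION_disjoint[symmetric]) (auto simp: linorder_neq_iff)
  also have "\<dots> \<le> 2 * K ^ 3 * En f f"
    using finS g_out k0 by (intro sum_osc_sq_le_energy) (auto simp: S_def f_def g_cut_def)
  also have "\<dots> \<le> 2 * K ^ 3 * k0"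
    using En_cut[of k0] k0 K1 by (intro mult_left_mono) (auto simp: f_def)
  finally have total: "(\<Sum>j<n0. \<Sum>F\<in>S j. (osc f F)\<^sup>2) \<le> 2 * K ^ 3 * k0" .
  have n0: "n0 > 0" "2048 * K ^ 6 * (2 + 2 * K)\<^sup>2 / k0 \<le> real n0"
    unfolding n0_def by linarith+
  have "\<exists>j<n0. (\<Sum>F\<in>S j. (osc f F)\<^sup>2) \<le> 2 * K ^ 3 * k0 / n0"
  proof (rule ccontr)
    assume neg: "\<not> ?thesis"
    have "(\<Sum>j<n0. 2 * K ^ 3 * k0 / n0) < (\<Sum>j<n0. \<Sum>F\<in>S j. (osc f F)\<^sup>2)"
      using neg n0(1) by (intro sum_strict_mono) (auto simp: not_le)
    then show False using total n0(1) by simp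
  qed
  then obtain j where j: "j < n0" "(\<Sum>F\<in>S j. (osc f F)\<^sup>2) \<le> 2 * K ^ 3 * k0 / n0" by blast
  obtain s where s: "t j \<le> s" "s \<le> 2 * t j" and
    W: "(\<Sum>F | F \<in> faces E \<and> closure F \<inter> sphere u s \<noteq> {}. osc f F)\<^sup>2
      \<le> 256 * K ^ 3 * (2 + 2 * K)\<^sup>2 * (\<Sum>F\<in>S j. (osc f F)\<^sup>2)"
    using circle_with_small_osc[OF u ru1[OF j(1)] t_carr] unfolding S_def by blast
  let ?W = "\<Sum>F | F \<in> faces E \<and> closure F \<inter> sphere u s \<noteq> {}. osc f F"
  have "?W\<^sup>2 \<le> 256 * K ^ 3 * (2 + 2 * K)\<^sup>2 * (2 * K ^ 3 * k0 / n0)"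
    using j(2) K1 by (intro order_trans[OF W] mult_left_mono) auto
  also have "\<dots> = 512 * K ^ 6 * (2 + 2 * K)\<^sup>2 * k0 / n0"
    by (simp add: mult_ac flip: power_add)
  \<comment> \<open>The constant 2048 in \<open>n0\<close> is 4 times 512, and 512 collects the
    constants of \<open>circle_with_small_osc\<close> and of the total energy.\<close>
  also have "\<dots> \<le> (k0 / 2)\<^sup>2"
  proof -
    have "512 * X * k0 / n0 \<le> (k0 / 2)\<^sup>2" if X: "2048 * X / k0 \<le> real n0" for X
    proof -
      have "2048 * X \<le> real n0 * k0" using X k0 by (simp add: pos_divide_le_eq)
      then have "512 * X * k0 \<le> real n0 * k0 / 4 * k0" using k0 by (intro mult_right_mono) auto
      then show ?thesis using n0(1) by (simp add: pos_divide_le_eq power2_eq_square mult_ac)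
    qed
    from this[of "K ^ 6 * (2 + 2 * K)\<^sup>2"] show ?thesis using n0(2) by (simp only: mult.assoc)
  qed
  finally have W2: "?W \<le> k0 / 2" by (rule power2_le_imp_le) (use k0 in simp)
  have tr: "2 * t j < \<theta> * r" using t_le[of j] th r mult_pos_pos[OF th(1) r] by linarith
  have s0: "0 \<le> s" "s < \<theta> * r" using s t_pos[of j] tr by linarith+
  have "\<theta> * r \<le> 1 / 2 * r" using th r by (intro mult_right_mono) auto
  then have sr: "s \<le> r" using s0 r by linarith
  obtain x0 y0 where xy: "{x0, y0} \<in> E" "g x0 \<ge> k0" "dist x0 u \<le> s" "s < dist y0 u"
    using level_set_crosses[OF ur' s0] by blast
  obtain F0 where F0: "F0 \<in> faces E" "x0 \<in> verts F0" "closure F0 \<inter> sphere u s \<noteq> {}"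
    using edge_meets_sphere[OF xy(1,3,4)] .
  have sph: "sphere u s \<subseteq> carr E" using carr sr by (auto simp: subset_iff)
  \<comment> \<open>The walk along the circle starts at a face with the vertex \<open>x0\<close> of
    the level set, where \<open>f\<close> has its maximal value \<open>k0\<close>; on the way it
    loses at most half of it.\<close>
  have "g x \<ge> k0 / 2" if F: "F \<in> faces E" "closure F \<inter> sphere u s \<noteq> {}" "x \<in> verts F" for F x
  proof -
    have "\<bar>f x0 - f x\<bar> \<le> ?W"
      by (rule walk_along[OF _ _ sph F0(1,3,2) F]) (auto intro: connected_sphere)
    moreover have "f x0 = k0" using xy(2) by (simp add: f_def g_cut_def)
    ultimately have "f x \<ge> k0 / 2" using W2 by linarith
    then show ?thesis by (simp add: f_def g_cut_def)
  qed
  then have inside: "g x \<ge> k0 / 2" if "x \<in> V_euc V u s" for x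
    using green_ge_inside[OF sr, of "k0 / 2" x] that by (auto simp: V_euc_def dist_commute)
  have subB: "V_euc V u s \<subseteq> B" using sr by (auto simp: B_eq V_euc_def)
  have "\<Theta> * r \<le> s" using t_ge[OF j(1)] t_n0 s(1) by linarith
  then have "\<Theta> * r / (1 + K) \<le> s / (1 + K)" using K1 by (intro divide_right_mono) auto
  then have "(\<Theta> * r / (1 + K))\<^sup>2 \<le> (s / (1 + K))\<^sup>2" using Theta r K1 by (intro power_mono) auto
  then have "(\<Theta> * r / (1 + K))\<^sup>2 / K\<^sup>2 \<le> (s / (1 + K))\<^sup>2 / K\<^sup>2" by (intro divide_right_mono) auto
  also have "\<dots> \<le> (\<Sum>v\<in>V_euc V u s. m v)"
  proof (rule sum_m_lower[OF u])
    show "rad u \<le> s / (1 + K)" using ru[OF j(1)] s(1) K1 by (simp add: pos_le_divide_eq mult.commute)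
    show "cball u s \<subseteq> carr E" using carr sr by (auto simp: subset_iff)
  qed
  finally have "k0 / 2 * ((\<Theta> * r / (1 + K))\<^sup>2 / K\<^sup>2) \<le> k0 / 2 * (\<Sum>v\<in>V_euc V u s. m v)"
    using k0 by (intro mult_left_mono) auto
  also have "\<dots> = (\<Sum>v\<in>V_euc V u s. m v * (k0 / 2))" by (simp add: sum_distrib_left mult.commute)
  also have "\<dots> \<le> (\<Sum>v\<in>V_euc V u s. m v * g v)" using inside by (intro sum_mono mult_left_mono) auto
  also have "\<dots> \<le> (\<Sum>x\<in>B. m x * g x)" using subB B g_nonneg by (intro sum_mono2) auto
  finally show ?thesis by (simp add: c2_def power_mult_distrib power_divide)
qed

end

end

section \<open>Expectations for the random walk\<close>

lemma sets_walk_law: "sets (walk_law wt E u) = sets (PiM UNIV (\<lambda>_. discrete_plane))"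
  by (simp add: walk_law_def)

lemma space_walk_law: "space (walk_law wt E u) = UNIV"
  by (simp add: walk_law_def space_PiM)

text \<open>Projection to the empty set of coordinates preserves the total mass, which is 1 for the
  marginals of the projective limit.\<close>

lemma prob_space_walk_law: "prob_space (walk_law wt E u)"
proof (rule prob_space_distrD)
  show "(\<lambda>x. restrict x {}) \<in> walk_law wt E u \<rightarrow>\<^sub>M PiM {} (\<lambda>_. discrete_plane)"
    by (subst measurable_cong_sets[OF sets_walk_law refl]) (rule measurable_restrict_subset, simp)
  have "prob_space (walk.CI wt E u {})"
    by (rule walk.PF.prob_space_P) auto
  then show "prob_space (distr (walk_law wt E u) (PiM {} (\<lambda>_. discrete_plane)) (\<lambda>x. restrict x {}))"
    unfolding walk_law_def by (subst walk.distr_lim) auto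
qed

lemma coordinate_measurable: "(\<lambda>X. X i) \<in> walk_law wt E u \<rightarrow>\<^sub>M discrete_plane"
  using measurable_component_singleton[of i UNIV "\<lambda>_. discrete_plane"]
  by (simp add: measurable_cong_sets[OF sets_walk_law refl])

lemma cylinder_sets: "{X. \<forall>i\<le>n. X i = x i} \<in> sets (walk_law wt E u)"
proof -
  have "(\<lambda>X. X i) -` {x i} \<inter> space (walk_law wt E u) \<in> sets (walk_law wt E u)" for i
    using coordinate_measurable by (rule measurable_sets) simp
  then have "(\<Inter>i\<in>{..n}. (\<lambda>X. X i) -` {x i} \<inter> space (walk_law wt E u)) \<in> sets (walk_law wt E u)"
    by (intro sets.finite_INT) auto
  also have "(\<Inter>i\<in>{..n}. (\<lambda>X. X i) -` {x i} \<inter> space (walk_law wt E u)) = {X. \<forall>i\<le>n. X i = x i}"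
    by (auto simp: space_walk_law)
  finally show ?thesis .
qed

section \<open>Finite paths and their probabilities\<close>

context weighted_graph
begin

abbreviation p :: "complex \<Rightarrow> complex \<Rightarrow> real" where "p \<equiv> walk_prob wt E"

lemma deg_eq: "deg v = (\<Sum>z\<in>nb v. wt {v, z})"
  unfolding deg_def by (intro sum.cong refl) (simp add: c_def nb_iff)

lemma p_eq: "p v x = c v x / deg v"
  by (simp add: walk_prob_def c_def deg_eq)

lemma p_nonneg: "v \<in> V \<Longrightarrow> p v x \<ge> 0"
  using deg_bounds(3)[of v] c_nonneg by (simp add: p_eq)

lemma sum_p: "v \<in> V \<Longrightarrow> (\<Sum>y\<in>nb v. p v y) = 1"
  using deg_bounds(3)[of v] by (simp add: p_eq flip: sum_divide_distrib deg_def)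

lemma pmf_step: "v \<in> V \<Longrightarrow> pmf (walk_step wt E v) x = p v x"
  using wt D by (intro pmf_walk_step finite_nb nb_nonempty) (force intro: less_le_trans[of 0 "1 / D"])+

text \<open>Paths are extended by \<open>0\<close> after time \<open>n\<close>, so that their first \<open>n + 1\<close> vertices determine them.\<close>

primrec paths :: "complex \<Rightarrow> nat \<Rightarrow> (nat \<Rightarrow> complex) set" where
  "paths u 0 = {(\<lambda>_. 0)(0 := u)}"
| "paths u (Suc n) = (\<lambda>(x, y). x(Suc n := y)) ` (SIGMA x:paths u n. nb (x n))"

lemma paths_props:
  assumes u: "u \<in> V" and x: "x \<in> paths u n"
  shows "x 0 = u" "\<And>i. i > n \<Longrightarrow> x i = 0" "\<And>i. i \<le> n \<Longrightarrow> x i \<in> V" "\<And>i. i < n \<Longrightarrow> {x i, x (Suc i)} \<in> E"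
proof -
  have "x 0 = u \<and> (\<forall>i>n. x i = 0) \<and> (\<forall>i\<le>n. x i \<in> V) \<and> (\<forall>i<n. {x i, x (Suc i)} \<in> E)"
    using x
  proof (induction n arbitrary: x)
    case 0
    then show ?case using u by simp
  next
    case (Suc n)
    then obtain x' y where x': "x' \<in> paths u n" "y \<in> nb (x' n)" "x = x'(Suc n := y)" by auto
    moreover have "y \<in> V" using x'(2) nb_V by blast
    ultimately show ?case
      using Suc.IH[OF x'(1)] by (auto simp: nb_iff le_Suc_eq less_Suc_eq)
  qed
  then show "x 0 = u" "\<And>i. i > n \<Longrightarrow> x i = 0" "\<And>i. i \<le> n \<Longrightarrow> x i \<in> V" "\<And>i. i < n \<Longrightarrow> {x i, x (Suc i)} \<in> E"
    by auto
qed

lemma finite_paths: "u \<in> V \<Longrightarrow> finite (paths u n)"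
proof (induction n)
  case (Suc n)
  have "finite (nb (x n))" if "x \<in> paths u n" for x
    using paths_props(3)[OF Suc.prems that, of n] finite_nb by simp
  then show ?case using Suc by auto
qed simp

definition path_prob :: "nat \<Rightarrow> (nat \<Rightarrow> complex) \<Rightarrow> real" where
  "path_prob n x = (\<Prod>i<n. p (x i) (x (Suc i)))"

lemma path_prob_nonneg: "u \<in> V \<Longrightarrow> x \<in> paths u n \<Longrightarrow> path_prob n x \<ge> 0"
  unfolding path_prob_def using paths_props(3) p_nonneg by (intro prod_nonneg) auto

text \<open>The Markov property for sums over paths: the last step is averaged separately.\<close>

lemma sum_paths_Suc:
  assumes u: "u \<in> V"
  shows "(\<Sum>x\<in>paths u (Suc n). path_prob (Suc n) x * \<phi> x)
    = (\<Sum>x\<in>paths u n. path_prob n x * (\<Sum>y\<in>nb (x n). p (x n) y * \<phi> (x(Suc n := y))))"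
proof -
  let ?S = "SIGMA x:paths u n. nb (x n)"
  have inj: "inj_on (\<lambda>(x, y). x(Suc n := y)) ?S"
  proof (rule inj_onI, clarify)
    fix x y x' y' assume x: "x \<in> paths u n" "x' \<in> paths u n" and eq: "x(Suc n := y) = x'(Suc n := y')"
    have "x i = x' i" for i
      using fun_cong[OF eq, of i] paths_props(2)[OF u x(1), of i] paths_props(2)[OF u x(2), of i]
      by (cases "i = Suc n") auto
    moreover have "y = y'" using fun_cong[OF eq, of "Suc n"] by simp
    ultimately show "x = x' \<and> y = y'" by auto
  qed
  have "(\<Sum>x\<in>paths u (Suc n). path_prob (Suc n) x * \<phi> x)
      = (\<Sum>(x, y)\<in>?S. path_prob (Suc n) (x(Suc n := y)) * \<phi> (x(Suc n := y)))"
    unfolding paths.simps sum.reindex[OF inj] by (intro sum.cong refl) auto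
  also have "\<dots> = (\<Sum>(x, y)\<in>?S. path_prob n x * (p (x n) y * \<phi> (x(Suc n := y))))"
  proof (intro sum.cong refl, clarify)
    fix x y
    have "path_prob (Suc n) (x(Suc n := y)) = path_prob n x * p (x n) y"
      unfolding path_prob_def by (simp add: prod.lessThan_Suc)
    then show "path_prob (Suc n) (x(Suc n := y)) * \<phi> (x(Suc n := y)) = path_prob n x * (p (x n) y * \<phi> (x(Suc n := y)))"
      by simp
  qed
  also have "\<dots> = (\<Sum>x\<in>paths u n. \<Sum>y\<in>nb (x n). path_prob n x * (p (x n) y * \<phi> (x(Suc n := y))))"
    using finite_paths[OF u] paths_props(3)[OF u] finite_nb by (intro sum.Sigma[symmetric]) auto
  finally show ?thesis by (simp add: sum_distrib_left)
qed

lemma sum_path_prob: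
  assumes u: "u \<in> V"
  shows "(\<Sum>x\<in>paths u n. path_prob n x) = 1"
proof (induction n)
  case 0
  then show ?case by (simp add: path_prob_def)
next
  case (Suc n)
  have "(\<Sum>x\<in>paths u (Suc n). path_prob (Suc n) x)
      = (\<Sum>x\<in>paths u n. path_prob n x * (\<Sum>y\<in>nb (x n). p (x n) y))"
    using sum_paths_Suc[OF u, of n "\<lambda>_. 1"] by simp
  also have "\<dots> = (\<Sum>x\<in>paths u n. path_prob n x)"
    using paths_props(3)[OF u] sum_p by (intro sum.cong) auto
  finally show ?case using Suc by simp
qed

definition cyl :: "nat \<Rightarrow> (nat \<Rightarrow> complex) \<Rightarrow> (nat \<Rightarrow> complex) set" where
  "cyl n x = {X. \<forall>i\<le>n. X i = x i}"

lemma emeasure_cyl: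
  assumes "u \<in> V" "x \<in> paths u n"
  shows "emeasure (walk_law wt E u) (cyl n x) = ennreal (path_prob n x)"
  unfolding cyl_def emeasure_walk_law_cylinder path_prob_def
  using paths_props[OF assms] by (auto intro!: arg_cong[where f = ennreal] prod.cong pmf_step)

lemma cyl_disjoint:
  assumes "u \<in> V" "x \<in> paths u n" "y \<in> paths u n" "x \<noteq> y"
  shows "cyl n x \<inter> cyl n y = {}"
proof (rule ccontr)
  assume "cyl n x \<inter> cyl n y \<noteq> {}"
  then obtain X where "\<forall>i\<le>n. X i = x i" "\<forall>i\<le>n. X i = y i" by (auto simp: cyl_def)
  then have "x i = y i" for i
    using paths_props(2)[OF assms(1,2), of i] paths_props(2)[OF assms(1,3), of i] by (cases "i \<le> n") auto
  then show False using assms(4) by auto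
qed

text \<open>The cylinders over the finitely many paths of length \<open>n\<close> are disjoint, and
  their probabilities add up to 1.\<close>

lemma AE_in_cyl:
  assumes u: "u \<in> V"
  shows "AE X in walk_law wt E u. \<exists>x\<in>paths u n. X \<in> cyl n x"
proof -
  interpret P: prob_space "walk_law wt E u" by (rule prob_space_walk_law)
  have sets: "cyl n x \<in> sets (walk_law wt E u)" for x
    unfolding cyl_def by (rule cylinder_sets)
  have "emeasure (walk_law wt E u) (\<Union>x\<in>paths u n. cyl n x) = (\<Sum>x\<in>paths u n. emeasure (walk_law wt E u) (cyl n x))"
    using finite_paths[OF u] sets cyl_disjoint[OF u]
    by (intro sum_emeasure[symmetric]) (auto simp: disjoint_family_on_def)
  also have "\<dots> = ennreal (\<Sum>x\<in>paths u n. path_prob n x)"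
    using emeasure_cyl[OF u] path_prob_nonneg[OF u] by (simp add: sum_ennreal)
  also have "\<dots> = 1" using sum_path_prob[OF u] by simp
  finally have "P.prob (\<Union>x\<in>paths u n. cyl n x) = 1" by (simp add: measure_def)
  then have "AE X in walk_law wt E u. X \<in> (\<Union>x\<in>paths u n. cyl n x)"
    using finite_paths[OF u] sets by (subst P.prob_eq_1[symmetric]) auto
  then show ?thesis by simp
qed

text \<open>As \<open>\<Phi> n\<close> depends on the first \<open>n + 1\<close> positions only, it
  almost surely agrees with a combination \<open>\<Psi> n\<close> of indicators of cylinders. This
  also takes care of measurability.\<close>

lemma nn_integral_walk_suminf:
  fixes \<Phi> :: "nat \<Rightarrow> (nat \<Rightarrow> complex) \<Rightarrow> ennreal"
  assumes u: "u \<in> V" and local: "\<And>n X Y. (\<And>i. i \<le> n \<Longrightarrow> X i = Y i) \<Longrightarrow> \<Phi> n X = \<Phi> n Y"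
  shows "(\<integral>\<^sup>+X. (\<Sum>n. \<Phi> n X) \<partial>walk_law wt E u) = (\<Sum>n. \<Sum>x\<in>paths u n. \<Phi> n x * ennreal (path_prob n x))"
proof -
  let ?M = "walk_law wt E u"
  have sets: "cyl n x \<in> sets ?M" for n x
    unfolding cyl_def by (rule cylinder_sets)
  define \<Psi> where "\<Psi> = (\<lambda>n X. \<Sum>x\<in>paths u n. \<Phi> n x * indicator (cyl n x) X)"
  have meas: "\<Psi> n \<in> borel_measurable ?M" for n
    unfolding \<Psi>_def
    by (intro borel_measurable_sum borel_measurable_times_ennreal borel_measurable_const
        borel_measurable_indicator sets)
  have eq: "\<Phi> n X = \<Psi> n X" if x: "x \<in> paths u n" "X \<in> cyl n x" for n X x
  proof -
    have "\<Psi> n X = (\<Sum>y\<in>{x}. \<Phi> n y * indicator (cyl n y) X)"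
      unfolding \<Psi>_def using x finite_paths[OF u] cyl_disjoint[OF u x(1)]
      by (intro sum.mono_neutral_right) (auto simp: indicator_def)
    also have "\<dots> = \<Phi> n x" using x(2) by simp
    also have "\<dots> = \<Phi> n X" using x(2) by (intro local) (simp add: cyl_def)
    finally show ?thesis by simp
  qed
  have "AE X in ?M. \<forall>n. \<Phi> n X = \<Psi> n X"
    unfolding AE_all_countable
  proof
    fix n
    show "AE X in ?M. \<Phi> n X = \<Psi> n X"
      using AE_in_cyl[OF u, of n] by (rule AE_mp) (use eq in auto)
  qed
  then have "(\<integral>\<^sup>+X. (\<Sum>n. \<Phi> n X) \<partial>?M) = (\<integral>\<^sup>+X. (\<Sum>n. \<Psi> n X) \<partial>?M)"
    by (intro nn_integral_cong_AE) (auto elim: AE_mp)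
  also have "\<dots> = (\<Sum>n. \<integral>\<^sup>+X. \<Psi> n X \<partial>?M)" using meas by (rule nn_integral_suminf)
  also have "\<dots> = (\<Sum>n. \<Sum>x\<in>paths u n. \<Phi> n x * ennreal (path_prob n x))"
  proof (intro suminf_cong)
    fix n
    have "(\<integral>\<^sup>+X. \<Psi> n X \<partial>?M) = (\<Sum>x\<in>paths u n. \<integral>\<^sup>+X. \<Phi> n x * indicator (cyl n x) X \<partial>?M)"
      unfolding \<Psi>_def
      by (intro nn_integral_sum borel_measurable_times_ennreal borel_measurable_const
          borel_measurable_indicator sets)
    also have "\<dots> = (\<Sum>x\<in>paths u n. \<Phi> n x * ennreal (path_prob n x))"
      using emeasure_cyl[OF u] sets by (intro sum.cong refl) (simp add: nn_integral_cmult_indicator)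
    finally show "(\<integral>\<^sup>+X. \<Psi> n X \<partial>?M) = (\<Sum>x\<in>paths u n. \<Phi> n x * ennreal (path_prob n x))" .
  qed
  finally show ?thesis .
qed

end

section \<open>The walk killed outside of a finite set\<close>

context dirichlet_problem
begin

text \<open>For \<open>u\<close> in \<open>B\<close>, the \<open>n\<close>-th power of the
  transition operator of the killed walk, applied to \<open>f\<close> and evaluated at
  \<open>u\<close>.\<close>

definition stopped :: "complex \<Rightarrow> nat \<Rightarrow> (complex \<Rightarrow> real) \<Rightarrow> real" where
  "stopped u n f = (\<Sum>x\<in>paths u n. path_prob n x * (if \<forall>i\<le>n. x i \<in> B then f (x n) else 0))"

definition exit_prob :: "complex \<Rightarrow> nat \<Rightarrow> real" where
  "exit_prob u n = (\<Sum>x\<in>paths u n. path_prob n x * (if (\<forall>i<n. x i \<in> B) \<and> x n \<notin> B then 1 else 0))"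

lemma stopped_0: "u \<in> B \<Longrightarrow> stopped u 0 f = f u"
  by (simp add: stopped_def path_prob_def)

lemma stopped_cong: "(\<And>x. x \<in> B \<Longrightarrow> f x = g x) \<Longrightarrow> stopped u n f = stopped u n g"
  unfolding stopped_def by (intro sum.cong refl) auto

lemma stopped_add: "stopped u n (\<lambda>x. f x + g x) = stopped u n f + stopped u n g"
  unfolding stopped_def sum.distrib[symmetric] by (intro sum.cong refl) (auto simp: algebra_simps)

lemma stopped_nonneg: "u \<in> V \<Longrightarrow> (\<And>x. f x \<ge> 0) \<Longrightarrow> stopped u n f \<ge> 0"
  unfolding stopped_def using path_prob_nonneg by (intro sum_nonneg) auto

lemma stopped_Suc:
  assumes u: "u \<in> V"
  shows "stopped u (Suc n) f = stopped u n (\<lambda>z. \<Sum>y\<in>nb z. p z y * (if y \<in> B then f y else 0))"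
  unfolding stopped_def sum_paths_Suc[OF u]
proof (intro sum.cong refl arg_cong2[where f = "(*)"])
  fix x assume "x \<in> paths u n"
  have "(\<forall>i\<le>Suc n. (x(Suc n := y)) i \<in> B) \<longleftrightarrow> (\<forall>i\<le>n. x i \<in> B) \<and> y \<in> B" for y
    by (auto simp: le_Suc_eq)
  then show "(\<Sum>y\<in>nb (x n). p (x n) y * (if \<forall>i\<le>Suc n. (x(Suc n := y)) i \<in> B then f ((x(Suc n := y)) (Suc n)) else 0))
      = (if \<forall>i\<le>n. x i \<in> B then \<Sum>y\<in>nb (x n). p (x n) y * (if y \<in> B then f y else 0) else 0)"
    by (auto intro!: sum.cong sum.neutral)
qed

lemma sum_stopped_eq_pot:
  assumes u: "u \<in> B"
  shows "(\<Sum>t<n. stopped u t f) = pot (\<lambda>x. deg x * f x) n u"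
proof -
  have uV: "u \<in> V" using u B by blast
  let ?H = "pot (\<lambda>x. deg x * f x)"
  \<comment> \<open>Generalised over \<open>k\<close>: the recursion of \<open>pot\<close> splits
    off the first of the remaining \<open>n\<close> steps, and \<open>stopped_Suc\<close> appends it
    to the initial \<open>k\<close> steps.\<close>
  have "stopped u k (?H n) = (\<Sum>t<n. stopped u (k + t) f)" for k
  proof (induction n arbitrary: k)
    case 0
    then show ?case by (simp add: stopped_def cong: if_cong)
  next
    case (Suc n)
    have "stopped u k (?H (Suc n)) = stopped u k (\<lambda>x. f x + (\<Sum>y\<in>nb x. p x y * (if y \<in> B then ?H n y else 0)))"
    proof (rule stopped_cong)
      fix x assume x: "x \<in> B"
      then have d: "deg x > 0" using deg_bounds(3) B by blast
      have "(\<Sum>y\<in>nb x. p x y * (if y \<in> B then ?H n y else 0)) = (\<Sum>y\<in>nb x. c x y * ?H n y) / deg x"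
        unfolding sum_divide_distrib using pot_outside by (intro sum.cong refl) (simp add: p_eq)
      then show "?H (Suc n) x = f x + (\<Sum>y\<in>nb x. p x y * (if y \<in> B then ?H n y else 0))"
        using x d by (simp add: add_divide_distrib)
    qed
    also have "\<dots> = stopped u k f + stopped u (Suc k) (?H n)"
      by (simp add: stopped_add stopped_Suc[OF uV])
    also have "\<dots> = (\<Sum>t<Suc n. stopped u (k + t) f)"
      by (simp only: Suc.IH sum.lessThan_Suc_shift) simp
    finally show ?case .
  qed
  from this[of 0] show ?thesis using stopped_0[OF u] by simp
qed

text \<open>Telescoping: the probability of leaving \<open>B\<close> at time \<open>n + 1\<close> is
  the loss of survival probability from time \<open>n\<close> to time \<open>n + 1\<close>.\<close>

lemma sum_exit_prob:
  assumes u: "u \<in> B"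
  shows "(\<Sum>t<n. exit_prob u t) \<le> 1"
proof -
  have uV: "u \<in> V" using u B by blast
  have step: "exit_prob u (Suc n) = stopped u n (\<lambda>_. 1) - stopped u (Suc n) (\<lambda>_. 1)" for n
  proof -
    have "exit_prob u (Suc n) + stopped u (Suc n) (\<lambda>_. 1)
        = (\<Sum>x\<in>paths u (Suc n). path_prob (Suc n) x * (if \<forall>i\<le>n. x i \<in> B then 1 else 0))"
      unfolding exit_prob_def stopped_def sum.distrib[symmetric]
      by (intro sum.cong refl) (auto simp: less_Suc_eq_le le_Suc_eq)
    also have "\<dots> = (\<Sum>x\<in>paths u n. path_prob n x * (\<Sum>y\<in>nb (x n). p (x n) y * (if \<forall>i\<le>n. (x(Suc n := y)) i \<in> B then 1 else 0)))"
      by (rule sum_paths_Suc[OF uV])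
    also have "\<dots> = stopped u n (\<lambda>_. 1)"
      unfolding stopped_def
    proof (intro sum.cong refl arg_cong2[where f = "(*)"])
      fix x assume "x \<in> paths u n"
      then have "(\<Sum>y\<in>nb (x n). p (x n) y) = 1" using sum_p paths_props(3)[OF uV] by blast
      moreover have "(\<forall>i\<le>n. (x(Suc n := y)) i \<in> B) \<longleftrightarrow> (\<forall>i\<le>n. x i \<in> B)" for y by auto
      ultimately show "(\<Sum>y\<in>nb (x n). p (x n) y * (if \<forall>i\<le>n. (x(Suc n := y)) i \<in> B then 1 else 0))
          = (if \<forall>i\<le>n. x i \<in> B then 1 else 0)"
        by (simp add: sum_distrib_right[symmetric])
    qed
    finally show ?thesis by simp
  qed
  have "(\<Sum>t<Suc n. exit_prob u t) = 1 - stopped u n (\<lambda>_. 1)" for n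
  proof (induction n)
    case 0
    then show ?case using u stopped_0[OF u] by (simp add: exit_prob_def)
  next
    case (Suc n)
    then show ?case using step[of n] by simp
  qed
  moreover have "stopped u n (\<lambda>_. 1) \<ge> 0" for n using stopped_nonneg[OF uV] by simp
  ultimately have "(\<Sum>t<Suc n. exit_prob u t) \<le> 1" for n by (metis diff_ge_0_iff_ge diff_diff_eq2 add_diff_cancel_left')
  then show ?thesis by (cases n) auto
qed

lemma le_hitting_time: "enat n \<le> hitting_time A X \<longleftrightarrow> (\<forall>i<n. X i \<notin> A)"
proof -
  have "enat n \<le> hitting_time A X \<longleftrightarrow> (\<forall>i. X i \<in> A \<longrightarrow> n \<le> i)"
    unfolding hitting_time_def by (auto simp: le_Inf_iff)
  then show ?thesis by (meson not_le)
qed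

text \<open>Time \<open>n\<close> counts if the walk has been in \<open>B\<close> before time
  \<open>n\<close>. Compared with the killed walk, this adds only the position at the exit, which
  contributes at most \<open>b\<close> and occurs at most once.\<close>

lemma expectation_bounds:
  assumes u: "u \<in> B" and Mb: "\<And>x. x \<in> vertex_boundary V E B \<Longrightarrow> m x \<le> b" "0 \<le> b"
  defines "\<E> \<equiv> \<integral>\<^sup>+X. isolation_sum V (hitting_time (vertex_boundary V E B) X) X \<partial>walk_law wt E u"
  shows "\<And>n. ennreal (pot (\<lambda>x. deg x * m x) n u) \<le> \<E>"
    and "(\<And>n. pot (\<lambda>x. deg x * m x) n u \<le> a) \<Longrightarrow> \<E> \<le> ennreal (a + b)"
    and "ennreal (m u) \<le> \<E>"
proof -
  have uV: "u \<in> V" using u B by blast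
  let ?A = "vertex_boundary V E B"
  define q where "q = (\<lambda>n. \<Sum>x\<in>paths u n. path_prob n x * (if \<forall>i<n. x i \<in> B then m (x n) else 0))"
  \<comment> \<open>A path from inside \<open>B\<close> can leave it only by stepping onto the
    vertex boundary, so hitting times translate into membership in \<open>B\<close>.\<close>
  have inB: "(\<forall>i<n. x i \<notin> ?A) \<longleftrightarrow> (\<forall>i<n. x i \<in> B)" if x: "x \<in> paths u n" for x n
  proof
    assume notA: "\<forall>i<n. x i \<notin> ?A"
    have "i < n \<Longrightarrow> x i \<in> B" for i
    proof (induction i)
      case 0
      then show ?case using u paths_props(1)[OF uV x] by simp
    next
      case (Suc i)
      then have "x i \<in> B" "x (Suc i) \<notin> ?A" "x (Suc i) \<in> V" "{x i, x (Suc i)} \<in> E"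
        using notA paths_props(3,4)[OF uV x] by auto
      then show ?case unfolding vertex_boundary_def by (auto simp: insert_commute)
    qed
    then show "\<forall>i<n. x i \<in> B" by blast
  qed (auto simp: vertex_boundary_def)
  have q_nonneg: "q n \<ge> 0" for n
    unfolding q_def using path_prob_nonneg[OF uV] by (intro sum_nonneg) auto
  have "\<E> = (\<integral>\<^sup>+X. (\<Sum>n. if \<forall>i<n. X i \<notin> ?A then ennreal (m (X n)) else 0) \<partial>walk_law wt E u)"
    by (simp add: \<E>_def isolation_sum_def le_hitting_time)
  also have "\<dots> = (\<Sum>n. \<Sum>x\<in>paths u n. (if \<forall>i<n. x i \<notin> ?A then ennreal (m (x n)) else 0) * ennreal (path_prob n x))"
    by (intro nn_integral_walk_suminf[OF uV]) auto
  also have "\<dots> = (\<Sum>n. ennreal (q n))"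
  proof (intro suminf_cong)
    fix n
    have "(\<Sum>x\<in>paths u n. (if \<forall>i<n. x i \<notin> ?A then ennreal (m (x n)) else 0) * ennreal (path_prob n x))
        = (\<Sum>x\<in>paths u n. ennreal (path_prob n x * (if \<forall>i<n. x i \<in> B then m (x n) else 0)))"
    proof (intro sum.cong refl)
      fix x assume x: "x \<in> paths u n"
      show "(if \<forall>i<n. x i \<notin> ?A then ennreal (m (x n)) else 0) * ennreal (path_prob n x)
          = ennreal (path_prob n x * (if \<forall>i<n. x i \<in> B then m (x n) else 0))"
        unfolding inB[OF x] using path_prob_nonneg[OF uV x]
        by (cases "\<forall>i<n. x i \<in> B") (simp_all only: if_True if_False, simp_all add: ennreal_mult mult.commute)
    qed
    also have "\<dots> = ennreal (q n)"
      unfolding q_def using path_prob_nonneg[OF uV] by (intro sum_ennreal) auto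
    finally show "(\<Sum>x\<in>paths u n. (if \<forall>i<n. x i \<notin> ?A then ennreal (m (x n)) else 0) * ennreal (path_prob n x)) = ennreal (q n)" .
  qed
  finally have E: "\<E> = (SUP n. \<Sum>t<n. ennreal (q t))" by (simp add: suminf_eq_SUP)
  have sum_q: "(\<Sum>t<n. ennreal (q t)) = ennreal (\<Sum>t<n. q t)" for n
    using q_nonneg by (intro sum_ennreal) auto
  have low: "stopped u t m \<le> q t" for t
    unfolding stopped_def q_def using path_prob_nonneg[OF uV] by (intro sum_mono mult_left_mono) auto
  have up: "q t \<le> stopped u t m + b * exit_prob u t" for t
    unfolding stopped_def q_def exit_prob_def sum_distrib_left sum.distrib[symmetric]
  proof (rule sum_mono)
    fix x assume x: "x \<in> paths u t"
    have pp: "path_prob t x \<ge> 0" using path_prob_nonneg[OF uV x] .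
    have le: "(\<forall>i\<le>t. x i \<in> B) \<longleftrightarrow> (\<forall>i<t. x i \<in> B) \<and> x t \<in> B" by (auto simp: le_less)
    have "m (x t) \<le> b" if xB: "\<forall>i<t. x i \<in> B" "x t \<notin> B"
    proof -
      obtain t' where t': "t = Suc t'" using xB u paths_props(1)[OF uV x] by (cases t) auto
      have "x t \<in> ?A"
        using xB paths_props(3,4)[OF uV x] unfolding vertex_boundary_def t'
        by (auto simp: insert_commute intro!: bexI[of _ "x t'"])
      then show ?thesis using Mb by blast
    qed
    then have "(if \<forall>i<t. x i \<in> B then m (x t) else 0) \<le> (if \<forall>i\<le>t. x i \<in> B then m (x t) else 0)
        + b * (if (\<forall>i<t. x i \<in> B) \<and> x t \<notin> B then 1 else 0)"
      unfolding le by auto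
    then have "path_prob t x * (if \<forall>i<t. x i \<in> B then m (x t) else 0) \<le> path_prob t x *
      ((if \<forall>i\<le>t. x i \<in> B then m (x t) else 0) + b * (if (\<forall>i<t. x i \<in> B) \<and> x t \<notin> B then 1 else 0))"
      using pp by (rule mult_left_mono)
    then show "path_prob t x * (if \<forall>i<t. x i \<in> B then m (x t) else 0) \<le> path_prob t x *
      (if \<forall>i\<le>t. x i \<in> B then m (x t) else 0) + b * (path_prob t x * (if (\<forall>i<t. x i \<in> B) \<and> x t \<notin> B then 1 else 0))"
      by (simp add: algebra_simps)
  qed
  show lower: "ennreal (pot (\<lambda>x. deg x * m x) n u) \<le> \<E>" for n
  proof -
    have "pot (\<lambda>x. deg x * m x) n u \<le> (\<Sum>t<n. q t)"
      unfolding sum_stopped_eq_pot[OF u, symmetric] using low by (rule sum_mono)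
    then have "ennreal (pot (\<lambda>x. deg x * m x) n u) \<le> (\<Sum>t<n. ennreal (q t))"
      unfolding sum_q by (rule ennreal_leI)
    also have "\<dots> \<le> \<E>" unfolding E by (rule SUP_upper) simp
    finally show ?thesis .
  qed
  have "ennreal (m u) = (\<Sum>t<Suc 0. ennreal (q t))" by (simp add: q_def path_prob_def)
  also have "\<dots> \<le> \<E>" unfolding E by (rule SUP_upper) simp
  finally show "ennreal (m u) \<le> \<E>" .
  assume a: "\<And>n. pot (\<lambda>x. deg x * m x) n u \<le> a"
  show "\<E> \<le> ennreal (a + b)"
    unfolding E
  proof (rule SUP_least)
    fix n
    have "(\<Sum>t<n. q t) \<le> (\<Sum>t<n. stopped u t m) + b * (\<Sum>t<n. exit_prob u t)"
      unfolding sum_distrib_left sum.distrib[symmetric] using up by (rule sum_mono)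
    also have "\<dots> \<le> a + b * 1"
      unfolding sum_stopped_eq_pot[OF u] using a sum_exit_prob[OF u] Mb(2) by (intro add_mono mult_left_mono)
    finally show "(\<Sum>t<n. ennreal (q t)) \<le> ennreal (a + b)" unfolding sum_q by (simp add: ennreal_leI)
  qed
qed

end

section \<open>The bounds on the expectation\<close>

context good_graph
begin

text \<open>The first term bounds the expectation from above: \<open>1024 * K ^ 10\<close> for the
  killed walk, and \<open>K\<^sup>2 \<le> K ^ 10\<close> for the exit position. The other two terms
  belong to the lower bound, for large \<open>r\<close> and for \<open>r\<close> comparable to
  \<open>rad u\<close>.\<close>

definition C' :: real where "C' = 1025 * K ^ 10 + K / c2 + ((1 + K) / \<Theta>)\<^sup>2"

lemma C'_bounds: "1 \<le> C'" "1025 * K ^ 10 \<le> C'" "1 / C' \<le> c2 / K" "1 / C' \<le> (\<Theta> / (1 + K))\<^sup>2"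
proof -
  have K1: "K \<ge> 1" using K_bounds(1) .
  have K10: "1 \<le> K ^ 10" using K1 by simp
  have pos: "K / c2 > 0" "((1 + K) / \<Theta>)\<^sup>2 > 0" using K1 c2 Theta by auto
  show "1 \<le> C'" "1025 * K ^ 10 \<le> C'" using pos K10 unfolding C'_def by linarith+
  have ge: "K / c2 \<le> C'" "((1 + K) / \<Theta>)\<^sup>2 \<le> C'" using pos K10 unfolding C'_def by linarith+
  have "1 / C' \<le> 1 / (K / c2)" by (intro divide_left_mono mult_pos_pos) (use ge pos in linarith)+
  then show "1 / C' \<le> c2 / K" by simp
  have "1 / C' \<le> 1 / ((1 + K) / \<Theta>)\<^sup>2" by (intro divide_left_mono mult_pos_pos) (use ge pos in linarith)+
  then show "1 / C' \<le> (\<Theta> / (1 + K))\<^sup>2" by (simp add: power_divide)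
qed

end

lemma (in weighted_graph) exit_time_bounds:
  assumes u: "u \<in> V" and r: "rad u \<le> r" and carr: "cball u ((K + 6) * r) \<subseteq> carr E"
  defines "\<E> \<equiv> \<integral>\<^sup>+X. isolation_sum V (hitting_time (vertex_boundary V E (V_euc V u r)) X) X \<partial>walk_law wt E u"
  shows "ennreal (1 / C' * r\<^sup>2) \<le> \<E> \<and> \<E> \<le> ennreal (C' * r\<^sup>2)"
proof -
  have K1: "K \<ge> 1" using K_bounds(1) .
  have r0: "r > 0" using r rad_pos[OF u] by linarith
  have "1 * r \<le> (K + 6) * r" using K1 r0 by (intro mult_right_mono) auto
  then have carr1: "cball u r \<subseteq> carr E" using carr by (auto simp: subset_iff)
  interpret dirichlet_problem D \<eta> V E wt "V_euc V u r"
    by unfold_locales (use finite_V_euc[OF carr1] in \<open>auto simp: V_euc_def\<close>)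
  let ?B = "V_euc V u r"
  let ?s = "\<lambda>x. deg x * m x"
  have uB: "u \<in> ?B" using u r0 by (simp add: V_euc_def)
  have sum_m: "(\<Sum>x\<in>?B. m x) \<le> 16 * r\<^sup>2" using sum_m_V_euc[OF u r B(2)] by simp
  have FK: "(\<Sum>x\<in>?B. m x * (f x)\<^sup>2) \<le> 16 * K ^ 8 * (\<Sum>x | x \<in> ?B \<and> f x > 0. m x) * En f f"
    if "\<And>x. f x \<ge> 0" "\<And>x. x \<notin> ?B \<Longrightarrow> f x = 0" for f
    using faber_krahn[OF u r _ carr that] by simp
  have boundary: "m x \<le> K\<^sup>2 * r\<^sup>2" if x: "x \<in> vertex_boundary V E ?B" for x
  proof -
    obtain y where y: "y \<in> ?B" "{x, y} \<in> E" using x by (auto simp: vertex_boundary_def)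
    have "rad x \<le> dist x y" using rad_le_edge[OF y(2)] .
    also have "\<dots> \<le> K * rad y" using edge_le_rad_K[of y x] y(2) by (simp add: insert_commute dist_commute)
    also have "\<dots> \<le> K * r" using rad_le_radius[OF u r y(1)] K1 by (intro mult_left_mono) auto
    finally have "rad x \<le> K * r" .
    then have "m x \<le> (K * r)\<^sup>2" using rad_pos edge_ends(1)[OF y(2)] by (intro power_mono) (auto simp: less_imp_le)
    then show ?thesis by (simp add: power_mult_distrib)
  qed
  define s where "s = (\<lambda>x. if x \<in> ?B then ?s x else 0)"
  have s_nonneg: "s x \<ge> 0" for x
    using deg_bounds(3)[of x] B by (auto simp: s_def intro!: mult_nonneg_nonneg intro: less_imp_le)
  have pot_s: "pot ?s n = pot s n" for n
    by (induction n) (auto simp: s_def)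
  have pot_le: "pot s n x \<le> 1024 * K ^ 10 * r\<^sup>2" for n x
  proof -
    have "pot s n x \<le> 4 * K\<^sup>2 * (16 * K ^ 8) * (\<Sum>x\<in>?B. m x)"
    proof (rule pot_bounded[OF s_nonneg _ _ _ FK])
      fix x assume x: "x \<in> ?B"
      then have "x \<in> V" using B by blast
      then have "deg x * m x \<le> K\<^sup>2 * m x" using deg_bounds(2) by (intro mult_right_mono) auto
      then show "s x \<le> K\<^sup>2 * m x" using x by (simp add: s_def)
    qed (use K1 in auto)
    also have "\<dots> \<le> 4 * K\<^sup>2 * (16 * K ^ 8) * (16 * r\<^sup>2)"
      using sum_m K1 by (intro mult_left_mono) auto
    also have "\<dots> = 1024 * K ^ 10 * r\<^sup>2"
      by (simp add: mult_ac flip: power_add)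
    finally show ?thesis .
  qed
  note bounds = expectation_bounds[OF uB boundary, folded \<E>_def]
  have "\<E> \<le> ennreal (1024 * K ^ 10 * r\<^sup>2 + K\<^sup>2 * r\<^sup>2)"
    using pot_le by (intro bounds(2)) (auto simp: pot_s)
  also have "\<dots> \<le> ennreal (C' * r\<^sup>2)"
  proof (rule ennreal_leI)
    have "K\<^sup>2 \<le> K ^ 10" using K1 by (intro power_increasing) auto
    then have "1024 * K ^ 10 + K\<^sup>2 \<le> C'" using C'_bounds(2) by linarith
    then have "(1024 * K ^ 10 + K\<^sup>2) * r\<^sup>2 \<le> C' * r\<^sup>2" by (intro mult_right_mono) auto
    then show "1024 * K ^ 10 * r\<^sup>2 + K\<^sup>2 * r\<^sup>2 \<le> C' * r\<^sup>2" by (simp add: distrib_right)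
  qed
  finally have upper: "\<E> \<le> ennreal (C' * r\<^sup>2)" .
  have lower: "ennreal (1 / C' * r\<^sup>2) \<le> \<E>"
  proof (cases "(1 + K) * rad u \<le> \<Theta> * r")
    case False
    then have "\<Theta> / (1 + K) * r \<le> rad u" using K1 by (simp add: field_simps)
    then have "(\<Theta> / (1 + K) * r)\<^sup>2 \<le> m u" using Theta K1 r0 by (intro power_mono) auto
    moreover have "1 / C' * r\<^sup>2 \<le> (\<Theta> / (1 + K))\<^sup>2 * r\<^sup>2" using C'_bounds(4) by (intro mult_right_mono) auto
    ultimately have "1 / C' * r\<^sup>2 \<le> m u" unfolding power_mult_distrib by linarith
    then have "ennreal (1 / C' * r\<^sup>2) \<le> ennreal (m u)" by (rule ennreal_leI)
    also have "\<dots> \<le> \<E>" by (rule bounds(3)) auto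
    finally show ?thesis .
  next
    case True
    define \<delta>\<^sub>u :: "complex \<Rightarrow> real" where "\<delta>\<^sub>u = (\<lambda>x. if x = u then 1 else 0)"
    have du: "\<delta>\<^sub>u x \<ge> 0" for x by (simp add: \<delta>\<^sub>u_def)
    have mu: "m u > 0" using rad_pos[OF u] by simp
    \<comment> \<open>The factor \<open>1 / m u\<close> dominates the point source at
      \<open>u\<close> by a multiple of \<open>m\<close>. The bound makes the iterates converge to
      the Green function.\<close>
    have bound: "pot \<delta>\<^sub>u n x \<le> 4 * (1 / m u) * (16 * K ^ 8) * (\<Sum>x\<in>?B. m x)" for n x
      by (rule pot_bounded[OF du _ _ _ FK]) (use K1 mu in \<open>auto simp: \<delta>\<^sub>u_def\<close>)
    have "\<exists>g. (\<forall>x. g x \<ge> 0) \<and> (\<forall>x. x \<notin> ?B \<longrightarrow> g x = 0) \<and> (\<forall>x\<in>?B. Lap g x = \<delta>\<^sub>u x)"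
    proof (rule pot_limit[OF du bound])
      fix g assume "\<And>x. g x \<ge> 0" "\<And>x. x \<notin> ?B \<Longrightarrow> g x = 0" "\<And>x. x \<in> ?B \<Longrightarrow> Lap g x = \<delta>\<^sub>u x"
      then show ?thesis by auto
    qed
    then obtain g where g: "\<And>x. g x \<ge> 0" "\<And>x. x \<notin> ?B \<Longrightarrow> g x = 0" "\<And>x. x \<in> ?B \<Longrightarrow> Lap g x = \<delta>\<^sub>u x"
      by auto
    obtain h where h: "\<And>x. (\<lambda>n. pot s n x) \<longlonglongrightarrow> h x" "\<And>x. h x \<ge> 0"
      "\<And>x. x \<notin> ?B \<Longrightarrow> h x = 0" "\<And>x. x \<in> ?B \<Longrightarrow> Lap h x = s x"
      using pot_limit[OF s_nonneg pot_le] by metis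
    have mass: "c2 * r\<^sup>2 \<le> (\<Sum>x\<in>?B. m x * g x)"
      by (rule green_mass[OF u refl carr1 r g(1,2) _ True]) (use g(3) in \<open>auto simp: \<delta>\<^sub>u_def\<close>)
    \<comment> \<open>Symmetry of the Green function in terms of energy: testing the equation of
      \<open>g\<close> with \<open>h\<close> gives \<open>h u\<close>, and testing that of
      \<open>h\<close> with \<open>g\<close> gives the sum of \<open>s\<close> against
      \<open>g\<close>.\<close>
    have "h u = En g h" using En_eq[of h g] h(3) g(3) uB B by (simp add: \<delta>\<^sub>u_def if_distrib sum.delta cong: if_cong sum.cong)
    also have "\<dots> = En h g" by (rule En_sym)
    also have "\<dots> = (\<Sum>x\<in>?B. g x * s x)" using En_eq[of g h] g(2) h(4) by simp
    finally have hu: "h u = (\<Sum>x\<in>?B. g x * s x)" .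
    have "c2 / K * r\<^sup>2 = 1 / K * (c2 * r\<^sup>2)" by simp
    also have "\<dots> \<le> 1 / K * (\<Sum>x\<in>?B. m x * g x)" using mass K1 by (intro mult_left_mono) auto
    also have "\<dots> = (\<Sum>x\<in>?B. g x * (1 / K * m x))" by (simp add: sum_distrib_left mult_ac)
    also have "\<dots> \<le> (\<Sum>x\<in>?B. g x * s x)"
    proof (rule sum_mono)
      fix x assume x: "x \<in> ?B"
      then have "x \<in> V" using B by blast
      then have "1 / K * m x \<le> s x"
        using deg_bounds(1) x unfolding s_def by (simp only: if_True) (intro mult_right_mono, auto)
      then show "g x * (1 / K * m x) \<le> g x * s x" using g(1) by (rule mult_left_mono)
    qed
    finally have "c2 / K * r\<^sup>2 \<le> h u" using hu by simp
    moreover have "1 / C' * r\<^sup>2 \<le> c2 / K * r\<^sup>2" using C'_bounds(3) by (intro mult_right_mono) auto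
    ultimately have "ennreal (1 / C' * r\<^sup>2) \<le> ennreal (h u)" by (intro ennreal_leI) linarith
    also have "\<dots> \<le> \<E>"
    proof (rule LIMSEQ_le_const2)
      show "(\<lambda>n. ennreal (pot s n u)) \<longlonglongrightarrow> ennreal (h u)" using h(1) by (rule tendsto_ennrealI)
      show "\<exists>N. \<forall>n\<ge>N. ennreal (pot s n u) \<le> \<E>" using bounds(1) by (simp add: pot_s)
    qed
    finally show ?thesis .
  qed
  show ?thesis using lower upper by blast
qed

lemma good_embedding_mono:
  assumes "good_embedding D \<eta> V E" "\<eta>' \<le> \<eta>"
  shows "good_embedding D \<eta>' V E"
proof -
  have "angle_at v a b \<le> pi - \<eta>'" if "angle_at v a b \<le> pi - \<eta>" for v a b
    using that assms(2) by linarith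
  then show ?thesis
    using assms(1) unfolding good_embedding_def inner_angles_bounded_def by blast
qed

theorem theorem1p5:
  fixes D \<eta> :: real
  assumes "D > 1" and "\<eta> > 0"
  shows "\<exists>C C' :: real. C \<ge> 1 \<and> C' \<ge> 1 \<and>
    (\<forall>V E wt. good_embedding D \<eta> V E \<longrightarrow> (\<forall>e\<in>E. wt e \<in> {1 / D .. D}) \<longrightarrow>
      (\<forall>u\<in>V. \<forall>r \<ge> isolation_radius V u. cball u (C * r) \<subseteq> carr E \<longrightarrow>
        (let T = hitting_time (vertex_boundary V E (V_euc V u r));
             \<E> = \<integral>\<^sup>+X. isolation_sum V (T X) X \<partial>walk_law wt E u
         in ennreal (1 / C' * r\<^sup>2) \<le> \<E> \<and> \<E> \<le> ennreal (C' * r\<^sup>2))))"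
proof (cases "\<exists>V E. good_embedding D \<eta> V E")
  \<comment> \<open>The bounds on the constants are facts of the locale \<open>good_graph\<close>,
    which takes an embedding; if there is none, nothing is claimed and any constants will
    do.\<close>
  case False
  then show ?thesis by (intro exI[of _ 1]) simp
next
  case True
  \<comment> \<open>Lowering \<open>\<eta>\<close> weakens the condition on the angles, and a value
    of at most 1 makes its cosine nonnegative.\<close>
  define \<eta>' where "\<eta>' = min \<eta> 1"
  have eta': "0 < \<eta>'" "\<eta>' \<le> 1" "\<eta>' \<le> \<eta>" using assms by (auto simp: \<eta>'_def)
  have loc: "good_graph D \<eta>' V E" if "good_embedding D \<eta> V E" for V E
    using good_embedding_mono[OF that eta'(3)] assms eta' by unfold_locales
  define A\<^sub>1 where "A\<^sub>1 = good_graph.K D \<eta>' + 6"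
  define A\<^sub>2 where "A\<^sub>2 = good_graph.C' D \<eta>'"
  obtain V\<^sub>0 E\<^sub>0 where "good_embedding D \<eta> V\<^sub>0 E\<^sub>0" using True by blast
  then interpret G0: good_graph D \<eta>' V\<^sub>0 E\<^sub>0 by (rule loc)
  have "A\<^sub>1 \<ge> 1" "A\<^sub>2 \<ge> 1" using G0.K_bounds(1) G0.C'_bounds(1) by (auto simp: A\<^sub>1_def A\<^sub>2_def)
  moreover have "ennreal (1 / A\<^sub>2 * r\<^sup>2) \<le> \<E> \<and> \<E> \<le> ennreal (A\<^sub>2 * r\<^sup>2)"
    if "good_embedding D \<eta> V E" "\<forall>e\<in>E. wt e \<in> {1 / D .. D}" "u \<in> V" "isolation_radius V u \<le> r"
      "cball u (A\<^sub>1 * r) \<subseteq> carr E"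
      "\<E> = (\<integral>\<^sup>+X. isolation_sum V (hitting_time (vertex_boundary V E (V_euc V u r)) X) X \<partial>walk_law wt E u)"
    for V E wt u r \<E>
  proof -
    interpret good_graph D \<eta>' V E using that(1) by (rule loc)
    interpret weighted_graph D \<eta>' V E wt using that(2) by unfold_locales auto
    show ?thesis using exit_time_bounds[OF that(3,4)] that(5,6) by (simp add: A\<^sub>1_def A\<^sub>2_def)
  qed
  ultimately show ?thesis unfolding Let_def by blast
qed

end
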